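(* Let $T>0$, $m\ge 2$ an integer, and $\varepsilon\in(0,1]$. Assume (A) and (B) (see context). Let $\Phi^{[n]}$ be the semi-discrete Strang splitting approximation defined by $\Phi^{[0]}=\Phi_0$ and $\Phi^{[n+1]}=\mathcal{S}_\tau(\Phi^{[n]}):=e^{\frac{\tau}{2}\mathbf{T}}e^{\varepsilon\tau\mathbf{V}}e^{\frac{\tau}{2}\mathbf{T}}\Phi^{[n]}$. Then there is a constant $C_1>0$ independent of $\tau$, $n$ and $\varepsilon$ such that $$\|\Phi(t_n,\cdot)-\Phi^{[n]}\|_{L^2}\le C_1\varepsilon t_n\tau^2\le C_1T\tau^2,\qquad 0\le n\le \frac{T/\varepsilon}{\tau}.$$
   Context: Let $\Omega=(a,b)$ with periodic boundary conditions. Consider the 1D Dirac equation for $\Phi(t,x)=(\phi_1,\phi_2)^T\in\mathbb{C}^2$: $i\partial_t\Phi=(-i\sigma_1\partial_x+\sigma_3)\Phi+\varepsilon(V(x)I_2-A_1(x)\sigma_1)\Phi$ for $x\in\Omega$, $t>0$, with $\Phi(t,a)=\Phi(t,b)$ and $\Phi(0,x)=\Phi_0(x)$, $\Phi_0(a)=\Phi_0(b)$, where $V,A_1$ are real-valued, time-independent, $\varepsilon\in(0,1]$, $I_2$ is the $2\times2$ identity and $\sigma_1=\begin{pmatrix}0&1\\1&0\end{pmatrix}$, $\sigma_3=\begin{pmatrix}1&0\\0&-1\end{pmatrix}$. Define operators $\mathbf{T}:=-\sigma_1\partial_x-i\sigma_3$ and $\mathbf{V}:=-i(V(x)I_2-A_1(x)\sigma_1)$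 (multiplication), so the equation reads $\partial_t\Phi=(\mathbf{T}+\varepsilon\mathbf{V})\Phi$. For $\tau>0$, $t_n=n\tau$. $H^m_{\rm per}(\Omega)=\{u\in H^m(\Omega):\partial_x^lu(a)=\partial_x^lu(b),\ 0\le l\le m-1\}$ and $W^{m,\infty}_{\rm per}(\Omega)$ analogously; $\|\cdot\|_{L^2}$ is the $L^2(\Omega)$ norm of $\mathbb{C}^2$-valued functions. Assumption (A): $V,A_1\in W^{m,\infty}_{\rm per}(\Omega)$. Assumption (B): with $T_\varepsilon=T/\varepsilon$, the exact solution satisfies $\|\Phi\|_{L^\infty([0,T_\varepsilon];(H^m_{\rm per}(\Omega))^2)}\le K$ for a constant $K$ independent of $\varepsilon$. Constants may depend on $T$, $K$, $m$, $V$, $A_1$, $\Omega$. *)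

theory Defs
  imports "HOL-Analysis.Analysis"
begin

text \<open>Functions on the periodic domain (a,b) are represented as (b-a)-periodic
functions on the real line; C^2-valued functions take values in complex^2.\<close>

definition sigma1 :: "complex^2^2" where
  "sigma1 = (\<chi> i j. if i = j then 0 else 1)"

definition sigma3 :: "complex^2^2" where
  "sigma3 = (\<chi> i j. if i = j then (if i = 1 then 1 else -1) else 0)"

text \<open>Matrix of the zeroth-order part of T = -sigma1 d/dx - i sigma3.\<close>
definition massmat :: "complex^2^2" where
  "massmat = (\<chi> i j. - \<i> * sigma3 $ i $ j)"

definition Vmat :: "(real \<Rightarrow> real) \<Rightarrow> (real \<Rightarrow> real) \<Rightarrow> real \<Rightarrow> complex^2^2" where
  "Vmat V A1 x = (\<chi> i j. - \<i> * (complex_of_real (V x) * (if i = j then 1 else 0)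
                                   - complex_of_real (A1 x) * sigma1 $ i $ j))"

primrec mpow :: "complex^2^2 \<Rightarrow> nat \<Rightarrow> complex^2^2" where
  "mpow A 0 = mat 1"
| "mpow A (Suc k) = A ** mpow A k"

definition mexp :: "complex^2^2 \<Rightarrow> complex^2^2" where
  "mexp A = (\<Sum>k. (1 / fact k) *\<^sub>R mpow A k)"

definition periodic_fun :: "real \<Rightarrow> real \<Rightarrow> (real \<Rightarrow> 'a) \<Rightarrow> bool" where
  "periodic_fun a b u \<longleftrightarrow> (\<forall>x. u (x + (b - a)) = u x)"

definition classical_sol ::
  "real \<Rightarrow> real \<Rightarrow> real \<Rightarrow> real \<Rightarrow> (real \<Rightarrow> complex^2^2) \<Rightarrow> (real \<Rightarrow> real \<Rightarrow> complex^2) \<Rightarrow> bool" where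
  "classical_sol a b t0 t1 F \<Psi> \<longleftrightarrow>
     (\<forall>s\<in>{t0..t1}. periodic_fun a b (\<Psi> s)) \<and>
     (\<exists>\<Psi>t \<Psi>x.
        (\<forall>s\<in>{t0..t1}. \<forall>x. ((\<lambda>r. \<Psi> r x) has_vector_derivative \<Psi>t s x) (at s within {t0..t1})) \<and>
        (\<forall>s\<in>{t0..t1}. \<forall>x. (\<Psi> s has_vector_derivative \<Psi>x s x) (at x)) \<and>
        continuous_on ({t0..t1} \<times> UNIV) (\<lambda>(s, x). \<Psi>t s x) \<and>
        continuous_on ({t0..t1} \<times> UNIV) (\<lambda>(s, x). \<Psi>x s x) \<and>
        (\<forall>s\<in>{t0..t1}. \<forall>x. \<Psi>t s x = - (sigma1 *v \<Psi>x s x) + massmat *v \<Psi> s x + F x *v \<Psi> s x))"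

text \<open>The free Dirac flow e^{tT} (t \<ge> 0): value at time t of the classical solution
  of d/dt Psi = T Psi with initial data u.\<close>
definition expT :: "real \<Rightarrow> real \<Rightarrow> real \<Rightarrow> (real \<Rightarrow> complex^2) \<Rightarrow> (real \<Rightarrow> complex^2)" where
  "expT a b t u = (THE w. \<exists>\<Psi>. classical_sol a b 0 t (\<lambda>x. 0) \<Psi> \<and> \<Psi> 0 = u \<and> \<Psi> t = w)"

primrec strang :: "real \<Rightarrow> real \<Rightarrow> real \<Rightarrow> real \<Rightarrow> (real \<Rightarrow> real) \<Rightarrow> (real \<Rightarrow> real)
                   \<Rightarrow> (real \<Rightarrow> complex^2) \<Rightarrow> nat \<Rightarrow> (real \<Rightarrow> complex^2)" where
  "strang a b \<epsilon> \<tau> V A1 \<Phi>0 0 = \<Phi>0"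
| "strang a b \<epsilon> \<tau> V A1 \<Phi>0 (Suc n) =
     expT a b (\<tau> / 2)
       (\<lambda>x. mexp ((\<epsilon> * \<tau>) *\<^sub>R Vmat V A1 x) *v expT a b (\<tau> / 2) (strang a b \<epsilon> \<tau> V A1 \<Phi>0 n) x)"

text \<open>Sobolev-type derivative chains on the line: D 0 = u, D (k+1) is the
  (weak) derivative of D k, i.e. D k is absolutely continuous with
  D k y - D k x = integral of D (k+1) over [x,y], for k < m.\<close>
definition deriv_chain :: "real \<Rightarrow> real \<Rightarrow> nat \<Rightarrow> (real \<Rightarrow> 'a::real_normed_vector)
                            \<Rightarrow> (nat \<Rightarrow> real \<Rightarrow> 'a) \<Rightarrow> bool" where
  "deriv_chain a b m u D \<longleftrightarrow>
     D 0 = u \<and> periodic_fun a b u \<and>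
     (\<forall>k<m. \<forall>x y. x \<le> y \<longrightarrow> (D (Suc k) has_integral (D k y - D k x)) {x..y}) \<and>
     D m \<in> borel_measurable lborel"

definition Hm_bounded :: "real \<Rightarrow> real \<Rightarrow> nat \<Rightarrow> real \<Rightarrow> (real \<Rightarrow> complex^2) \<Rightarrow> bool" where
  "Hm_bounded a b m K u \<longleftrightarrow>
     (\<exists>D. deriv_chain a b m u D \<and>
          set_integrable lborel {a..b} (\<lambda>x. (norm (D m x))\<^sup>2) \<and>
          sqrt (\<Sum>k\<le>m. LINT x:{a..b}|lborel. (norm (D k x))\<^sup>2) \<le> K)"

definition W_per :: "real \<Rightarrow> real \<Rightarrow> nat \<Rightarrow> (real \<Rightarrow> real) \<Rightarrow> bool" where
  "W_per a b m f \<longleftrightarrow>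
     (\<exists>D. deriv_chain a b m f D \<and> (\<exists>M. AE x in lborel. \<bar>D m x\<bar> \<le> M))"

definition L2norm :: "real \<Rightarrow> real \<Rightarrow> (real \<Rightarrow> complex^2) \<Rightarrow> real" where
  "L2norm a b u = sqrt (LINT x:{a..b}|lborel. (norm (u x))\<^sup>2)"

definition dirac_solution :: "real \<Rightarrow> real \<Rightarrow> real \<Rightarrow> (real \<Rightarrow> real) \<Rightarrow> (real \<Rightarrow> real)
                              \<Rightarrow> real \<Rightarrow> (real \<Rightarrow> real \<Rightarrow> complex^2) \<Rightarrow> bool" where
  "dirac_solution a b \<epsilon> V A1 Tend \<Phi> \<longleftrightarrow> classical_sol a b 0 Tend (\<lambda>x. \<epsilon> *\<^sub>R Vmat V A1 x) \<Phi>"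

end

theory Submission
  imports Defs
begin

text \<open>All estimates are in the real inner product of \<open>L\<^sup>2\<close>, for which \<open>\<^bold>T\<close> and \<open>\<^bold>V\<close> are skew-adjoint. Hence
  the free flow and the Strang step are isometries, and it suffices to bound the error of one step by
  \<open>C \<epsilon> \<tau>\<^sup>3\<close>. Conjugated by the free flow around the midpoint of the step, the equation becomes \<open>Z' = \<epsilon> \<^bold>B(s) Z\<close>
  and the Strang step its exponential midpoint rule. Since \<open>\<^bold>V\<close> commutes with \<open>\<sigma>\<^sub>1\<close>, the commutator \<open>[\<^bold>V, \<^bold>T]\<close>
  is multiplication by a Lipschitz matrix, so \<open>\<^bold>B\<close> has an expansion to second order in \<open>s\<close> on functions that
  are Lipschitz under translations in \<open>L\<^sup>2\<close>. That property follows from the \<open>H\<^sup>1\<close> bound and, unlike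
  derivatives of the solution, is trivially preserved by the free flow. The defect is estimated by duality,
  which leaves only scalar functions of time to differentiate.\<close>

section \<open>Spinor algebra and the exponential of the potential\<close>

text \<open>A second time derivative of the conjugated potential would be a double commutator: a
  first-order operator containing second derivatives of \<open>V\<close> and \<open>A1\<close>,
  which for \<open>m = 2\<close> exist only almost everywhere. The expansion therefore stops at the
  single commutator, and its remainder is measured by increments of the free flow. In the decisive
  pairings the second argument is a transport of the defect, of which only the L^2 norm is
  available, so every derivative has to be moved onto the solution. The half steps are given by a
  definite description, so existence of the free flow must be shown along with uniqueness. An
  explicit formula with the Klein-Gordon kernel provides it for C^1 data and both signs of time. The
  interaction picture moves at speed proportional to \<open>\<epsilon>\<close>, which puts the
  factor \<open>\<epsilon>\<close> into the local error. Since a step is exactly norm preserving, n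
  steps cost at most n times \<open>C * \<epsilon> * \<tau>^3\<close>, and this stays of order
  \<open>\<tau>^2\<close> up to time \<open>T / \<epsilon>\<close>.\<close>

definition scal_J :: "complex^2 \<Rightarrow> complex^2" where
  "scal_J v = (\<chi> i. - \<i> * v $ i)"

definition flip :: "complex^2 \<Rightarrow> complex^2" where
  "flip v = sigma1 *v v"

definition mass :: "complex^2 \<Rightarrow> complex^2" where
  "mass v = massmat *v v"

text \<open>This is multiplication by i times \<open>sigma1\<close>, the coefficient of
  \<open>A1\<close> in the potential. Treating it and \<open>scal_J\<close> as real-linear maps fits
  the real inner product used throughout.\<close>

definition flip_J :: "complex^2 \<Rightarrow> complex^2" where
  "flip_J v = - scal_J (flip v)"

lemma spinor_nth [simp]:
  "flip v $ 1 = v $ 2" "flip v $ 2 = v $ 1"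
  "mass v $ 1 = - \<i> * v $ 1" "mass v $ 2 = \<i> * v $ 2"
  "scal_J v $ i = - \<i> * v $ i"
  "flip_J v $ 1 = \<i> * v $ 2" "flip_J v $ 2 = \<i> * v $ 1"
  by (simp_all add: flip_def mass_def scal_J_def flip_J_def matrix_vector_mult_def sigma1_def
      sigma3_def massmat_def sum_2)

lemmas spinor_simps = vec_eq_iff forall_2 inner_vec_def sum_2 inner_complex_def

lemma spinor_inner:
  "flip v \<bullet> w = v \<bullet> flip w" "mass v \<bullet> w = - (v \<bullet> mass w)"
  "scal_J v \<bullet> w = - (v \<bullet> scal_J w)" "flip_J v \<bullet> w = - (v \<bullet> flip_J w)"
  by (simp_all add: spinor_simps)

lemma spinor_mult:
  "flip (flip v) = v" "mass (mass v) = - v" "scal_J (scal_J v) = - v" "flip_J (flip_J v) = - v"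
  "mass (flip v) = - flip (mass v)" "mass (scal_J v) = scal_J (mass v)"
  "flip (scal_J v) = scal_J (flip v)" "flip (flip_J v) = flip_J (flip v)"
  "scal_J (flip_J v) = flip_J (scal_J v)"
  by (simp_all add: spinor_simps)

lemma spinor_norm [simp]:
  "norm (flip v) = norm v" "norm (mass v) = norm v" "norm (scal_J v) = norm v"
  "norm (flip_J v) = norm v"
  by (simp_all add: norm_eq_sqrt_inner spinor_inner spinor_mult)

lemma bounded_linear_flip: "bounded_linear flip"
  and bounded_linear_mass: "bounded_linear mass"
  and bounded_linear_scal_J: "bounded_linear scal_J"
  and bounded_linear_flip_J: "bounded_linear flip_J"
  by (rule bounded_linear_intro[where K=1]; simp add: spinor_simps algebra_simps)+

lemmas spinor_bounded_linear =
  bounded_linear_flip bounded_linear_mass bounded_linear_scal_J bounded_linear_flip_J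

lemmas spinor_linear =
  spinor_bounded_linear[THEN bounded_linear.linear, THEN linear_add]
  spinor_bounded_linear[THEN bounded_linear.linear, THEN linear_diff]
  spinor_bounded_linear[THEN bounded_linear.linear, THEN linear_neg]
  spinor_bounded_linear[THEN bounded_linear.linear, THEN linear_0]
  spinor_bounded_linear[THEN bounded_linear.linear, THEN linear_scale]

lemmas spinor_continuous [continuous_intros] =
  bounded_linear.continuous_on[OF bounded_linear_flip]
  bounded_linear.continuous_on[OF bounded_linear_mass]
  bounded_linear.continuous_on[OF bounded_linear_scal_J]
  bounded_linear.continuous_on[OF bounded_linear_flip_J]

lemmas spinor_has_vector_derivative =
  bounded_linear.has_vector_derivative[OF bounded_linear_flip]
  bounded_linear.has_vector_derivative[OF bounded_linear_mass]
  bounded_linear.has_vector_derivative[OF bounded_linear_scal_J]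
  bounded_linear.has_vector_derivative[OF bounded_linear_flip_J]

lemma Vmat_mult: "Vmat V A1 x *v v = V x *\<^sub>R scal_J v + A1 x *\<^sub>R flip_J v"
  by (simp add: vec_eq_iff forall_2 Vmat_def matrix_vector_mult_def sum_2 sigma1_def
      scaleR_conv_of_real[where 'a=complex] algebra_simps)

text \<open>The exponentials of \<^term>\<open>scal_J\<close> and \<^term>\<open>flip_J\<close>, both of which square to minus the identity.\<close>

definition rotor :: "real \<Rightarrow> real \<Rightarrow> complex^2 \<Rightarrow> complex^2" where
  "rotor p q v = (let w = cos q *\<^sub>R v + sin q *\<^sub>R flip_J v in cos p *\<^sub>R w + sin p *\<^sub>R scal_J w)"

text \<open>\<open>A\<close> and \<open>B\<close> are the spectral projections of
  \<open>sigma1\<close> for the eigenvalues 1 and -1. They are idempotent with product zero, so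
  powers act on the two coefficients separately and the matrix series splits into two scalar
  exponential series.\<close>

lemma mexp_spectral:
  fixes A B z w
  defines "A \<equiv> (\<chi> i j. (1/2 :: complex)) :: complex^2^2"
    and "B \<equiv> (\<chi> i j. if i = j then 1/2 else - 1/2) :: complex^2^2"
  shows "mexp (\<chi> i j. z * A $ i $ j + w * B $ i $ j) = (\<chi> i j. exp z * A $ i $ j + exp w * B $ i $ j)"
proof -
  define F where "F z w = (\<chi> i j. z * A $ i $ j + w * B $ i $ j)" for z w
  have mult: "F z w ** F x y = F (z * x) (w * y)" for z w x y
    by (simp add: F_def A_def B_def vec_eq_iff forall_2 matrix_matrix_mult_def sum_2 field_simps)
  have pow: "mpow (F z w) k = F (z^k) (w^k)" for k
  proof (induction k)
    case 0
    show ?case by (simp add: F_def A_def B_def vec_eq_iff forall_2 mat_def)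
  next
    case (Suc k)
    then show ?case by (simp add: mult)
  qed
  have F_lim: "(\<lambda>n. F (X n) (Y n)) \<longlonglongrightarrow> F x y" if "X \<longlonglongrightarrow> x" "Y \<longlonglongrightarrow> y" for X Y x y
    unfolding F_def by (intro vec_tendstoI) (simp, intro tendsto_intros that)
  have F_sum: "(\<Sum>k<n. (1 / fact k) *\<^sub>R F (z^k) (w^k))
      = F (\<Sum>k<n. z^k /\<^sub>R fact k) (\<Sum>k<n. w^k /\<^sub>R fact k)" for n
    by (induction n) (simp_all add: F_def vec_eq_iff algebra_simps divide_inverse_commute)
  have "(\<lambda>k. (1 / fact k) *\<^sub>R F (z^k) (w^k)) sums F (exp z) (exp w)"
    unfolding sums_def F_sum using exp_converges[of z] exp_converges[of w]
    by (intro F_lim) (simp_all add: sums_def)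
  then show ?thesis
    unfolding mexp_def F_def[symmetric] pow by (simp add: sums_iff)
qed

lemma mexp_Vmat: "mexp (r *\<^sub>R Vmat V A1 x) *v v = rotor (r * V x) (r * A1 x) v"
proof -
  \<comment> \<open>The eigenvalues of the scaled potential matrix on the eigenspaces of
    \<open>sigma1\<close> for 1 and -1.\<close>
  define z w where "z = - \<i> * of_real (r * V x) + \<i> * of_real (r * A1 x)"
    and "w = - \<i> * of_real (r * V x) - \<i> * of_real (r * A1 x)"
  have "r *\<^sub>R Vmat V A1 x = (\<chi> i j. z * (\<chi> i j. 1/2 :: complex^2^2) $ i $ j
      + w * (\<chi> i j. if i = j then 1/2 else - 1/2 :: complex^2^2) $ i $ j)"
    by (simp add: vec_eq_iff forall_2 Vmat_def sigma1_def z_def w_def scaleR_conv_of_real[where 'a=complex] field_simps)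
  then have "mexp (r *\<^sub>R Vmat V A1 x) = (\<chi> i j. exp z * (\<chi> i j. 1/2 :: complex^2^2) $ i $ j
      + exp w * (\<chi> i j. if i = j then 1/2 else - 1/2 :: complex^2^2) $ i $ j)"
    by (simp only: mexp_spectral)
  moreover have "exp z = cis (- (r * V x)) * cis (r * A1 x)" "exp w = cis (- (r * V x)) * cis (- (r * A1 x))"
    unfolding z_def w_def cis_conv_exp exp_add[symmetric]
    by (rule arg_cong[where f = exp], simp add: algebra_simps)+
  ultimately show ?thesis
    by (simp add: vec_eq_iff forall_2 matrix_vector_mult_def sum_2 rotor_def Let_def complex_eq_iff
        scaleR_conv_of_real[where 'a=complex]) (simp add: field_simps)
qed

section \<open>Periodic functions and their inner product\<close>

lemma mvt_bound:
  fixes f :: "real \<Rightarrow> 'a::real_normed_vector"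
  assumes "\<And>r. r \<in> S \<Longrightarrow> (f has_vector_derivative f' r) (at r within S)"
    and "\<And>r. r \<in> S \<Longrightarrow> norm (f' r) \<le> B" and "convex S" "s \<in> S" "t \<in> S"
  shows "norm (f t - f s) \<le> B * \<bar>t - s\<bar>"
proof -
  have "norm (f t - f s) \<le> B * norm (t - s)"
  proof (rule differentiable_bound[OF \<open>convex S\<close>, where f' = "\<lambda>r h. h *\<^sub>R f' r"])
    show "(f has_derivative (\<lambda>h. h *\<^sub>R f' r)) (at r within S)" if "r \<in> S" for r
      using assms(1)[OF that] by (simp add: has_vector_derivative_def)
    show "onorm (\<lambda>h. h *\<^sub>R f' r) \<le> B" if "r \<in> S" for r
      using assms(2)[OF that] by (intro onorm_le) (simp add: mult_right_mono mult.commute[of "\<bar>_\<bar>"])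
  qed (use assms in auto)
  then show ?thesis by simp
qed

lemma has_vector_derivative_shift:
  assumes "(u has_vector_derivative u') (at (x + h))"
  shows "((\<lambda>x. u (x + h)) has_vector_derivative u') (at x)"
proof -
  have "((\<lambda>x. x + h) has_vector_derivative 1) (at x)"
    by (auto intro!: derivative_eq_intros)
  from vector_diff_chain_at[OF this, of u u'] assms show ?thesis by (simp add: o_def)
qed

locale period_cell =
  fixes a b :: real
  assumes ab: "a < b"
begin

definition cper :: "(real \<Rightarrow> 'a::real_normed_vector) \<Rightarrow> bool" where
  "cper u \<longleftrightarrow> continuous_on UNIV u \<and> periodic_fun a b u"

text \<open>The regularity class of the argument: on it the free flow is a classical solution, and
  each Strang step maps it to itself.\<close>

definition c1per :: "(real \<Rightarrow> 'a::real_normed_vector) \<Rightarrow> bool" where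
  "c1per u \<longleftrightarrow> periodic_fun a b u \<and>
     (\<exists>u'. continuous_on UNIV u' \<and> (\<forall>x. (u has_vector_derivative u' x) (at x)))"

definition ip :: "(real \<Rightarrow> 'a::euclidean_space) \<Rightarrow> (real \<Rightarrow> 'a) \<Rightarrow> real" where
  "ip u v = integral {a..b} (\<lambda>x. u x \<bullet> v x)"

definition nrm :: "(real \<Rightarrow> 'a::euclidean_space) \<Rightarrow> real" where
  "nrm u = sqrt (ip u u)"

section \<open>Closure properties of the function classes\<close>

lemma cper_continuous: "cper u \<Longrightarrow> continuous_on S u"
  by (auto simp: cper_def intro: continuous_on_subset)

lemma cper_add: "cper u \<Longrightarrow> cper v \<Longrightarrow> cper (\<lambda>x. u x + v x)"
  and cper_diff: "cper u \<Longrightarrow> cper v \<Longrightarrow> cper (\<lambda>x. u x - v x)"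
  and cper_scale: "cper u \<Longrightarrow> cper (\<lambda>x. c *\<^sub>R u x)"
  and cper_scaleR: "cper f \<Longrightarrow> cper u \<Longrightarrow> cper (\<lambda>x. f x *\<^sub>R u x)"
  and cper_const: "cper (\<lambda>x. z)"
  by (auto simp: cper_def periodic_fun_def intro!: continuous_intros)

lemma cper_shift:
  assumes "cper u"
  shows "cper (\<lambda>x. u (x + h))"
proof -
  have "u (x + (b - a) + h) = u (x + h)" for x
    using assms unfolding cper_def periodic_fun_def by (metis add.assoc add.commute)
  moreover have "continuous_on UNIV (\<lambda>x. u (x + h))"
    by (rule continuous_on_compose2[OF cper_continuous[OF assms]]) (auto intro!: continuous_intros)
  ultimately show ?thesis by (simp add: cper_def periodic_fun_def)
qed

lemma cper_linear: "bounded_linear L \<Longrightarrow> cper u \<Longrightarrow> cper (\<lambda>x. L (u x))"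
  by (auto simp: cper_def periodic_fun_def intro: bounded_linear.continuous_on)

lemma c1per_cper: "c1per u \<Longrightarrow> cper u"
  unfolding cper_def c1per_def
  by (metis continuous_at_imp_continuous_on has_vector_derivative_continuous)

lemma vector_derivative_periodic:
  assumes "periodic_fun a b u" "\<And>x. (u has_vector_derivative u' x) (at x)"
  shows "periodic_fun a b u'"
  unfolding periodic_fun_def
proof
  fix x
  have "((\<lambda>x. u (x + (b - a))) has_vector_derivative u' (x + (b - a))) (at x)"
    by (rule has_vector_derivative_shift[OF assms(2)])
  moreover have "(\<lambda>x. u (x + (b - a))) = u" using assms(1) by (auto simp: periodic_fun_def)
  ultimately show "u' (x + (b - a)) = u' x"
    using assms(2) vector_derivative_unique_at by metis
qed

lemma c1perE:
  assumes "c1per u"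
  obtains u' where "cper u'" "\<And>x. (u has_vector_derivative u' x) (at x)"
proof -
  obtain u' where "continuous_on UNIV u'" "\<And>x. (u has_vector_derivative u' x) (at x)"
    using assms by (auto simp: c1per_def)
  then show ?thesis
    using that[of u'] vector_derivative_periodic[of u u'] assms by (simp add: c1per_def cper_def)
qed

lemma c1perI:
  "periodic_fun a b u \<Longrightarrow> (\<And>x. (u has_vector_derivative u' x) (at x)) \<Longrightarrow> continuous_on UNIV u' \<Longrightarrow> c1per u"
  unfolding c1per_def by blast

lemma c1per_diff:
  assumes "c1per u" "c1per v"
  shows "c1per (\<lambda>x. u x - v x)"
proof -
  obtain u' v' where "cper u'" "\<And>x. (u has_vector_derivative u' x) (at x)"
    "cper v'" "\<And>x. (v has_vector_derivative v' x) (at x)"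
    using assms c1perE by metis
  then show ?thesis
    using cper_diff[OF assms[THEN c1per_cper]]
    by (intro c1perI[where u' = "\<lambda>x. u' x - v' x"] derivative_intros cper_continuous cper_diff)
      (auto simp: cper_def)
qed

lemma c1per_linear:
  assumes "bounded_linear L" "c1per u"
  shows "c1per (\<lambda>x. L (u x))"
proof -
  obtain u' where u': "cper u'" "\<And>x. (u has_vector_derivative u' x) (at x)"
    using assms c1perE by blast
  then have "((\<lambda>x. L (u x)) has_vector_derivative L (u' x)) (at x)" for x
    using bounded_linear.has_vector_derivative[OF assms(1)] by blast
  then show ?thesis
    using cper_linear[OF assms(1) c1per_cper[OF assms(2)]] cper_linear[OF assms(1) \<open>cper u'\<close>]
    by (intro c1perI[where u' = "\<lambda>x. L (u' x)"]) (simp_all add: cper_def)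
qed

lemma c1per_scaleR:
  assumes "c1per f" "c1per u"
  shows "c1per (\<lambda>x. f x *\<^sub>R u x)"
proof -
  obtain u' f' where d: "cper u'" "\<And>x. (u has_vector_derivative u' x) (at x)"
    "cper f'" "\<And>x. (f has_vector_derivative f' x) (at x)"
    using assms c1perE by metis
  then have "((\<lambda>x. f x *\<^sub>R u x) has_vector_derivative f x *\<^sub>R u' x + f' x *\<^sub>R u x) (at x)" for x
    by (intro has_vector_derivative_scaleR) (auto simp: has_real_derivative_iff_has_vector_derivative)
  then show ?thesis
    using cper_scaleR[OF assms[THEN c1per_cper]] d assms[THEN c1per_cper]
    by (intro c1perI[where u' = "\<lambda>x. f x *\<^sub>R u' x + f' x *\<^sub>R u x"])
      (auto simp: cper_def intro!: continuous_intros)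
qed

lemma c1per_add:
  assumes "c1per u" "c1per v"
  shows "c1per (\<lambda>x. u x + v x)"
proof -
  obtain u' v' where "cper u'" "\<And>x. (u has_vector_derivative u' x) (at x)"
    "cper v'" "\<And>x. (v has_vector_derivative v' x) (at x)"
    using assms c1perE by metis
  then show ?thesis
    using cper_add[OF assms[THEN c1per_cper]]
    by (intro c1perI[where u' = "\<lambda>x. u' x + v' x"] derivative_intros cper_continuous cper_add)
      (auto simp: cper_def)
qed

lemma c1per_shift:
  assumes "c1per u"
  shows "c1per (\<lambda>x. u (x + h))"
proof -
  obtain u' where u': "cper u'" "\<And>x. (u has_vector_derivative u' x) (at x)"
    using assms c1perE by blast
  have "((\<lambda>x. u (x + h)) has_vector_derivative u' (x + h)) (at x)" for x
    by (rule has_vector_derivative_shift[OF u'(2)])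
  then show ?thesis using cper_shift[OF c1per_cper[OF assms]] cper_shift[OF u'(1)]
    by (intro c1perI) (auto simp: cper_def)
qed

lemma periodic_reduce:
  assumes "periodic_fun a b u"
  obtains y where "y \<in> {a..b}" "u y = u x"
proof -
  have nat: "u (z + real k * (b - a)) = u z" for z k
  proof (induction k)
    case (Suc k)
    have "u (z + real (Suc k) * (b - a)) = u (z + real k * (b - a) + (b - a))"
      by (simp add: algebra_simps)
    then show ?case using Suc assms by (simp add: periodic_fun_def)
  qed simp
  define n where "n = \<lfloor>(x - a) / (b - a)\<rfloor>"
  define y where "y = x - of_int n * (b - a)"
  have "of_int n \<le> (x - a) / (b - a)" "(x - a) / (b - a) < of_int n + 1"
    unfolding n_def by linarith+
  then have "y \<in> {a..b}"
    using ab by (simp add: y_def field_simps)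
  moreover have "u y = u x"
  \<comment> \<open>\<open>nat\<close> only adds periods, so for negative \<open>n\<close> the chain
    runs from \<open>x\<close> up to \<open>y\<close> instead of from \<open>y\<close> up to
    \<open>x\<close>.\<close>
  proof (cases "n \<ge> 0")
    case True
    then show ?thesis using nat[of y "nat n"] by (simp add: y_def)
  next
    case False
    then show ?thesis using nat[of x "nat (- n)"] by (simp add: y_def)
  qed
  ultimately show ?thesis using that by blast
qed

lemma cper_bounded:
  assumes "cper u"
  obtains B where "B \<ge> 0" "\<And>x. norm (u x) \<le> B"
proof -
  have "compact (u ` {a..b})"
    by (intro compact_continuous_image cper_continuous assms) auto
  then obtain B where B: "\<And>x. x \<in> {a..b} \<Longrightarrow> norm (u x) \<le> B"
    using compact_imp_bounded bounded_iff by (metis imageI)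
  have "norm (u x) \<le> B" for x
    using periodic_reduce[of u x] assms B unfolding cper_def by metis
  moreover from this have "B \<ge> 0" by (meson norm_ge_zero order_trans)
  ultimately show ?thesis using that by blast
qed

text \<open>The piece of the shifted interval beyond \<open>b\<close> is moved back by one period; a
  shift by at most one period needs a single wrap-around.\<close>

lemma integral_shift_period:
  fixes f :: "real \<Rightarrow> 'a::euclidean_space"
  assumes "cper f" "0 \<le> h" "h \<le> b - a"
  shows "integral {a..b} (\<lambda>x. f (x + h)) = integral {a..b} f"
proof -
  have int: "f integrable_on {c..d}" for c d
    by (intro integrable_continuous_real cper_continuous assms)
  have "integral {a..b} (\<lambda>x. f (x + h)) = integral {a + h..b + h} f"
    using integral_shift_real_ivl[of "a + h" h "b + h" f] by simp
  also have "\<dots> = integral {a + h..b} f + integral {b..b + h} f"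
    using assms by (subst Henstock_Kurzweil_Integration.integral_combine[OF _ _ int]) auto
  also have "integral {b..b + h} f = integral {a..a + h} (\<lambda>x. f (x + (b - a)))"
    using integral_shift_real_ivl[of b "b - a" "b + h" f] by (simp add: algebra_simps)
  also have "(\<lambda>x. f (x + (b - a))) = f" using assms by (auto simp: cper_def periodic_fun_def)
  also have "integral {a + h..b} f + integral {a..a + h} f = integral {a..b} f"
    using assms by (subst add.commute, subst Henstock_Kurzweil_Integration.integral_combine[OF _ _ int]) auto
  finally show ?thesis .
qed

lemma integrable_inner: "cper u \<Longrightarrow> cper v \<Longrightarrow> (\<lambda>x. u x \<bullet> v x) integrable_on {c..d}"
  by (intro integrable_continuous_real continuous_intros cper_continuous)

section \<open>The real L^2 pairing over one period\<close>

lemma ip_commute: "ip u v = ip v u"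
  by (simp add: ip_def inner_commute)

lemma ip_linear:
  assumes "cper u" "cper v" "cper w"
  shows "ip (\<lambda>x. u x + v x) w = ip u w + ip v w" "ip (\<lambda>x. u x - v x) w = ip u w - ip v w"
    "ip (\<lambda>x. c *\<^sub>R u x) w = c * ip u w"
    "ip w (\<lambda>x. u x + v x) = ip w u + ip w v" "ip w (\<lambda>x. u x - v x) = ip w u - ip w v"
    "ip w (\<lambda>x. c *\<^sub>R u x) = c * ip w u"
  using assms
  by (simp_all add: ip_def inner_add_left inner_diff_left inner_add_right inner_diff_right
      Henstock_Kurzweil_Integration.integral_add Henstock_Kurzweil_Integration.integral_diff
      integrable_inner)

lemma ip_ge_0: "0 \<le> ip u u"
  \<comment> \<open>A non-integrable integrand has integral 0 by convention, so no regularity of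
    \<open>u\<close> enters.\<close>
  unfolding ip_def by (cases "(\<lambda>x. u x \<bullet> u x) integrable_on {a..b}")
    (auto intro: integral_nonneg simp: not_integrable_integral)

lemma nrm_ge_0 [simp]: "0 \<le> nrm u"
  by (simp add: nrm_def ip_ge_0)

lemma nrm_square: "(nrm u)\<^sup>2 = ip u u"
  by (simp add: nrm_def ip_ge_0)

lemma ip_Cauchy_Schwarz:
  assumes "cper u" "cper v"
  shows "\<bar>ip u v\<bar> \<le> nrm u * nrm v"
proof -
  define A B C where "A = ip u u" and "B = ip u v" and "C = ip v v"
  have q: "0 \<le> A + 2 * t * B + t\<^sup>2 * C" for t
  proof -
    have tv: "cper (\<lambda>x. t *\<^sub>R v x)" using assms cper_scale by blast
    have "0 \<le> ip (\<lambda>x. u x + t *\<^sub>R v x) (\<lambda>x. u x + t *\<^sub>R v x)" by (rule ip_ge_0)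
    also have "\<dots> = A + 2 * t * B + t\<^sup>2 * C"
      using assms tv by (simp add: ip_linear cper_add A_def B_def C_def ip_commute[of v u]
          power2_eq_square algebra_simps)
    finally show ?thesis .
  qed
  have "B\<^sup>2 \<le> A * C"
  proof (cases "C = 0")
    case True
    have "B = 0"
    proof (rule ccontr)
      assume "B \<noteq> 0"
      \<comment> \<open>For \<open>C = 0\<close> the quadratic degenerates to an affine function of
        \<open>t\<close>; this choice of \<open>t\<close> gives it the value -1.\<close>
      with q[of "- (A + 1) / (2 * B)"] True show False by (simp add: field_simps)
    qed
    then show ?thesis using True by simp
  next
    case False
    then have "C > 0" using ip_ge_0[of v] by (simp add: C_def)
    with q[of "- B / C"] show ?thesis by (simp add: field_simps power2_eq_square)
  qed
  then have "sqrt (B\<^sup>2) \<le> sqrt (A * C)" by (rule real_sqrt_le_mono)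
  then show ?thesis by (simp add: nrm_def A_def B_def C_def real_sqrt_mult)
qed

lemma nrm_triangle:
  assumes "cper u" "cper v"
  shows "nrm (\<lambda>x. u x + v x) \<le> nrm u + nrm v" "nrm (\<lambda>x. u x - v x) \<le> nrm u + nrm v"
proof -
  have "(nrm (\<lambda>x. u x + v x))\<^sup>2 \<le> (nrm u + nrm v)\<^sup>2" "(nrm (\<lambda>x. u x - v x))\<^sup>2 \<le> (nrm u + nrm v)\<^sup>2"
    using assms ip_Cauchy_Schwarz[OF assms]
    by (simp_all add: nrm_square ip_linear cper_add cper_diff ip_commute[of v u] power2_sum)
  then show "nrm (\<lambda>x. u x + v x) \<le> nrm u + nrm v" "nrm (\<lambda>x. u x - v x) \<le> nrm u + nrm v"
    by (auto intro: power2_le_imp_le)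
qed

lemma nrm_mono:
  assumes "cper u" "cper v" "\<And>x. norm (u x) \<le> c * norm (v x)" "0 \<le> c"
  shows "nrm u \<le> c * nrm v"
proof -
  have "ip u u \<le> integral {a..b} (\<lambda>x. c\<^sup>2 * (v x \<bullet> v x))"
    unfolding ip_def
  proof (rule integral_le)
    show "u x \<bullet> u x \<le> c\<^sup>2 * (v x \<bullet> v x)" for x
      using power_mono[OF assms(3)[of x], of 2] by (simp add: power_mult_distrib power2_norm_eq_inner)
  qed (use assms in \<open>auto intro!: integrable_inner integrable_on_mult_right\<close>)
  also have "\<dots> = c\<^sup>2 * ip v v" by (simp add: ip_def)
  finally have "sqrt (ip u u) \<le> sqrt (c\<^sup>2 * ip v v)" by (rule real_sqrt_le_mono)
  then show ?thesis using assms(4) by (simp add: nrm_def real_sqrt_mult)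
qed

lemma nrm_cong_norm: "(\<And>x. norm (u x) = norm (v x)) \<Longrightarrow> nrm u = nrm v"
  by (simp add: nrm_def ip_def flip: power2_norm_eq_inner)

lemma nrm_eq_0D:
  assumes "cper u" "nrm u = 0"
  shows "u = (\<lambda>x. 0)"
proof
  fix x
  define f where "f = (\<lambda>x. u x \<bullet> u x)"
  have f: "cper f" using assms(1) unfolding f_def cper_def periodic_fun_def
    by (auto intro!: continuous_intros)
  have "integral {a..b} f = 0" using assms(2) by (simp add: nrm_def ip_def f_def)
  then have z: "\<And>x. x \<in> {a..b} \<Longrightarrow> u x = 0"
    using integral_eq_0_iff[OF cper_continuous[OF f] ab] by (auto simp: f_def)
  show "u x = 0"
    using periodic_reduce[of u x] assms z unfolding cper_def by metis
qed

lemma ip_shift: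
  assumes "cper u" "cper v" "0 \<le> h" "h \<le> b - a"
  shows "ip (\<lambda>x. u (x + h)) (\<lambda>x. v (x + h)) = ip u v"
proof -
  have "cper (\<lambda>x. u x \<bullet> v x)" using assms unfolding cper_def periodic_fun_def
    by (auto intro!: continuous_intros)
  from integral_shift_period[OF this assms(3,4)] show ?thesis by (simp add: ip_def)
qed

text \<open>For a continuous integrand the Lebesgue and the gauge integral agree. This links the
  norm of the statement to the one used in the estimates.\<close>

lemma L2norm_eq_nrm:
  assumes "cper u"
  shows "L2norm a b u = nrm u"
proof -
  have "continuous_on {a..b} (\<lambda>x. (norm (u x))\<^sup>2)"
    by (intro continuous_intros cper_continuous assms)
  then have "set_integrable lborel {a..b} (\<lambda>x. (norm (u x))\<^sup>2)"
    using borel_integrable_atLeastAtMost' by blast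
  then show ?thesis
    by (simp add: L2norm_def nrm_def ip_def set_borel_integral_eq_integral power2_norm_eq_inner)
qed

end

section \<open>The Klein-Gordon kernel\<close>

text \<open>\<open>bessel0 z\<close> is \<open>J\<^sub>0 (\<surd>z)\<close>: it turns the Klein-Gordon kernel \<open>J\<^sub>0 (\<surd>(t\<^sup>2 - y\<^sup>2)) / 2\<close> into an entire
  function of \<open>t\<close> and \<open>y\<close>.\<close>

definition bessel_coeff :: "nat \<Rightarrow> real" where
  "bessel_coeff n = (-1/4) ^ n / (fact n)\<^sup>2"

definition bessel0 :: "real \<Rightarrow> real" where
  "bessel0 z = (\<Sum>n. bessel_coeff n * z ^ n)"

definition bessel0' :: "real \<Rightarrow> real" where
  "bessel0' z = (\<Sum>n. diffs bessel_coeff n * z ^ n)"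

definition bessel0'' :: "real \<Rightarrow> real" where
  "bessel0'' z = (\<Sum>n. diffs (diffs bessel_coeff) n * z ^ n)"

lemma summable_bessel_coeff: "summable (\<lambda>n. bessel_coeff n * z ^ n)"
proof (rule summable_comparison_test'[OF summable_exp[of "\<bar>z / 4\<bar>"], of 0])
  fix n :: nat
  have "\<bar>z / 4\<bar> ^ n / (fact n)\<^sup>2 \<le> \<bar>z / 4\<bar> ^ n / fact n"
    by (intro divide_left_mono) (auto simp: power2_eq_square fact_ge_1)
  then show "norm (bessel_coeff n * z ^ n) \<le> inverse (fact n) * \<bar>z / 4\<bar> ^ n"
    by (simp add: bessel_coeff_def abs_mult power_abs power_divide divide_simps power_mult_distrib)
qed

lemma summable_bessel_diffs:
  "summable (\<lambda>n. diffs bessel_coeff n * z ^ n)" "summable (\<lambda>n. diffs (diffs bessel_coeff) n * z ^ n)"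
  by (intro termdiff_converges_all summable_bessel_coeff)+

lemma DERIV_bessel0: "(bessel0 has_real_derivative bessel0' z) (at z)"
  and DERIV_bessel0': "(bessel0' has_real_derivative bessel0'' z) (at z)"
  unfolding bessel0_def[abs_def] bessel0'_def[abs_def] bessel0''_def
  by (rule termdiffs_strong_converges_everywhere, fact summable_bessel_coeff summable_bessel_diffs)+

lemma isCont_bessel0'': "isCont bessel0'' z"
  unfolding bessel0''_def[abs_def]
  by (rule DERIV_isCont, rule termdiffs_strong_converges_everywhere, fact summable_bessel_diffs)

lemma bessel_at_0 [simp]: "bessel0 0 = 1" "bessel0' 0 = - 1 / 4"
  by (simp_all add: bessel0_def bessel0'_def powser_zero) (simp_all add: bessel_coeff_def diffs_def)

text \<open>Bessel's equation of order zero in the variable \<open>z\<close>, the square of the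
  usual argument. It amounts to the recursion \<open>4 * (n+1)^2 * c (n+1) = - c n\<close>, and it
  is what makes the kernel satisfy the Klein-Gordon equation.\<close>

lemma bessel_ode: "z * bessel0'' z + bessel0' z = - bessel0 z / 4"
proof -
  define c where "c = bessel_coeff"
  have "c (Suc n) = - c n / (4 * (real (Suc n))\<^sup>2)" for n
    by (simp add: c_def bessel_coeff_def power_mult_distrib del: of_nat_Suc)
  then have rec: "4 * real (Suc n) * diffs c n = - c n" for n
    by (simp add: diffs_def power2_eq_square del: of_nat_Suc)
  have "(\<lambda>n. diffs (diffs c) n * z ^ n) sums bessel0'' z"
    using summable_bessel_diffs(2) by (simp add: bessel0''_def c_def summable_sums)
  from sums_mult[OF this, of z] have "(\<lambda>n. diffs (diffs c) n * z ^ Suc n) sums (z * bessel0'' z)"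
    by (simp add: algebra_simps)
  then have "(\<lambda>n. real (Suc n) * diffs c (Suc n) * z ^ Suc n) sums (z * bessel0'' z)"
    by (simp add: diffs_def)
  then have "(\<lambda>n. real n * diffs c n * z ^ n) sums (z * bessel0'' z)"
    by (subst (asm) sums_Suc_iff) simp
  moreover have "(\<lambda>n. diffs c n * z ^ n) sums bessel0' z"
    using summable_bessel_diffs(1) by (simp add: bessel0'_def c_def summable_sums)
  ultimately have "(\<lambda>n. real n * diffs c n * z ^ n + diffs c n * z ^ n) sums (z * bessel0'' z + bessel0' z)"
    by (rule sums_add)
  moreover have "real n * diffs c n * z ^ n + diffs c n * z ^ n = (- 1 / 4) * (c n * z ^ n)" for n
  proof -
    have "real (Suc n) * diffs c n = - c n / 4" using rec[of n] by linarith
    then have "real (Suc n) * diffs c n * z ^ n = - c n / 4 * z ^ n" by simp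
    then show ?thesis by (simp add: algebra_simps)
  qed
  ultimately have "(\<lambda>n. (- 1 / 4) * (c n * z ^ n)) sums (z * bessel0'' z + bessel0' z)" by simp
  moreover have "(\<lambda>n. (- 1 / 4) * (c n * z ^ n)) sums ((- 1 / 4) * bessel0 z)"
    by (intro sums_mult) (simp add: bessel0_def c_def summable_sums summable_bessel_coeff)
  ultimately show ?thesis using sums_unique2 by fastforce
qed

text \<open>\<open>cone_int k u t x\<close> is the oriented integral of \<open>k t y *\<^sub>R u (x - y)\<close> over \<open>-t \<le> y \<le> t\<close>,
  rescaled to a fixed interval so that it can be differentiated under the integral sign.\<close>

definition cone_int :: "(real \<Rightarrow> real \<Rightarrow> real) \<Rightarrow> (real \<Rightarrow> 'a::euclidean_space) \<Rightarrow> real \<Rightarrow> real \<Rightarrow> 'a" where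
  "cone_int k u t x = t *\<^sub>R integral {-1..1} (\<lambda>\<theta>. k t (t * \<theta>) *\<^sub>R u (x - t * \<theta>))"

lemma continuous_on_cone_int:
  assumes "continuous_on UNIV (\<lambda>(t, y). k t y)" "continuous_on UNIV u"
  shows "continuous_on UNIV (\<lambda>(t, x). cone_int k u t x)"
proof -
  have k: "continuous_on S (\<lambda>z. k (f z) (g z))" if "continuous_on S f" "continuous_on S g"
    for S :: "((real \<times> real) \<times> real) set" and f g
    using continuous_on_compose2[OF assms(1), of S "\<lambda>z. (f z, g z)"] that by (simp add: continuous_on_Pair)
  have u: "continuous_on S (\<lambda>z. u (f z))" if "continuous_on S f"
    for S :: "((real \<times> real) \<times> real) set" and f
    using continuous_on_compose2[OF assms(2)] that by blast
  have "continuous_on (UNIV \<times> cbox (-1) 1)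
      (\<lambda>(p, \<theta>). k (fst p) (fst p * \<theta>) *\<^sub>R u (snd p - fst p * \<theta>))"
    unfolding case_prod_beta by (intro continuous_intros k u)
  from integral_continuous_on_param[OF this]
  show ?thesis unfolding cone_int_def case_prod_beta by (intro continuous_intros) simp
qed

text \<open>The Leibniz rule with moving endpoints, boundary terms included. On the fixed interval
  differentiation produces \<open>u'\<close>; it is traded for boundary values by integrating an
  exact derivative in \<theta>. The resulting formulas contain only \<open>u\<close>, so they can be
  differentiated once more with \<open>u\<close> merely C^1.\<close>

lemma cone_int_deriv:
  fixes u :: "real \<Rightarrow> 'a::euclidean_space"
  assumes k: "\<And>t y. ((\<lambda>(t, y). k t y) has_derivative (\<lambda>(s, z). s * k1 t y + z * k2 t y)) (at (t, y))"
    and k1: "continuous_on UNIV (\<lambda>(t, y). k1 t y)" and k2: "continuous_on UNIV (\<lambda>(t, y). k2 t y)"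
    and u: "\<And>x. (u has_vector_derivative u' x) (at x)" and u': "continuous_on UNIV u'"
  shows "((\<lambda>t. cone_int k u t x) has_vector_derivative
           k t t *\<^sub>R u (x - t) + k t (- t) *\<^sub>R u (x + t) + cone_int k1 u t x) (at t)"
    and "((\<lambda>x. cone_int k u t x) has_vector_derivative
           k t (- t) *\<^sub>R u (x + t) - k t t *\<^sub>R u (x - t) + cone_int k2 u t x) (at x)"
proof -
  have "isCont (\<lambda>(t, y). k t y) p" for p
    using has_derivative_continuous[OF k[of "fst p" "snd p"]] by simp
  then have "continuous_on UNIV (\<lambda>(t, y). k t y)"
    by (simp add: continuous_at_imp_continuous_on)
  note kc = this k1 k2
  have kcont: "continuous_on S (\<lambda>z. k (f z) (g z))" "continuous_on S (\<lambda>z. k1 (f z) (g z))"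
     "continuous_on S (\<lambda>z. k2 (f z) (g z))" if "continuous_on S f" "continuous_on S g"
    for S :: "'c::topological_space set" and f g
    using kc[THEN continuous_on_compose2, of S "\<lambda>z. (f z, g z)"] that by (simp_all add: continuous_on_Pair)
  have uc: "continuous_on UNIV u"
    by (intro continuous_at_imp_continuous_on ballI) (rule has_vector_derivative_continuous[OF u])
  have ucont: "continuous_on S (\<lambda>z. u (f z))" "continuous_on S (\<lambda>z. u' (f z))" if "continuous_on S f"
    for S :: "'c::topological_space set" and f
    using uc[THEN continuous_on_compose2, of S f] u'[THEN continuous_on_compose2, of S f] that by auto
  note cont = kcont ucont
  have dk: "((\<lambda>s. k (f s) (g s)) has_real_derivative f' * k1 (f s) (g s) + g' * k2 (f s) (g s)) (at s)"
    if "(f has_real_derivative f') (at s)" "(g has_real_derivative g') (at s)" for f g f' g' s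
  proof -
    have "((\<lambda>s. (f s, g s)) has_derivative (\<lambda>h. (f' * h, g' * h))) (at s)"
      using that by (intro has_derivative_Pair) (auto simp: has_field_derivative_def)
    from has_derivative_compose[OF this, of "\<lambda>(t, y). k t y"] k
    have "((\<lambda>s. k (f s) (g s)) has_derivative (\<lambda>h. f' * h * k1 (f s) (g s) + g' * h * k2 (f s) (g s))) (at s)"
      by fastforce
    then show ?thesis
      unfolding has_field_derivative_def
      by (rule has_derivative_eq_rhs) (simp add: fun_eq_iff algebra_simps)
  qed
  have du: "((\<lambda>s. u (f s)) has_vector_derivative f' *\<^sub>R u' (f s)) (at s)"
    if "(f has_real_derivative f') (at s)" for f f' s
    using vector_diff_chain_at[of f f' s u "u' (f s)"] that u
    by (simp add: has_real_derivative_iff_has_vector_derivative o_def)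
  define h where "h t x \<theta> = k t (t * \<theta>) *\<^sub>R u (x - t * \<theta>)" for t x \<theta>
  define ht where "ht t x \<theta> = k t (t * \<theta>) *\<^sub>R (- \<theta>) *\<^sub>R u' (x - t * \<theta>)
      + (k1 t (t * \<theta>) + \<theta> * k2 t (t * \<theta>)) *\<^sub>R u (x - t * \<theta>)" for t x \<theta>
  define hx where "hx t x \<theta> = k t (t * \<theta>) *\<^sub>R u' (x - t * \<theta>)" for t x \<theta>
  \<comment> \<open>The derivative of the integrand in the integration variable. Its
    \<open>u'\<close> term is \<open>-t\<close> times the one in \<open>hx\<close>, which permits
    the exchange.\<close>
  define h\<theta> where "h\<theta> t x \<theta> = k t (t * \<theta>) *\<^sub>R (- t) *\<^sub>R u' (x - t * \<theta>)
      + (t * k2 t (t * \<theta>)) *\<^sub>R u (x - t * \<theta>)" for t x \<theta>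
  have e: "((\<lambda>t. t * \<theta>) has_real_derivative \<theta>) (at t)" "((\<lambda>t. x - t * \<theta>) has_real_derivative - \<theta>) (at t)"
    "((\<lambda>x. x - t * \<theta>) has_real_derivative 1) (at x)" "((\<lambda>\<theta>. t * \<theta>) has_real_derivative t) (at \<theta>)"
    "((\<lambda>\<theta>. x - t * \<theta>) has_real_derivative - t) (at \<theta>)" for t x \<theta> :: real
    by (auto intro!: derivative_eq_intros)
  have dt: "((\<lambda>t. h t x \<theta>) has_vector_derivative ht t x \<theta>) (at t)" for t x \<theta>
    unfolding h_def ht_def
    using dk[OF DERIV_ident e(1)] du[OF e(2)] by (intro has_vector_derivative_scaleR) simp_all
  have dx: "((\<lambda>x. h t x \<theta>) has_vector_derivative hx t x \<theta>) (at x)" for t x \<theta>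
    unfolding h_def hx_def
    using du[OF e(3)]
    by (intro bounded_linear.has_vector_derivative[OF bounded_linear_scaleR_right]) simp
  have d\<theta>: "(h t x has_vector_derivative h\<theta> t x \<theta>) (at \<theta>)" for t x \<theta>
    unfolding h_def[abs_def] h\<theta>_def
    using dk[OF DERIV_const e(4)] du[OF e(5)] by (intro has_vector_derivative_scaleR) simp_all
  have int: "h t x integrable_on {-1..1}" "ht t x integrable_on {-1..1}" "hx t x integrable_on {-1..1}"
    "(\<lambda>\<theta>. k1 t (t * \<theta>) *\<^sub>R u (x - t * \<theta>)) integrable_on {-1..1}"
    "(\<lambda>\<theta>. k2 t (t * \<theta>) *\<^sub>R u (x - t * \<theta>)) integrable_on {-1..1}" for t x
    unfolding h_def ht_def hx_def by (intro integrable_continuous_real continuous_intros cont)+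
  show "((\<lambda>x. cone_int k u t x) has_vector_derivative
           k t (- t) *\<^sub>R u (x + t) - k t t *\<^sub>R u (x - t) + cone_int k2 u t x) (at x)"
  proof -
    have "((\<lambda>x. integral (cbox (-1) 1) (h t x)) has_vector_derivative integral (cbox (-1) 1) (hx t x)) (at x within UNIV)"
    proof (rule leibniz_rule_vector_derivative)
      show "continuous_on (UNIV \<times> cbox (-1) 1) (\<lambda>(x, \<theta>). hx t x \<theta>)"
        unfolding hx_def case_prod_beta by (intro continuous_intros cont)
    qed (use dx int in \<open>auto intro: has_vector_derivative_at_within\<close>)
    then have d: "((\<lambda>x. cone_int k u t x) has_vector_derivative t *\<^sub>R integral {-1..1} (hx t x)) (at x)"
      unfolding cone_int_def h_def[symmetric]
      by (intro bounded_linear.has_vector_derivative[OF bounded_linear_scaleR_right]) simp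
    have i1: "(h\<theta> t x has_integral h t x 1 - h t x (-1)) {-1..1}"
      by (intro fundamental_theorem_of_calculus) (auto intro: d\<theta> has_vector_derivative_at_within)
    have i2: "((\<lambda>\<theta>. t *\<^sub>R (k2 t (t * \<theta>) *\<^sub>R u (x - t * \<theta>)) - t *\<^sub>R hx t x \<theta>)
        has_integral cone_int k2 u t x - t *\<^sub>R integral {-1..1} (hx t x)) {-1..1}"
      unfolding cone_int_def using int by (intro has_integral_diff has_integral_cmul) (auto simp: has_integral_integral)
    have eq: "(\<lambda>\<theta>. t *\<^sub>R (k2 t (t * \<theta>) *\<^sub>R u (x - t * \<theta>)) - t *\<^sub>R hx t x \<theta>) = h\<theta> t x"
      by (auto simp: h\<theta>_def hx_def algebra_simps)
    have "h t x 1 - h t x (-1) = cone_int k2 u t x - t *\<^sub>R integral {-1..1} (hx t x)"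
      by (rule has_integral_unique[OF i1]) (use i2 in \<open>unfold eq\<close>)
    then have "t *\<^sub>R integral {-1..1} (hx t x)
        = k t (- t) *\<^sub>R u (x + t) - k t t *\<^sub>R u (x - t) + cone_int k2 u t x"
      by (simp add: h_def algebra_simps)
    with d show ?thesis by simp
  qed
  show "((\<lambda>t. cone_int k u t x) has_vector_derivative
           k t t *\<^sub>R u (x - t) + k t (- t) *\<^sub>R u (x + t) + cone_int k1 u t x) (at t)"
  proof -
    have "((\<lambda>t. integral (cbox (-1) 1) (h t x)) has_vector_derivative integral (cbox (-1) 1) (ht t x)) (at t within UNIV)"
    proof (rule leibniz_rule_vector_derivative)
      show "continuous_on (UNIV \<times> cbox (-1) 1) (\<lambda>(t, \<theta>). ht t x \<theta>)"
        unfolding ht_def case_prod_beta by (intro continuous_intros cont)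
    qed (use dt int in \<open>auto intro: has_vector_derivative_at_within\<close>)
    from has_vector_derivative_scaleR[OF DERIV_ident this]
    have d: "((\<lambda>t. cone_int k u t x) has_vector_derivative
        t *\<^sub>R integral {-1..1} (ht t x) + integral {-1..1} (h t x)) (at t)"
      unfolding cone_int_def h_def[symmetric] by simp
    \<comment> \<open>The exact derivative is now that of \<theta> times the integrand: the
      prefactor \<open>t\<close> has contributed the extra undifferentiated term.\<close>
    have i1: "((\<lambda>\<theta>. \<theta> *\<^sub>R h\<theta> t x \<theta> + 1 *\<^sub>R h t x \<theta>) has_integral 1 *\<^sub>R h t x 1 - (-1) *\<^sub>R h t x (-1)) {-1..1}"
      by (intro fundamental_theorem_of_calculus has_vector_derivative_scaleR)
         (auto intro: d\<theta> has_vector_derivative_at_within)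
    have i2: "((\<lambda>\<theta>. t *\<^sub>R ht t x \<theta> + h t x \<theta> - t *\<^sub>R (k1 t (t * \<theta>) *\<^sub>R u (x - t * \<theta>)))
        has_integral t *\<^sub>R integral {-1..1} (ht t x) + integral {-1..1} (h t x) - cone_int k1 u t x) {-1..1}"
      unfolding cone_int_def using int
      by (intro has_integral_diff has_integral_add has_integral_cmul) (auto simp: has_integral_integral)
    have eq: "(\<lambda>\<theta>. t *\<^sub>R ht t x \<theta> + h t x \<theta> - t *\<^sub>R (k1 t (t * \<theta>) *\<^sub>R u (x - t * \<theta>)))
        = (\<lambda>\<theta>. \<theta> *\<^sub>R h\<theta> t x \<theta> + 1 *\<^sub>R h t x \<theta>)"
      by (auto simp: h\<theta>_def ht_def algebra_simps)
    have "t *\<^sub>R integral {-1..1} (ht t x) + integral {-1..1} (h t x) - cone_int k1 u t x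
        = 1 *\<^sub>R h t x 1 - (-1) *\<^sub>R h t x (-1)"
      using i2 unfolding eq by (rule has_integral_unique) (rule i1)
    then have "t *\<^sub>R integral {-1..1} (ht t x) + integral {-1..1} (h t x)
        = k t t *\<^sub>R u (x - t) + k t (- t) *\<^sub>R u (x + t) + cone_int k1 u t x"
      by (simp add: h_def algebra_simps)
    with d show ?thesis by simp
  qed
qed

section \<open>The free Dirac flow\<close>

text \<open>Half the t-derivative of \<open>kern_0\<close>; likewise \<open>kern_y\<close> is minus
  half its y-derivative. They give the bulk terms when the cone integral of \<open>kern_0\<close> is
  differentiated.\<close>

definition kern_t :: "real \<Rightarrow> real \<Rightarrow> real" where
  "kern_t t y = t * bessel0' (t\<^sup>2 - y\<^sup>2)"

definition kern_y :: "real \<Rightarrow> real \<Rightarrow> real" where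
  "kern_y t y = y * bessel0' (t\<^sup>2 - y\<^sup>2)"

definition kern_0 :: "real \<Rightarrow> real \<Rightarrow> real" where
  "kern_0 t y = bessel0 (t\<^sup>2 - y\<^sup>2)"

text \<open>With \<open>\<chi> = cone_int kern_0 u / 2\<close>, the solution of \<open>\<chi>\<^sub>t\<^sub>t = \<chi>\<^sub>x\<^sub>x - \<chi>\<close>, \<open>\<chi>(0) = 0\<close>, \<open>\<chi>\<^sub>t(0) = u\<close>,
  this is \<open>\<chi>\<^sub>t + \<^bold>T \<chi>\<close>; it solves the free Dirac equation because \<open>\<^bold>T\<^sup>2 \<chi> = \<chi>\<^sub>x\<^sub>x - \<chi>\<close>.\<close>

definition dirac_flow :: "real \<Rightarrow> (real \<Rightarrow> complex^2) \<Rightarrow> real \<Rightarrow> complex^2" where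
  "dirac_flow t u x = (1/2) *\<^sub>R (u (x - t) + u (x + t)) + (1/2) *\<^sub>R flip (u (x - t) - u (x + t))
     + cone_int kern_t u t x + flip (cone_int kern_y u t x) + (1/2) *\<^sub>R mass (cone_int kern_0 u t x)"

lemma dirac_flow_0: "dirac_flow 0 u = u"
  by (auto simp: dirac_flow_def cone_int_def spinor_linear simp flip: scaleR_2)

lemma bessel_FDERIV:
  "((\<lambda>p. bessel0 ((fst p)\<^sup>2 - (snd p)\<^sup>2)) has_derivative
     (\<lambda>q. (2 * t * fst q - 2 * y * snd q) * bessel0' (t\<^sup>2 - y\<^sup>2))) (at (t, y))"
  "((\<lambda>p. bessel0' ((fst p)\<^sup>2 - (snd p)\<^sup>2)) has_derivative
     (\<lambda>q. (2 * t * fst q - 2 * y * snd q) * bessel0'' (t\<^sup>2 - y\<^sup>2))) (at (t, y))"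
proof -
  have g: "((\<lambda>p. (fst p)\<^sup>2 - (snd p)\<^sup>2) has_derivative (\<lambda>q. 2 * t * fst q - 2 * y * snd q)) (at (t, y))"
    by (auto intro!: derivative_eq_intros simp: algebra_simps)
  show "((\<lambda>p. bessel0 ((fst p)\<^sup>2 - (snd p)\<^sup>2)) has_derivative
     (\<lambda>q. (2 * t * fst q - 2 * y * snd q) * bessel0' (t\<^sup>2 - y\<^sup>2))) (at (t, y))"
    using DERIV_compose_FDERIV[OF _ g, of bessel0] DERIV_bessel0 by auto
  show "((\<lambda>p. bessel0' ((fst p)\<^sup>2 - (snd p)\<^sup>2)) has_derivative
     (\<lambda>q. (2 * t * fst q - 2 * y * snd q) * bessel0'' (t\<^sup>2 - y\<^sup>2))) (at (t, y))"
    using DERIV_compose_FDERIV[OF _ g, of bessel0'] DERIV_bessel0' by auto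
qed

lemma kern_has_derivative:
  "((\<lambda>(t, y). kern_0 t y) has_derivative (\<lambda>(s, z). s * (2 * kern_t t y) + z * (- 2 * kern_y t y))) (at (t, y))"
  "((\<lambda>(t, y). kern_t t y) has_derivative (\<lambda>(s, z).
      s * (bessel0' (t\<^sup>2 - y\<^sup>2) + 2 * t\<^sup>2 * bessel0'' (t\<^sup>2 - y\<^sup>2))
      + z * (- 2 * t * y * bessel0'' (t\<^sup>2 - y\<^sup>2)))) (at (t, y))"
  "((\<lambda>(t, y). kern_y t y) has_derivative (\<lambda>(s, z).
      s * (2 * t * y * bessel0'' (t\<^sup>2 - y\<^sup>2))
      + z * (bessel0' (t\<^sup>2 - y\<^sup>2) - 2 * y\<^sup>2 * bessel0'' (t\<^sup>2 - y\<^sup>2)))) (at (t, y))"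
  unfolding kern_0_def kern_t_def kern_y_def case_prod_beta
  subgoal by (rule has_derivative_eq_rhs[OF bessel_FDERIV(1)]) (simp add: fun_eq_iff algebra_simps)
  subgoal by (rule has_derivative_eq_rhs[OF has_derivative_mult[OF has_derivative_fst[OF has_derivative_ident]
          bessel_FDERIV(2)]]) (simp add: fun_eq_iff power2_eq_square algebra_simps)
  subgoal by (rule has_derivative_eq_rhs[OF has_derivative_mult[OF has_derivative_snd[OF has_derivative_ident]
          bessel_FDERIV(2)]]) (simp add: fun_eq_iff power2_eq_square algebra_simps)
  done

lemma bessel_continuous:
  assumes "continuous_on S f"
  shows "continuous_on S (\<lambda>x. bessel0 (f x))" "continuous_on S (\<lambda>x. bessel0' (f x))"
    "continuous_on S (\<lambda>x. bessel0'' (f x))"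
proof -
  have "continuous_on UNIV bessel0" "continuous_on UNIV bessel0'" "continuous_on UNIV bessel0''"
    using DERIV_isCont[OF DERIV_bessel0] DERIV_isCont[OF DERIV_bessel0'] isCont_bessel0''
    by (auto intro!: continuous_at_imp_continuous_on)
  then show "continuous_on S (\<lambda>x. bessel0 (f x))" "continuous_on S (\<lambda>x. bessel0' (f x))"
    "continuous_on S (\<lambda>x. bessel0'' (f x))"
    using assms by (auto intro: continuous_on_compose2)
qed

text \<open>Travelling waves, edge values and bulk terms match separately once the anticommutation
  of \<open>mass\<close> and \<open>flip\<close> is used. All real times are covered, because the
  cone integral is oriented; backward flows are needed for the conjugation.\<close>

lemma dirac_flow_solves:
  assumes u: "\<And>x. (u has_vector_derivative u' x) (at x)" and u': "continuous_on UNIV u'"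
  obtains \<Psi>t \<Psi>x where
    "\<And>t x. ((\<lambda>t. dirac_flow t u x) has_vector_derivative \<Psi>t t x) (at t)"
    "\<And>t x. (dirac_flow t u has_vector_derivative \<Psi>x t x) (at x)"
    "continuous_on UNIV (\<lambda>(t, x). \<Psi>t t x)" "continuous_on UNIV (\<lambda>(t, x). \<Psi>x t x)"
    "\<And>t x. \<Psi>t t x = - flip (\<Psi>x t x) + mass (dirac_flow t u x)"
proof -
  define At Ay Bt By where "At t y = bessel0' (t\<^sup>2 - y\<^sup>2) + 2 * t\<^sup>2 * bessel0'' (t\<^sup>2 - y\<^sup>2)"
    and "Ay t y = - 2 * t * y * bessel0'' (t\<^sup>2 - y\<^sup>2)"
    and "Bt t y = 2 * t * y * bessel0'' (t\<^sup>2 - y\<^sup>2)"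
    and "By t y = bessel0' (t\<^sup>2 - y\<^sup>2) - 2 * y\<^sup>2 * bessel0'' (t\<^sup>2 - y\<^sup>2)" for t y :: real
  have uc: "continuous_on UNIV u"
    by (intro continuous_at_imp_continuous_on ballI) (rule has_vector_derivative_continuous[OF u])
  have kc: "continuous_on UNIV (\<lambda>(t, y). At t y)" "continuous_on UNIV (\<lambda>(t, y). Ay t y)"
    "continuous_on UNIV (\<lambda>(t, y). Bt t y)" "continuous_on UNIV (\<lambda>(t, y). By t y)"
    "continuous_on UNIV (\<lambda>(t, y). 2 * kern_t t y)" "continuous_on UNIV (\<lambda>(t, y). - 2 * kern_y t y)"
    unfolding At_def Ay_def Bt_def By_def kern_t_def kern_y_def case_prod_beta
    by (intro continuous_intros bessel_continuous)+
  note cc = kc[THEN continuous_on_cone_int, OF uc, unfolded case_prod_beta]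
  have ucont: "continuous_on S (\<lambda>z. u (f z))" "continuous_on S (\<lambda>z. u' (f z))" if "continuous_on S f"
    for S :: "(real \<times> real) set" and f
    using uc[THEN continuous_on_compose2, of S f] u'[THEN continuous_on_compose2, of S f] that by auto
  note dA = cone_int_deriv[OF kern_has_derivative(2)[folded At_def Ay_def] kc(1,2) u u']
  note dB = cone_int_deriv[OF kern_has_derivative(3)[folded Bt_def By_def] kc(3,4) u u']
  note dC = cone_int_deriv[OF kern_has_derivative(1) kc(5,6) u u']
  have du: "((\<lambda>s. u (f s)) has_vector_derivative f' *\<^sub>R u' (f s)) (at s)"
    if "(f has_real_derivative f') (at s)" for f f' s
    using vector_diff_chain_at[of f f' s u "u' (f s)"] that u
    by (simp add: has_real_derivative_iff_has_vector_derivative o_def)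
  have dux: "((\<lambda>x. u (x - t)) has_vector_derivative u' (x - t)) (at x)"
     "((\<lambda>x. u (x + t)) has_vector_derivative u' (x + t)) (at x)"
     "((\<lambda>t. u (x - t)) has_vector_derivative - u' (x - t)) (at t)"
     "((\<lambda>t. u (x + t)) has_vector_derivative u' (x + t)) (at t)" for t x
  proof -
    have "((\<lambda>x. x - t) has_real_derivative 1) (at x)" "((\<lambda>x. x + t) has_real_derivative 1) (at x)"
      "((\<lambda>t. x - t) has_real_derivative - 1) (at t)" "((\<lambda>t. x + t) has_real_derivative 1) (at t)"
      by (auto intro!: derivative_eq_intros)
    from this[THEN du] show "((\<lambda>x. u (x - t)) has_vector_derivative u' (x - t)) (at x)"
     "((\<lambda>x. u (x + t)) has_vector_derivative u' (x + t)) (at x)"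
     "((\<lambda>t. u (x - t)) has_vector_derivative - u' (x - t)) (at t)"
     "((\<lambda>t. u (x + t)) has_vector_derivative u' (x + t)) (at t)" by simp_all
  qed
  define \<Psi>t where "\<Psi>t t x = (1/2) *\<^sub>R (- u' (x - t) + u' (x + t)) + (1/2) *\<^sub>R flip (- u' (x - t) - u' (x + t))
     + (kern_t t t *\<^sub>R u (x - t) + kern_t t (- t) *\<^sub>R u (x + t) + cone_int At u t x)
     + flip (kern_y t t *\<^sub>R u (x - t) + kern_y t (- t) *\<^sub>R u (x + t) + cone_int Bt u t x)
     + (1/2) *\<^sub>R mass (kern_0 t t *\<^sub>R u (x - t) + kern_0 t (- t) *\<^sub>R u (x + t)
          + cone_int (\<lambda>t y. 2 * kern_t t y) u t x)" for t x
  define \<Psi>x where "\<Psi>x t x = (1/2) *\<^sub>R (u' (x - t) + u' (x + t)) + (1/2) *\<^sub>R flip (u' (x - t) - u' (x + t))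
     + (kern_t t (- t) *\<^sub>R u (x + t) - kern_t t t *\<^sub>R u (x - t) + cone_int Ay u t x)
     + flip (kern_y t (- t) *\<^sub>R u (x + t) - kern_y t t *\<^sub>R u (x - t) + cone_int By u t x)
     + (1/2) *\<^sub>R mass (kern_0 t (- t) *\<^sub>R u (x + t) - kern_0 t t *\<^sub>R u (x - t)
          + cone_int (\<lambda>t y. - 2 * kern_y t y) u t x)" for t x
  show ?thesis
  proof (rule that[of \<Psi>t \<Psi>x])
    show "((\<lambda>t. dirac_flow t u x) has_vector_derivative \<Psi>t t x) (at t)" for t x
      unfolding dirac_flow_def \<Psi>t_def
      by (intro has_vector_derivative_add has_vector_derivative_diff spinor_has_vector_derivative
          bounded_linear.has_vector_derivative[OF bounded_linear_scaleR_right] dux dA(1) dB(1) dC(1))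
    show "(dirac_flow t u has_vector_derivative \<Psi>x t x) (at x)" for t x
      unfolding dirac_flow_def[abs_def] \<Psi>x_def
      by (intro has_vector_derivative_add has_vector_derivative_diff spinor_has_vector_derivative
          bounded_linear.has_vector_derivative[OF bounded_linear_scaleR_right] dux dA(2) dB(2) dC(2))
    show "continuous_on UNIV (\<lambda>(t, x). \<Psi>t t x)" "continuous_on UNIV (\<lambda>(t, x). \<Psi>x t x)"
      unfolding \<Psi>t_def \<Psi>x_def kern_0_def kern_t_def kern_y_def case_prod_beta
      by (intro continuous_intros cc[unfolded kern_t_def kern_y_def] ucont bessel_continuous)+
    show "\<Psi>t t x = - flip (\<Psi>x t x) + mass (dirac_flow t u x)" for t x
    proof -
      have int: "(\<lambda>\<theta>. k t (t * \<theta>) *\<^sub>R u (x - t * \<theta>)) integrable_on {-1..1}"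
        if "continuous_on UNIV (\<lambda>(t, y). k t y)" for k :: "real \<Rightarrow> real \<Rightarrow> real"
      proof -
        have "continuous_on {-1..1} (\<lambda>\<theta>. (t, t * \<theta>))" by (intro continuous_intros)
        from continuous_on_compose2[OF that this]
        have "continuous_on {-1..1} (\<lambda>\<theta>. k t (t * \<theta>))" by simp
        then show ?thesis
          by (intro integrable_continuous_real continuous_intros continuous_on_compose2[OF uc]) auto
      qed
      have scale: "cone_int (\<lambda>t y. c * k t y) u t x = c *\<^sub>R cone_int k u t x" for c k
        by (simp add: cone_int_def scaleR_left_commute flip: scaleR_scaleR)
      have Bt: "cone_int Bt u t x = - cone_int Ay u t x"
        by (simp add: cone_int_def Bt_def Ay_def)
      \<comment> \<open>The Bessel equation at \<open>t\<^sup>2 - y\<^sup>2\<close>; this is the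
        Klein-Gordon equation for the kernel, and the only place where the special function matters
        in the bulk.\<close>
      have At_eq: "At t y = (- 1 / 2) * kern_0 t y - By t y" for t y
        using bessel_ode[of "t\<^sup>2 - y\<^sup>2"] by (simp add: At_def By_def kern_0_def algebra_simps)
      have "cone_int At u t x = t *\<^sub>R integral {-1..1} (\<lambda>\<theta>. (- 1 / 2) *\<^sub>R (kern_0 t (t * \<theta>) *\<^sub>R u (x - t * \<theta>))
          - By t (t * \<theta>) *\<^sub>R u (x - t * \<theta>))"
        unfolding cone_int_def by (simp only: At_eq scaleR_diff_left scaleR_scaleR)
      also have "\<dots> = (- 1 / 2) *\<^sub>R cone_int kern_0 u t x - cone_int By u t x"
      proof -
        have "continuous_on UNIV (\<lambda>(t, y). kern_0 t y)"
          unfolding kern_0_def case_prod_beta by (intro continuous_intros bessel_continuous)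
        note i1 = integrable_cmul[OF int[OF this], of "- 1 / 2"] and i2 = int[OF kc(4)]
        show ?thesis
          unfolding cone_int_def Henstock_Kurzweil_Integration.integral_diff[OF i1 i2] integral_cmul
          by (simp add: scaleR_diff_right scaleR_left_commute)
      qed
      finally have At: "cone_int At u t x = (- 1 / 2) *\<^sub>R cone_int kern_0 u t x - cone_int By u t x" .
      \<comment> \<open>On the edges of the cone the argument of the Bessel function vanishes, so
        only its value 1 and slope -1/4 at the origin appear.\<close>
      have "kern_0 t t = 1" "kern_0 t (- t) = 1" "kern_t t t = - t / 4" "kern_t t (- t) = - t / 4"
        "kern_y t t = - t / 4" "kern_y t (- t) = t / 4"
        by (simp_all add: kern_0_def kern_t_def kern_y_def)
      note boundary = this
      show ?thesis
        unfolding \<Psi>t_def \<Psi>x_def dirac_flow_def scale Bt At boundary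
        by (simp add: spinor_linear spinor_mult algebra_simps)
    qed
  qed
qed

section \<open>Classical solutions with a source\<close>

context period_cell
begin

text \<open>The potential of \<open>classical_sol\<close> is replaced by an arbitrary source. Free
  solutions, the exact solution, differences, and the potential applied to a free solution then all
  fall under one notion.\<close>

definition dsol :: "real \<Rightarrow> real \<Rightarrow> (real \<Rightarrow> real \<Rightarrow> complex^2) \<Rightarrow> (real \<Rightarrow> real \<Rightarrow> complex^2) \<Rightarrow> bool" where
  "dsol t0 t1 R \<Psi> \<longleftrightarrow>
     (\<forall>s\<in>{t0..t1}. periodic_fun a b (\<Psi> s)) \<and>
     (\<exists>\<Psi>t \<Psi>x.
        (\<forall>s\<in>{t0..t1}. \<forall>x. ((\<lambda>r. \<Psi> r x) has_vector_derivative \<Psi>t s x) (at s within {t0..t1})) \<and>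
        (\<forall>s\<in>{t0..t1}. \<forall>x. (\<Psi> s has_vector_derivative \<Psi>x s x) (at x)) \<and>
        continuous_on ({t0..t1} \<times> UNIV) (\<lambda>(s, x). \<Psi>t s x) \<and>
        continuous_on ({t0..t1} \<times> UNIV) (\<lambda>(s, x). \<Psi>x s x) \<and>
        (\<forall>s\<in>{t0..t1}. \<forall>x. \<Psi>t s x = - flip (\<Psi>x s x) + mass (\<Psi> s x) + R s x))"

lemma classical_sol_iff_dsol:
  "classical_sol a b t0 t1 F \<Psi> \<longleftrightarrow> dsol t0 t1 (\<lambda>s x. F x *v \<Psi> s x) \<Psi>"
  by (simp add: classical_sol_def dsol_def flip_def mass_def)

lemma dsolI:
  assumes "\<And>s. s \<in> {t0..t1} \<Longrightarrow> periodic_fun a b (\<Psi> s)"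
    "\<And>s x. s \<in> {t0..t1} \<Longrightarrow> ((\<lambda>r. \<Psi> r x) has_vector_derivative \<Psi>t s x) (at s within {t0..t1})"
    "\<And>s x. s \<in> {t0..t1} \<Longrightarrow> (\<Psi> s has_vector_derivative \<Psi>x s x) (at x)"
    "continuous_on ({t0..t1} \<times> UNIV) (\<lambda>(s, x). \<Psi>t s x)"
    "continuous_on ({t0..t1} \<times> UNIV) (\<lambda>(s, x). \<Psi>x s x)"
    "\<And>s x. s \<in> {t0..t1} \<Longrightarrow> \<Psi>t s x = - flip (\<Psi>x s x) + mass (\<Psi> s x) + R s x"
  shows "dsol t0 t1 R \<Psi>"
  using assms unfolding dsol_def by blast

lemma continuous_on_slice:
  assumes "continuous_on (S \<times> UNIV) (\<lambda>(s, x). f s x)" "s \<in> S"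
  shows "continuous_on A (f s)"
proof -
  have "continuous_on A (\<lambda>x. (s, x))" by (intro continuous_intros)
  from continuous_on_compose2[OF assms(1) this] assms(2) show ?thesis by auto
qed

text \<open>Besides unpacking, this supplies joint continuity of \<open>\<Psi>\<close>: a time
  derivative together with a jointly continuous space derivative gives total
  differentiability.\<close>

lemma dsolE:
  assumes "dsol t0 t1 R \<Psi>"
  obtains \<Psi>t \<Psi>x where
    "\<And>s. s \<in> {t0..t1} \<Longrightarrow> periodic_fun a b (\<Psi> s)"
    "\<And>s x. s \<in> {t0..t1} \<Longrightarrow> ((\<lambda>r. \<Psi> r x) has_vector_derivative \<Psi>t s x) (at s within {t0..t1})"
    "\<And>s x. s \<in> {t0..t1} \<Longrightarrow> (\<Psi> s has_vector_derivative \<Psi>x s x) (at x)"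
    "continuous_on ({t0..t1} \<times> UNIV) (\<lambda>(s, x). \<Psi>t s x)"
    "continuous_on ({t0..t1} \<times> UNIV) (\<lambda>(s, x). \<Psi>x s x)"
    "continuous_on ({t0..t1} \<times> UNIV) (\<lambda>(s, x). \<Psi> s x)"
    "\<And>s x. s \<in> {t0..t1} \<Longrightarrow> \<Psi>t s x = - flip (\<Psi>x s x) + mass (\<Psi> s x) + R s x"
proof -
  obtain \<Psi>t \<Psi>x where d:
    "\<And>s. s \<in> {t0..t1} \<Longrightarrow> periodic_fun a b (\<Psi> s)"
    "\<And>s x. s \<in> {t0..t1} \<Longrightarrow> ((\<lambda>r. \<Psi> r x) has_vector_derivative \<Psi>t s x) (at s within {t0..t1})"
    "\<And>s x. s \<in> {t0..t1} \<Longrightarrow> (\<Psi> s has_vector_derivative \<Psi>x s x) (at x)"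
    "continuous_on ({t0..t1} \<times> UNIV) (\<lambda>(s, x). \<Psi>t s x)"
    "continuous_on ({t0..t1} \<times> UNIV) (\<lambda>(s, x). \<Psi>x s x)"
    "\<And>s x. s \<in> {t0..t1} \<Longrightarrow> \<Psi>t s x = - flip (\<Psi>x s x) + mass (\<Psi> s x) + R s x"
    using assms unfolding dsol_def by blast
  have "continuous (at (s, x) within {t0..t1} \<times> UNIV) (\<lambda>(s, x). \<Psi> s x)" if s: "s \<in> {t0..t1}" for s x
  proof (rule has_derivative_continuous, rule has_derivative_partialsI)
    show "((\<lambda>s. \<Psi> s x) has_derivative (\<lambda>h. h *\<^sub>R \<Psi>t s x)) (at s within {t0..t1})"
      using d(2)[OF s] by (simp add: has_vector_derivative_def)
    show "(\<Psi> r has_derivative blinfun_apply (blinfun_scaleR_left (\<Psi>x r y))) (at y within UNIV)"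
      if "r \<in> {t0..t1}" for r y
      using d(3)[OF that] by (simp add: has_vector_derivative_def)
    have "continuous (at (s, x) within {t0..t1} \<times> UNIV) (\<lambda>(s, x). \<Psi>x s x)"
      using d(5) s by (auto simp: continuous_on_eq_continuous_within)
    from bounded_linear.continuous[OF bounded_linear_blinfun_scaleR_left this]
    show "continuous (at (s, x) within {t0..t1} \<times> UNIV) (\<lambda>(s, x). blinfun_scaleR_left (\<Psi>x s x))"
      unfolding case_prod_beta .
  qed auto
  then have "continuous_on ({t0..t1} \<times> UNIV) (\<lambda>(s, x). \<Psi> s x)"
    by (auto simp: continuous_on_eq_continuous_within)
  with d that show ?thesis by blast
qed

lemma dsol_c1per:
  assumes "dsol t0 t1 R \<Psi>" "s \<in> {t0..t1}"
  shows "c1per (\<Psi> s)"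
proof -
  obtain \<Psi>t \<Psi>x where d: "periodic_fun a b (\<Psi> s)" "\<And>x. (\<Psi> s has_vector_derivative \<Psi>x s x) (at x)"
    "continuous_on ({t0..t1} \<times> UNIV) (\<lambda>(s, x). \<Psi>x s x)"
    using assms(2) by (metis dsolE[OF assms(1)])
  then show ?thesis using continuous_on_slice[OF d(3) assms(2)] by (intro c1perI)
qed

lemma dsol_subinterval:
  assumes "dsol t0 t1 R \<Psi>" "t0 \<le> r0" "r1 \<le> t1"
  shows "dsol r0 r1 R \<Psi>"
proof -
  have sub: "{r0..r1} \<subseteq> {t0..t1}" "{r0..r1} \<times> UNIV \<subseteq> {t0..t1} \<times> (UNIV :: real set)" using assms by auto
  from assms(1) show ?thesis
  proof (rule dsolE)
    fix \<Psi>t \<Psi>x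
    assume "\<And>s. s \<in> {t0..t1} \<Longrightarrow> periodic_fun a b (\<Psi> s)"
    "\<And>s x. s \<in> {t0..t1} \<Longrightarrow> ((\<lambda>r. \<Psi> r x) has_vector_derivative \<Psi>t s x) (at s within {t0..t1})"
    "\<And>s x. s \<in> {t0..t1} \<Longrightarrow> (\<Psi> s has_vector_derivative \<Psi>x s x) (at x)"
    "continuous_on ({t0..t1} \<times> UNIV) (\<lambda>(s, x). \<Psi>t s x)"
    "continuous_on ({t0..t1} \<times> UNIV) (\<lambda>(s, x). \<Psi>x s x)"
    "\<And>s x. s \<in> {t0..t1} \<Longrightarrow> \<Psi>t s x = - flip (\<Psi>x s x) + mass (\<Psi> s x) + R s x"
    then show ?thesis
      by (intro dsolI[of _ _ _ \<Psi>t \<Psi>x])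
        (use sub in \<open>auto intro: has_vector_derivative_within_subset[OF _ sub(1)] continuous_on_subset[OF _ sub(2)]\<close>)
  qed
qed

lemma dsol_diff:
  assumes "dsol t0 t1 R \<Psi>" "dsol t0 t1 Q X"
  shows "dsol t0 t1 (\<lambda>s x. R s x - Q s x) (\<lambda>s x. \<Psi> s x - X s x)"
proof -
  obtain \<Psi>t \<Psi>x where 1:
    "\<And>s. s \<in> {t0..t1} \<Longrightarrow> periodic_fun a b (\<Psi> s)"
    "\<And>s x. s \<in> {t0..t1} \<Longrightarrow> ((\<lambda>r. \<Psi> r x) has_vector_derivative \<Psi>t s x) (at s within {t0..t1})"
    "\<And>s x. s \<in> {t0..t1} \<Longrightarrow> (\<Psi> s has_vector_derivative \<Psi>x s x) (at x)"
    "continuous_on ({t0..t1} \<times> UNIV) (\<lambda>(s, x). \<Psi>t s x)"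
    "continuous_on ({t0..t1} \<times> UNIV) (\<lambda>(s, x). \<Psi>x s x)"
    "\<And>s x. s \<in> {t0..t1} \<Longrightarrow> \<Psi>t s x = - flip (\<Psi>x s x) + mass (\<Psi> s x) + R s x"
    by (rule dsolE[OF assms(1)]) blast
  obtain Xt Xx where 2:
    "\<And>s. s \<in> {t0..t1} \<Longrightarrow> periodic_fun a b (X s)"
    "\<And>s x. s \<in> {t0..t1} \<Longrightarrow> ((\<lambda>r. X r x) has_vector_derivative Xt s x) (at s within {t0..t1})"
    "\<And>s x. s \<in> {t0..t1} \<Longrightarrow> (X s has_vector_derivative Xx s x) (at x)"
    "continuous_on ({t0..t1} \<times> UNIV) (\<lambda>(s, x). Xt s x)"
    "continuous_on ({t0..t1} \<times> UNIV) (\<lambda>(s, x). Xx s x)"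
    "\<And>s x. s \<in> {t0..t1} \<Longrightarrow> Xt s x = - flip (Xx s x) + mass (X s x) + Q s x"
    by (rule dsolE[OF assms(2)]) blast
  show ?thesis
  proof (rule dsolI[of _ _ _ "\<lambda>s x. \<Psi>t s x - Xt s x" "\<lambda>s x. \<Psi>x s x - Xx s x"])
    show "continuous_on ({t0..t1} \<times> UNIV) (\<lambda>(s, x). \<Psi>t s x - Xt s x)"
      "continuous_on ({t0..t1} \<times> UNIV) (\<lambda>(s, x). \<Psi>x s x - Xx s x)"
      using 1 2 by (auto simp: case_prod_beta intro!: continuous_on_diff)
  qed (use 1 2 in \<open>auto simp: periodic_fun_def spinor_linear intro!: has_vector_derivative_diff\<close>)
qed

text \<open>\<open>\<^bold>T\<close> is skew-adjoint for the real inner product, so only the sources contribute.\<close>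

lemma ip_dsol_deriv:
  assumes \<Psi>: "dsol t0 t1 R \<Psi>" and X: "dsol t0 t1 Q X" and s: "s \<in> {t0..t1}"
    and R: "cper (R s)" and Q: "cper (Q s)"
  shows "((\<lambda>s. ip (\<Psi> s) (X s)) has_vector_derivative ip (R s) (X s) + ip (\<Psi> s) (Q s)) (at s within {t0..t1})"
proof -
  obtain \<Psi>t \<Psi>x where 1:
    "\<And>s. s \<in> {t0..t1} \<Longrightarrow> periodic_fun a b (\<Psi> s)"
    "\<And>s x. s \<in> {t0..t1} \<Longrightarrow> ((\<lambda>r. \<Psi> r x) has_vector_derivative \<Psi>t s x) (at s within {t0..t1})"
    "\<And>s x. s \<in> {t0..t1} \<Longrightarrow> (\<Psi> s has_vector_derivative \<Psi>x s x) (at x)"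
    "continuous_on ({t0..t1} \<times> UNIV) (\<lambda>(s, x). \<Psi>t s x)"
    "continuous_on ({t0..t1} \<times> UNIV) (\<lambda>(s, x). \<Psi>x s x)"
    "continuous_on ({t0..t1} \<times> UNIV) (\<lambda>(s, x). \<Psi> s x)"
    "\<And>s x. s \<in> {t0..t1} \<Longrightarrow> \<Psi>t s x = - flip (\<Psi>x s x) + mass (\<Psi> s x) + R s x"
    by (rule dsolE[OF \<Psi>]) blast
  obtain Xt Xx where 2:
    "\<And>s. s \<in> {t0..t1} \<Longrightarrow> periodic_fun a b (X s)"
    "\<And>s x. s \<in> {t0..t1} \<Longrightarrow> ((\<lambda>r. X r x) has_vector_derivative Xt s x) (at s within {t0..t1})"
    "\<And>s x. s \<in> {t0..t1} \<Longrightarrow> (X s has_vector_derivative Xx s x) (at x)"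
    "continuous_on ({t0..t1} \<times> UNIV) (\<lambda>(s, x). Xt s x)"
    "continuous_on ({t0..t1} \<times> UNIV) (\<lambda>(s, x). Xx s x)"
    "continuous_on ({t0..t1} \<times> UNIV) (\<lambda>(s, x). X s x)"
    "\<And>s x. s \<in> {t0..t1} \<Longrightarrow> Xt s x = - flip (Xx s x) + mass (X s x) + Q s x"
    by (rule dsolE[OF X]) blast
  have per: "cper (\<Psi> r)" "cper (X r)" if "r \<in> {t0..t1}" for r
    using dsol_c1per[OF \<Psi> that] dsol_c1per[OF X that] c1per_cper by auto
  have "((\<lambda>s. integral (cbox a b) (\<lambda>x. \<Psi> s x \<bullet> X s x)) has_vector_derivative
      integral (cbox a b) (\<lambda>x. \<Psi> s x \<bullet> Xt s x + \<Psi>t s x \<bullet> X s x)) (at s within {t0..t1})"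
  proof (rule leibniz_rule_vector_derivative)
    show "((\<lambda>r. \<Psi> r x \<bullet> X r x) has_vector_derivative \<Psi> r x \<bullet> Xt r x + \<Psi>t r x \<bullet> X r x) (at r within {t0..t1})"
      if "r \<in> {t0..t1}" for r x
      using 1(2)[OF that] 2(2)[OF that] by (rule bounded_bilinear.has_vector_derivative[OF bounded_bilinear_inner])
    show "(\<lambda>x. \<Psi> r x \<bullet> X r x) integrable_on cbox a b" if "r \<in> {t0..t1}" for r
      using integrable_inner per[OF that] by simp
    have sub: "{t0..t1} \<times> cbox a b \<subseteq> {t0..t1} \<times> UNIV" by auto
    show "continuous_on ({t0..t1} \<times> cbox a b) (\<lambda>(r, x). \<Psi> r x \<bullet> Xt r x + \<Psi>t r x \<bullet> X r x)"
      using 1(4,6)[THEN continuous_on_subset, OF sub] 2(4,6)[THEN continuous_on_subset, OF sub]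
      unfolding case_prod_beta by (intro continuous_intros)
  qed (use s in auto)
  moreover have "integral {a..b} (\<lambda>x. \<Psi> s x \<bullet> Xt s x + \<Psi>t s x \<bullet> X s x) = ip (R s) (X s) + ip (\<Psi> s) (Q s)"
  proof -
    \<comment> \<open>\<open>flip\<close> is symmetric, so the transport terms form an exact space
      derivative whose integral over a period is zero; the \<open>mass\<close> terms cancel
      pointwise.\<close>
    have "((\<lambda>x. flip (\<Psi> s x) \<bullet> Xx s x + flip (\<Psi>x s x) \<bullet> X s x) has_integral
        flip (\<Psi> s b) \<bullet> X s b - flip (\<Psi> s a) \<bullet> X s a) {a..b}"
      using ab 1(3)[OF s] 2(3)[OF s]
      by (intro fundamental_theorem_of_calculus bounded_bilinear.has_vector_derivative[OF bounded_bilinear_inner]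
          spinor_has_vector_derivative) (auto intro: has_vector_derivative_at_within)
    moreover have "\<Psi> s b = \<Psi> s a" "X s b = X s a"
      using 1(1)[OF s] 2(1)[OF s] unfolding periodic_fun_def by (metis add.commute diff_add_cancel)+
    ultimately have "((\<lambda>x. flip (\<Psi> s x) \<bullet> Xx s x + flip (\<Psi>x s x) \<bullet> X s x) has_integral 0) {a..b}" by simp
    moreover have "((\<lambda>x. R s x \<bullet> X s x + \<Psi> s x \<bullet> Q s x) has_integral ip (R s) (X s) + ip (\<Psi> s) (Q s)) {a..b}"
      unfolding ip_def using integrable_inner per[OF s] R Q by (intro has_integral_add integrable_integral)
    ultimately have "((\<lambda>x. (R s x \<bullet> X s x + \<Psi> s x \<bullet> Q s x) - (flip (\<Psi> s x) \<bullet> Xx s x + flip (\<Psi>x s x) \<bullet> X s x))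
      has_integral (ip (R s) (X s) + ip (\<Psi> s) (Q s)) - 0) {a..b}"
      by (intro has_integral_diff)
    moreover have "(\<lambda>x. (R s x \<bullet> X s x + \<Psi> s x \<bullet> Q s x) - (flip (\<Psi> s x) \<bullet> Xx s x + flip (\<Psi>x s x) \<bullet> X s x))
       = (\<lambda>x. \<Psi> s x \<bullet> Xt s x + \<Psi>t s x \<bullet> X s x)"
      by (simp add: 1(7)[OF s] 2(7)[OF s] spinor_inner inner_add_left inner_add_right algebra_simps)
    ultimately show ?thesis by (simp add: integral_unique)
  qed
  ultimately show ?thesis by (simp add: ip_def)
qed

lemma ip_free_const:
  assumes "dsol t0 t1 (\<lambda>s x. 0) \<Psi>" "dsol t0 t1 (\<lambda>s x. 0) X" "s \<in> {t0..t1}" "r \<in> {t0..t1}"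
  shows "ip (\<Psi> s) (X s) = ip (\<Psi> r) (X r)"
proof -
  have "norm (ip (\<Psi> s) (X s) - ip (\<Psi> r) (X r)) \<le> 0 * \<bar>s - r\<bar>"
    using assms by (intro mvt_bound[OF ip_dsol_deriv]) (auto simp: cper_const ip_def)
  then show ?thesis by simp
qed

text \<open>Energy method: the norm of the difference is conserved and vanishes at \<open>r\<close>,
  and continuity turns zero norm into pointwise equality.\<close>

lemma dsol_free_unique:
  assumes "dsol t0 t1 (\<lambda>s x. 0) \<Psi>" "dsol t0 t1 (\<lambda>s x. 0) X" "r \<in> {t0..t1}" "\<Psi> r = X r" "s \<in> {t0..t1}"
  shows "\<Psi> s = X s"
proof -
  have d: "dsol t0 t1 (\<lambda>s x. 0) (\<lambda>s x. \<Psi> s x - X s x)"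
    using dsol_diff[OF assms(1,2)] by simp
  have "nrm (\<lambda>x. \<Psi> s x - X s x) = nrm (\<lambda>x. \<Psi> r x - X r x)"
    unfolding nrm_def using ip_free_const[OF d d assms(5,3)] by simp
  also have "\<dots> = 0" using assms(4) by (simp add: nrm_def ip_def)
  finally show ?thesis
    using nrm_eq_0D[OF c1per_cper[OF dsol_c1per[OF d assms(5)]]] by (auto simp: fun_eq_iff)
qed

section \<open>The explicit flow as a group of isometries\<close>

lemma dirac_flow_periodic:
  assumes "periodic_fun a b u"
  shows "periodic_fun a b (dirac_flow t u)"
proof -
  have "u (x + (b - a) - y) = u (x - y)" "u (x + (b - a) + y) = u (x + y)" for x y
    using assms unfolding periodic_fun_def by (metis add.assoc add.commute diff_add_eq)+
  then show ?thesis unfolding periodic_fun_def dirac_flow_def cone_int_def by simp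
qed

lemma dsol_dirac_flow:
  assumes "c1per u"
  shows "dsol t0 t1 (\<lambda>s x. 0) (\<lambda>s. dirac_flow (s - c) u)"
proof -
  obtain u' where u': "cper u'" "\<And>x. (u has_vector_derivative u' x) (at x)"
    using assms c1perE by blast
  obtain \<Psi>t \<Psi>x where d:
    "\<And>t x. ((\<lambda>t. dirac_flow t u x) has_vector_derivative \<Psi>t t x) (at t)"
    "\<And>t x. (dirac_flow t u has_vector_derivative \<Psi>x t x) (at x)"
    "continuous_on UNIV (\<lambda>(t, x). \<Psi>t t x)" "continuous_on UNIV (\<lambda>(t, x). \<Psi>x t x)"
    "\<And>t x. \<Psi>t t x = - flip (\<Psi>x t x) + mass (dirac_flow t u x)"
    using dirac_flow_solves[OF u'(2) cper_continuous[OF u'(1)]] by blast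
  have c: "continuous_on ({t0..t1} \<times> UNIV) (\<lambda>(s, x). f (s - c) x)"
    if "continuous_on UNIV (\<lambda>(s, x). f s x)" for f :: "real \<Rightarrow> real \<Rightarrow> complex^2"
  proof -
    have "continuous_on ({t0..t1} \<times> UNIV) (\<lambda>p. (fst p - c, snd p))" by (intro continuous_intros)
    from continuous_on_compose2[OF that this] show ?thesis by (auto simp: case_prod_beta)
  qed
  show ?thesis
  proof (rule dsolI[of _ _ _ "\<lambda>s. \<Psi>t (s - c)" "\<lambda>s. \<Psi>x (s - c)"])
    show "((\<lambda>r. dirac_flow (r - c) u x) has_vector_derivative \<Psi>t (s - c) x) (at s within {t0..t1})" for s x
      using has_vector_derivative_shift[of "\<lambda>t. dirac_flow t u x" _ s "- c"] d(1)
      by (auto intro: has_vector_derivative_at_within)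
  qed (use d c assms in \<open>auto simp: c1per_def intro: dirac_flow_periodic\<close>)
qed

text \<open>Existence comes from the explicit formula and uniqueness from energy conservation; only
  together do they give the definite description in \<open>expT\<close> a value.\<close>

lemma expT_eq_dirac_flow:
  assumes "c1per u" "0 \<le> t"
  shows "expT a b t u = dirac_flow t u"
  unfolding expT_def
proof (rule the_equality)
  have "dsol 0 t (\<lambda>s x. 0) (\<lambda>s. dirac_flow (s - 0) u)" by (rule dsol_dirac_flow[OF assms(1)])
  then have flow: "dsol 0 t (\<lambda>s x. 0) (\<lambda>s. dirac_flow s u)" by simp
  then show "\<exists>\<Psi>. classical_sol a b 0 t (\<lambda>x. 0) \<Psi> \<and> \<Psi> 0 = u \<and> \<Psi> t = dirac_flow t u"
    by (intro exI[of _ "\<lambda>s. dirac_flow s u"]) (simp add: classical_sol_iff_dsol dirac_flow_0)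
  fix w assume "\<exists>\<Psi>. classical_sol a b 0 t (\<lambda>x. 0) \<Psi> \<and> \<Psi> 0 = u \<and> \<Psi> t = w"
  then obtain \<Psi> where "dsol 0 t (\<lambda>s x. 0) \<Psi>" "\<Psi> 0 = u" "\<Psi> t = w"
    by (auto simp: classical_sol_iff_dsol)
  then show "w = dirac_flow t u"
    using dsol_free_unique[OF _ flow, of \<Psi> 0 t] assms(2) by (simp add: dirac_flow_0)
qed

lemma c1per_dirac_flow:
  assumes "c1per u"
  shows "c1per (dirac_flow t u)"
  using dsol_c1per[OF dsol_dirac_flow[OF assms, of t t 0], of t] by simp

lemma ip_dirac_flow:
  assumes "c1per u" "c1per v"
  shows "ip (dirac_flow t u) (dirac_flow t v) = ip u v"
  \<comment> \<open>The interval from \<open>min 0 t\<close> to \<open>max 0 t\<close> covers both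
    signs of \<open>t\<close>; the same device recurs below.\<close>
  using ip_free_const[OF assms[THEN dsol_dirac_flow, of "min 0 t" "max 0 t" 0], of t 0]
  by (simp add: dirac_flow_0)

text \<open>As functions of \<open>s\<close> both sides are free solutions that agree at 0. In
  particular the flow for \<open>- t\<close> inverts the flow for \<open>t\<close>.\<close>

lemma dirac_flow_add:
  assumes "c1per u"
  shows "dirac_flow s (dirac_flow t u) = dirac_flow (s + t) u"
proof -
  have "dsol (min 0 s) (max 0 s) (\<lambda>s x. 0) (\<lambda>s. dirac_flow (s - 0) (dirac_flow t u))"
    "dsol (min 0 s) (max 0 s) (\<lambda>s x. 0) (\<lambda>s. dirac_flow (s - - t) u)"
    by (intro dsol_dirac_flow c1per_dirac_flow assms)+
  from dsol_free_unique[OF this, of 0 s] show ?thesis by (simp add: dirac_flow_0)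
qed

text \<open>The difference of two free solutions is again one, so conservation applies directly and
  linearity of the integral formula is bypassed.\<close>

lemma nrm_dirac_flow_diff:
  assumes "c1per u" "c1per v"
  shows "nrm (\<lambda>x. dirac_flow t u x - dirac_flow t v x) = nrm (\<lambda>x. u x - v x)"
proof -
  have "dsol (min 0 t) (max 0 t) (\<lambda>s x. 0 - 0) (\<lambda>s x. dirac_flow (s - 0) u x - dirac_flow (s - 0) v x)"
    by (intro dsol_diff dsol_dirac_flow assms)
  then have d: "dsol (min 0 t) (max 0 t) (\<lambda>s x. 0) (\<lambda>s x. dirac_flow s u x - dirac_flow s v x)" by simp
  show ?thesis
    unfolding nrm_def using ip_free_const[OF d d, of t 0] by (simp add: dirac_flow_0)
qed

lemma nrm_dirac_flow: "c1per u \<Longrightarrow> nrm (dirac_flow t u) = nrm u"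
  by (simp add: nrm_def ip_dirac_flow)

end

section \<open>Translation estimates\<close>

lemma rotor_expand: "rotor p q v = (cos p * cos q) *\<^sub>R v + (cos p * sin q) *\<^sub>R flip_J v
    + (sin p * cos q) *\<^sub>R scal_J v + (sin p * sin q) *\<^sub>R scal_J (flip_J v)"
  by (simp add: rotor_def Let_def spinor_linear algebra_simps)

text \<open>Each of the two rotations obeys the addition theorems because its generator squares to
  minus the identity, and the two generators commute.\<close>

lemma rotor_rotor: "rotor p q (rotor p' q' v) = rotor (p + p') (q + q') v"
proof -
  have rot: "cos p *\<^sub>R (cos p' *\<^sub>R w + sin p' *\<^sub>R w') + sin p *\<^sub>R (cos p' *\<^sub>R w' - sin p' *\<^sub>R w)
     = cos (p + p') *\<^sub>R w + sin (p + p') *\<^sub>R w'" for p p' and w w' :: "complex^2"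
    by (simp add: cos_add sin_add algebra_simps)
  define e where "e q v = cos q *\<^sub>R v + sin q *\<^sub>R flip_J v" for q v
  define d where "d p v = cos p *\<^sub>R v + sin p *\<^sub>R scal_J v" for p v
  have "e q (e q' v) = e (q + q') v" "d p (d p' v) = d (p + p') v" for p p' q q' v
    using rot[of q q' v "flip_J v"] rot[of p p' v "scal_J v"]
    by (simp_all add: e_def d_def spinor_linear spinor_mult)
  moreover have "e q (d p v) = d p (e q v)" for p q v
    by (simp add: e_def d_def spinor_linear spinor_mult algebra_simps)
  moreover have "rotor p q v = d p (e q v)" for p q v
    by (simp add: rotor_def e_def d_def Let_def)
  ultimately show ?thesis by simp
qed

lemma rotor_0 [simp]: "rotor 0 0 v = v"
  by (simp add: rotor_expand)

lemma rotor_inner: "rotor p q v \<bullet> w = v \<bullet> rotor (- p) (- q) w"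
  by (simp add: rotor_expand inner_add_left inner_add_right inner_diff_right spinor_inner spinor_mult)

lemma norm_rotor [simp]: "norm (rotor p q v) = norm v"
  by (simp add: norm_eq_sqrt_inner rotor_inner rotor_rotor)

lemma rotor_diff: "rotor p q (v - w) = rotor p q v - rotor p q w"
  by (simp add: rotor_expand spinor_linear algebra_simps)

lemma rotor_has_vector_derivative:
  "((\<lambda>r. rotor (r * p) (r * q) v) has_vector_derivative
     p *\<^sub>R scal_J (rotor (r * p) (r * q) v) + q *\<^sub>R flip_J (rotor (r * p) (r * q) v)) (at r)"
proof -
  have t: "((\<lambda>r. f r *\<^sub>R w) has_vector_derivative f' *\<^sub>R w) (at r)"
    if "(f has_real_derivative f') (at r)" for f f' and w :: "complex^2"
    using has_vector_derivative_scaleR[OF that has_vector_derivative_const[of w]] by simp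
  have "((\<lambda>r. cos (r * p) * cos (r * q)) has_real_derivative
      - p * (sin (r * p) * cos (r * q)) - q * (cos (r * p) * sin (r * q))) (at r)"
    "((\<lambda>r. cos (r * p) * sin (r * q)) has_real_derivative
      - p * (sin (r * p) * sin (r * q)) + q * (cos (r * p) * cos (r * q))) (at r)"
    "((\<lambda>r. sin (r * p) * cos (r * q)) has_real_derivative
      p * (cos (r * p) * cos (r * q)) - q * (sin (r * p) * sin (r * q))) (at r)"
    "((\<lambda>r. sin (r * p) * sin (r * q)) has_real_derivative
      p * (cos (r * p) * sin (r * q)) + q * (sin (r * p) * cos (r * q))) (at r)"
    by (auto intro!: derivative_eq_intros simp: algebra_simps)
  note d = this[THEN t]
  show ?thesis
    unfolding rotor_expand
    by (rule has_vector_derivative_eq_rhs[OF has_vector_derivative_add[OF has_vector_derivative_add[OF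
            has_vector_derivative_add[OF d(1,2)] d(3)] d(4)]])
       (simp add: spinor_linear spinor_mult algebra_simps)
qed

context period_cell
begin

text \<open>A difference form of a bound on the L^2 norm of the derivative. Forward shifts by at
  most one period suffice: this is the range of \<open>ip_shift\<close>, and small positive shifts
  already determine derivatives.\<close>

definition tlip :: "real \<Rightarrow> (real \<Rightarrow> complex^2) \<Rightarrow> bool" where
  "tlip L q \<longleftrightarrow> (\<forall>h. 0 \<le> h \<and> h \<le> b - a \<longrightarrow> nrm (\<lambda>x. q (x + h) - q x) \<le> L * h)"

lemma nrm_shift:
  assumes "cper u" "0 \<le> h" "h \<le> b - a"
  shows "nrm (\<lambda>x. u (x + h)) = nrm u"
  using ip_shift[OF assms(1,1,2,3)] by (simp add: nrm_def)

lemma ip_shift_deriv: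
  assumes q: "cper q" and f: "\<And>x. (f has_vector_derivative f' x) (at x)" and f': "continuous_on UNIV f'"
  shows "((\<lambda>h. ip q (\<lambda>x. f (x + h))) has_vector_derivative ip q (\<lambda>x. f' (x + h))) (at h within S)"
proof -
  have fc: "continuous_on UNIV f"
    by (intro continuous_at_imp_continuous_on ballI) (rule has_vector_derivative_continuous[OF f])
  have "((\<lambda>h. integral (cbox a b) (\<lambda>x. q x \<bullet> f (x + h))) has_vector_derivative
      integral (cbox a b) (\<lambda>x. q x \<bullet> f' (x + h))) (at h within UNIV)"
  proof (rule leibniz_rule_vector_derivative)
    fix h x
    have "((\<lambda>h. f (h + x)) has_vector_derivative f' (h + x)) (at h)"
      using f by (rule has_vector_derivative_shift)
    then show "((\<lambda>h. q x \<bullet> f (x + h)) has_vector_derivative q x \<bullet> f' (x + h)) (at h within UNIV)"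
      using bounded_linear.has_vector_derivative[OF bounded_linear_inner_right] by (simp add: add.commute)
    have "continuous_on {a..b} (\<lambda>x. f (x + h))"
      by (rule continuous_on_compose2[OF fc]) (auto intro!: continuous_intros)
    then show "(\<lambda>x. q x \<bullet> f (x + h)) integrable_on cbox a b"
      using cper_continuous[OF q, of "{a..b}"] by (simp, intro integrable_continuous_real continuous_intros)
  next
    show "continuous_on (UNIV \<times> cbox a b) (\<lambda>(h, x). q x \<bullet> f' (x + h))"
      unfolding case_prod_beta
      by (intro continuous_intros continuous_on_compose2[OF f'] continuous_on_compose2[OF cper_continuous[OF q, of UNIV]]) auto
  qed auto
  then show ?thesis by (simp add: ip_def has_vector_derivative_at_within)
qed

text \<open>The increment \<open>g\<close> is paired with itself. With one factor frozen, the
  pairing is a scalar function of the shift with derivative at most \<open>nrm g * K\<close>;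
  cancelling one factor \<open>nrm g\<close> gives the bound.\<close>

lemma tlip_from_deriv:
  assumes "c1per u" "\<And>x. (u has_vector_derivative u' x) (at x)" "cper u'" "nrm u' \<le> K"
  shows "tlip K u"
  unfolding tlip_def
proof safe
  fix h assume h: "0 \<le> h" "h \<le> b - a"
  define g where "g = (\<lambda>x. u (x + h) - u x)"
  have u: "cper u" using assms c1per_cper by blast
  have g: "cper g" unfolding g_def by (intro cper_diff cper_shift u)
  have "norm (ip g (\<lambda>x. u (x + h)) - ip g (\<lambda>x. u (x + 0))) \<le> (nrm g * K) * \<bar>h - 0\<bar>"
  proof (rule mvt_bound)
    fix r assume r: "r \<in> {0..b - a}"
    show "((\<lambda>h. ip g (\<lambda>x. u (x + h))) has_vector_derivative ip g (\<lambda>x. u' (x + r))) (at r within {0..b - a})"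
      by (rule ip_shift_deriv[OF g assms(2) cper_continuous[OF assms(3)]])
    have "\<bar>ip g (\<lambda>x. u' (x + r))\<bar> \<le> nrm g * nrm (\<lambda>x. u' (x + r))"
      by (intro ip_Cauchy_Schwarz g cper_shift assms)
    also have "nrm (\<lambda>x. u' (x + r)) = nrm u'" using r by (intro nrm_shift assms) auto
    also have "nrm g * nrm u' \<le> nrm g * K" using assms(4) by (intro mult_left_mono) auto
    finally show "norm (ip g (\<lambda>x. u' (x + r))) \<le> nrm g * K" by simp
  qed (use h in auto)
  moreover have "ip g (\<lambda>x. u (x + h)) - ip g (\<lambda>x. u (x + 0)) = (nrm g)\<^sup>2"
    unfolding nrm_square using ip_linear(5)[OF cper_shift[OF u, of h] u g] by (simp add: g_def)
  ultimately have "nrm g * nrm g \<le> nrm g * (K * h)"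
    using h by (simp add: power2_eq_square)
  then have "nrm g \<le> K * h"
    using h order_trans[OF nrm_ge_0[of u'] assms(4)] nrm_ge_0[of g]
    by (cases "nrm g = 0") (auto simp: mult_le_cancel_left)
  then show "nrm (\<lambda>x. u (x + h) - u x) \<le> K * h" by (simp add: g_def)
qed

lemma tlip_nonneg:
  assumes "tlip L q"
  shows "0 \<le> L"
proof -
  have "0 \<le> nrm (\<lambda>x. q (x + (b - a)) - q x)" by simp
  also have "\<dots> \<le> L * (b - a)" using assms ab by (simp add: tlip_def)
  finally show ?thesis using ab by (simp add: zero_le_mult_iff)
qed

text \<open>Integration by parts at the level of difference quotients: translation invariance moves
  the shift from \<open>f\<close> to \<open>q\<close>. The bound sees \<open>f\<close> only through
  its norm, which is essential when \<open>f\<close> is a transported defect.\<close>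

lemma ip_deriv_le:
  assumes q: "cper q" "tlip L q" and f: "cper f" "\<And>x. (f has_vector_derivative f' x) (at x)" "continuous_on UNIV f'"
  shows "\<bar>ip q f'\<bar> \<le> L * nrm f"
proof -
  define \<phi> where "\<phi> h = ip q (\<lambda>x. f (x + h))" for h
  have "(\<phi> has_vector_derivative ip q (\<lambda>x. f' (x + 0))) (at 0 within {0..b - a})"
    unfolding \<phi>_def by (rule ip_shift_deriv[OF q(1) f(2,3)])
  then have "((\<lambda>h. (\<phi> h - \<phi> 0) / (h - 0)) \<longlongrightarrow> ip q f') (at 0 within {0..b - a})"
    unfolding has_field_derivative_iff[symmetric] has_real_derivative_iff_has_vector_derivative by simp
  then have lim: "((\<lambda>h. \<bar>\<phi> h - \<phi> 0\<bar> / \<bar>h\<bar>) \<longlongrightarrow> \<bar>ip q f'\<bar>) (at 0 within {0..b - a})"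
    using tendsto_rabs by fastforce
  have "\<bar>\<phi> h - \<phi> 0\<bar> / \<bar>h\<bar> \<le> L * nrm f" if h: "0 < h" "h \<le> b - a" for h
  proof -
    \<comment> \<open>Shifting both factors leaves the pairing unchanged, so the increment of
      \<open>f\<close> becomes one of \<open>q\<close>.\<close>
    have "\<phi> 0 = ip (\<lambda>x. q (x + h)) (\<lambda>x. f (x + h))"
      using ip_shift[OF q(1) f(1), of h] h by (simp add: \<phi>_def)
    then have "\<phi> 0 - \<phi> h = ip (\<lambda>x. q (x + h) - q x) (\<lambda>x. f (x + h))"
      unfolding \<phi>_def using ip_linear(2)[OF cper_shift[OF q(1)] q(1) cper_shift[OF f(1)]] by simp
    then have "\<bar>\<phi> h - \<phi> 0\<bar> \<le> nrm (\<lambda>x. q (x + h) - q x) * nrm (\<lambda>x. f (x + h))"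
      using ip_Cauchy_Schwarz[OF cper_diff[OF cper_shift[OF q(1)] q(1)] cper_shift[OF f(1)], of h h]
      by (simp add: abs_minus_commute)
    also have "\<dots> \<le> (L * h) * nrm f"
      using q(2) h nrm_shift[OF f(1), of h] by (auto simp: tlip_def intro!: mult_right_mono)
    finally show ?thesis using h by (simp add: divide_le_eq mult.commute mult.left_commute)
  qed
  then have "eventually (\<lambda>h. \<bar>\<phi> h - \<phi> 0\<bar> / \<bar>h\<bar> \<le> L * nrm f) (at 0 within {0..b - a})"
    by (auto simp: eventually_at_filter intro!: always_eventually)
  from tendsto_upperbound[OF lim this] show ?thesis
    using ab by (simp add: at_within_Icc_at_right)
qed

text \<open>The time derivative of the pairing has a mass part, bounded by Cauchy-Schwarz, and a
  transport part, bounded by \<open>ip_deriv_le\<close>. The function \<open>q\<close> will be a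
  commutator term, whose coefficients are only Lipschitz; hence the form of its hypotheses.\<close>

lemma ip_dirac_flow_minus_id:
  assumes q: "cper q" "tlip L q" and f: "c1per f"
  shows "\<bar>ip q (\<lambda>x. dirac_flow t f x - f x)\<bar> \<le> \<bar>t\<bar> * (L + nrm q) * nrm f"
proof -
  obtain f' where f': "cper f'" "\<And>x. (f has_vector_derivative f' x) (at x)"
    using f c1perE by blast
  obtain \<Psi>t \<Psi>x where d:
    "\<And>t x. ((\<lambda>t. dirac_flow t f x) has_vector_derivative \<Psi>t t x) (at t)"
    "\<And>t x. (dirac_flow t f has_vector_derivative \<Psi>x t x) (at x)"
    "continuous_on UNIV (\<lambda>(t, x). \<Psi>t t x)" "continuous_on UNIV (\<lambda>(t, x). \<Psi>x t x)"
    "\<And>t x. \<Psi>t t x = - flip (\<Psi>x t x) + mass (dirac_flow t f x)"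
    using dirac_flow_solves[OF f'(2) cper_continuous[OF f'(1)]] by blast
  have fl: "cper (dirac_flow s f)" for s using c1per_dirac_flow[OF f] c1per_cper by blast
  have sl: "continuous_on UNIV (\<Psi>x s)" for s
    using continuous_on_slice[of UNIV \<Psi>x s] d(4) by simp
  have px: "cper (\<Psi>x s)" for s
    using vector_derivative_periodic[OF _ d(2)] fl sl by (auto simp: cper_def)
  have "norm (ip q (dirac_flow t f) - ip q (dirac_flow 0 f)) \<le> ((L + nrm q) * nrm f) * \<bar>t - 0\<bar>"
  proof (rule mvt_bound)
    fix s :: real
    have "((\<lambda>s. integral (cbox a b) (\<lambda>x. q x \<bullet> dirac_flow s f x)) has_vector_derivative
        integral (cbox a b) (\<lambda>x. q x \<bullet> \<Psi>t s x)) (at s within UNIV)"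
    proof (rule leibniz_rule_vector_derivative)
      show "((\<lambda>s. q x \<bullet> dirac_flow s f x) has_vector_derivative q x \<bullet> \<Psi>t s x) (at s within UNIV)" for s x
        using bounded_linear.has_vector_derivative[OF bounded_linear_inner_right d(1)] by simp
      show "(\<lambda>x. q x \<bullet> dirac_flow s f x) integrable_on cbox a b" for s
        using integrable_inner[OF q(1) fl] by simp
      have "continuous_on (UNIV \<times> cbox a b) (\<lambda>(t, x). \<Psi>t t x)"
        using d(3) by (rule continuous_on_subset) auto
      then show "continuous_on (UNIV \<times> cbox a b) (\<lambda>(s, x). q x \<bullet> \<Psi>t s x)"
        unfolding case_prod_beta
        by (intro continuous_intros continuous_on_compose2[OF cper_continuous[OF q(1), of UNIV]]) auto
    qed auto
    then show "((\<lambda>s. ip q (dirac_flow s f)) has_vector_derivative ip q (\<Psi>t s)) (at s within UNIV)"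
      by (simp add: ip_def)
    have m: "cper (\<lambda>x. mass (dirac_flow s f x))" "cper (\<lambda>x. flip (\<Psi>x s x))" "cper (\<lambda>x. flip (dirac_flow s f x))"
      using cper_linear[OF bounded_linear_mass fl] cper_linear[OF bounded_linear_flip px]
        cper_linear[OF bounded_linear_flip fl] by auto
    have "ip q (\<Psi>t s) = ip q (\<lambda>x. mass (dirac_flow s f x)) - ip q (\<lambda>x. flip (\<Psi>x s x))"
      using ip_linear(5)[OF m(1,2) q(1)] by (simp add: d(5)[abs_def])
    also have "\<bar>\<dots>\<bar> \<le> nrm q * nrm (\<lambda>x. mass (dirac_flow s f x)) + L * nrm (\<lambda>x. flip (dirac_flow s f x))"
      using ip_Cauchy_Schwarz[OF q(1) m(1)]
        ip_deriv_le[OF q m(3) spinor_has_vector_derivative(1)[OF d(2)] cper_continuous[OF m(2)]] by linarith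
    also have "\<dots> = (L + nrm q) * nrm f"
      using nrm_cong_norm[of "\<lambda>x. mass (dirac_flow s f x)" "dirac_flow s f"]
        nrm_cong_norm[of "\<lambda>x. flip (dirac_flow s f x)" "dirac_flow s f"]
      by (simp add: nrm_dirac_flow[OF f] algebra_simps)
    finally show "norm (ip q (\<Psi>t s)) \<le> (L + nrm q) * nrm f" by simp
  qed auto
  then show ?thesis
    using ip_linear(5)[OF fl[of t] c1per_cper[OF f] q(1)] by (simp add: dirac_flow_0 mult.commute mult.left_commute)
qed

text \<open>The increment \<open>g\<close> is paired with itself, and the flow is moved onto
  \<open>g\<close> as its inverse. What remains is a pairing of \<open>u\<close> with an increment
  of the backward flow of \<open>g\<close>, where the previous bound applies.\<close>

lemma nrm_dirac_flow_minus_id: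
  assumes u: "c1per u" "tlip L u"
  shows "nrm (\<lambda>x. dirac_flow t u x - u x) \<le> \<bar>t\<bar> * (L + nrm u)"
proof -
  define g where "g = (\<lambda>x. dirac_flow t u x - u x)"
  have c: "c1per g" "c1per (dirac_flow t u)" "c1per (dirac_flow (- t) g)"
    unfolding g_def using u by (auto intro!: c1per_diff c1per_dirac_flow)
  have "(nrm g)\<^sup>2 = ip g (dirac_flow t u) - ip g u"
    unfolding nrm_square using ip_linear(5)[OF c1per_cper c1per_cper c1per_cper] c u by (simp add: g_def)
  also have "ip g (dirac_flow t u) = ip (dirac_flow t (dirac_flow (- t) g)) (dirac_flow t u)"
    by (simp add: dirac_flow_add c dirac_flow_0)
  also have "\<dots> = ip u (dirac_flow (- t) g)" using ip_dirac_flow[OF c(3) u(1)] by (simp add: ip_commute)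
  also have "\<dots> - ip g u = ip u (\<lambda>x. dirac_flow (- t) g x - g x)"
    using ip_linear(5)[OF c(3,1)[THEN c1per_cper] c1per_cper[OF u(1)]] by (simp add: ip_commute[of g u])
  also have "\<dots> \<le> \<bar>t\<bar> * (L + nrm u) * nrm g"
    using ip_dirac_flow_minus_id[OF c1per_cper[OF u(1)] u(2) c(1), of "- t"] by simp
  finally have "nrm g * nrm g \<le> nrm g * (\<bar>t\<bar> * (L + nrm u))" by (simp add: power2_eq_square mult.commute)
  then have "nrm g \<le> \<bar>t\<bar> * (L + nrm u)"
    using nrm_ge_0[of g] nrm_ge_0[of u] tlip_nonneg[OF u(2)]
    by (cases "nrm g = 0") (auto simp: mult_le_cancel_left)
  then show ?thesis by (simp add: g_def)
qed

lemma dirac_flow_shift: "dirac_flow t (\<lambda>x. u (x + h)) x = dirac_flow t u (x + h)"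
proof -
  have "x - y + h = x + h - y" "x + y + h = x + h + y" for y by simp_all
  then show ?thesis by (simp only: dirac_flow_def cone_int_def)
qed

text \<open>The free equation has constant coefficients, so translations commute with the flow, and
  the flow preserves norms of differences.\<close>

lemma tlip_dirac_flow:
  assumes "c1per u" "tlip L u"
  shows "tlip L (dirac_flow t u)"
  using assms nrm_dirac_flow_diff[OF c1per_shift[OF assms(1)] assms(1), of t]
  by (simp add: tlip_def dirac_flow_shift)

end

section \<open>Potentials with Lipschitz derivative\<close>

text \<open>Serves to discard a second-order Taylor remainder inside a pairing, in place of a
  product rule for functions of time with values in L^2.\<close>

lemma quadratic_has_derivative_0:
  fixes f :: "real \<Rightarrow> real"
  assumes "\<And>s. s \<in> S \<Longrightarrow> \<bar>f s\<bar> \<le> C * (s - s0)\<^sup>2" "s0 \<in> S"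
  shows "(f has_real_derivative 0) (at s0 within S)"
proof -
  have f0: "f s0 = 0" using assms(1)[OF assms(2)] by simp
  have "((\<lambda>s. C * \<bar>s - s0\<bar>) \<longlongrightarrow> C * \<bar>s0 - s0\<bar>) (at s0 within S)" by (intro tendsto_intros)
  then have lim: "((\<lambda>s. C * \<bar>s - s0\<bar>) \<longlongrightarrow> 0) (at s0 within S)" by simp
  have "norm ((f s - f s0) / (s - s0)) \<le> C * \<bar>s - s0\<bar>" if "s \<in> S" "s \<noteq> s0" for s
  proof -
    have "(s - s0)\<^sup>2 = \<bar>s - s0\<bar> * \<bar>s - s0\<bar>" by (simp add: power2_eq_square)
    then show ?thesis using assms(1)[OF that(1)] that(2) by (simp add: f0 abs_divide divide_le_eq mult.assoc)
  qed
  then have "((\<lambda>s. (f s - f s0) / (s - s0)) \<longlongrightarrow> 0) (at s0 within S)"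
    by (intro Lim_null_comparison[OF _ lim]) (auto simp: eventually_at_filter intro!: always_eventually)
  then show ?thesis by (simp add: has_field_derivative_iff)
qed

text \<open>The C^{1,1} content of the assumption on the potentials for \<open>m \<ge> 2\<close>,
  with a single constant \<open>B\<close> for all bounds.\<close>

locale dirac_potential = period_cell +
  fixes V A1 V' A1' :: "real \<Rightarrow> real" and B :: real
  assumes V_per: "periodic_fun a b V" and A_per: "periodic_fun a b A1"
    and V_deriv: "\<And>x. (V has_vector_derivative V' x) (at x)"
    and A_deriv: "\<And>x. (A1 has_vector_derivative A1' x) (at x)"
    and V_bound: "\<And>x. \<bar>V x\<bar> \<le> B" and A_bound: "\<And>x. \<bar>A1 x\<bar> \<le> B"
    and V'_bound: "\<And>x. \<bar>V' x\<bar> \<le> B" and A'_bound: "\<And>x. \<bar>A1' x\<bar> \<le> B"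
    and V'_lip: "\<And>x y. \<bar>V' x - V' y\<bar> \<le> B * \<bar>x - y\<bar>"
    and A'_lip: "\<And>x y. \<bar>A1' x - A1' y\<bar> \<le> B * \<bar>x - y\<bar>"
begin

lemma B_nonneg: "0 \<le> B"
  using V_bound[of 0] by simp

lemma cper_V': "cper V'" and cper_A': "cper A1'"
  using V'_lip A'_lip B_nonneg vector_derivative_periodic[OF V_per V_deriv]
    vector_derivative_periodic[OF A_per A_deriv]
  by (auto simp: cper_def dist_real_def intro!: lipschitz_on_continuous_on[of B] lipschitz_onI)

lemma c1per_V: "c1per V" and c1per_A: "c1per A1"
  using c1perI[OF V_per V_deriv] c1perI[OF A_per A_deriv] cper_V' cper_A' by (auto simp: cper_def)

lemma A_lip: "\<bar>A1 x - A1 y\<bar> \<le> B * \<bar>x - y\<bar>"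
  using mvt_bound[of UNIV A1 A1' B y x] A_deriv A'_bound by simp

definition pot :: "real \<Rightarrow> complex^2 \<Rightarrow> complex^2" where
  "pot x v = V x *\<^sub>R scal_J v + A1 x *\<^sub>R flip_J v"

text \<open>The commutator \<open>[\<^bold>V, \<^bold>T]\<close> has order zero because \<open>\<^bold>V\<close> commutes with \<open>\<sigma>\<^sub>1\<close>.\<close>

definition comm :: "real \<Rightarrow> complex^2 \<Rightarrow> complex^2" where
  "comm x v = V' x *\<^sub>R flip (scal_J v) + A1' x *\<^sub>R flip (flip_J v)
     + A1 x *\<^sub>R (flip_J (mass v) - mass (flip_J v))"

text \<open>The pointwise exponential of \<open>r\<close> times the potential, in the closed form
  provided by \<open>mexp_Vmat\<close>.\<close>

definition evol :: "real \<Rightarrow> real \<Rightarrow> complex^2 \<Rightarrow> complex^2" where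
  "evol r x v = rotor (r * V x) (r * A1 x) v"

lemma norm_pot: "norm (pot x v) \<le> 2 * B * norm v"
proof -
  have "norm (pot x v) \<le> \<bar>V x\<bar> * norm v + \<bar>A1 x\<bar> * norm v"
    unfolding pot_def by (rule norm_triangle_le) simp
  also have "\<dots> \<le> B * norm v + B * norm v"
    using V_bound A_bound by (intro add_mono mult_right_mono) auto
  finally show ?thesis by simp
qed

text \<open>The coefficients are kept free so that the bound serves both for the commutator and for
  its increments in \<open>x\<close>. The 4 is 1 + 1 + 2, the mass term consisting of two
  products.\<close>

lemma norm_comm_aux:
  fixes v :: "complex^2"
  assumes "\<bar>p\<bar> \<le> C" "\<bar>q\<bar> \<le> C" "\<bar>r\<bar> \<le> C"
  shows "norm (p *\<^sub>R flip (scal_J v) + q *\<^sub>R flip (flip_J v) + r *\<^sub>R (flip_J (mass v) - mass (flip_J v)))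
    \<le> 4 * C * norm v"
proof -
  have "norm (flip_J (mass v) - mass (flip_J v)) \<le> 2 * norm v"
    using norm_triangle_ineq4[of "flip_J (mass v)" "mass (flip_J v)"] by simp
  then have "\<bar>r\<bar> * norm (flip_J (mass v) - mass (flip_J v)) \<le> C * (2 * norm v)"
    using assms by (intro mult_mono) auto
  moreover have "\<bar>p\<bar> * norm v \<le> C * norm v" "\<bar>q\<bar> * norm v \<le> C * norm v"
    using assms by (auto intro: mult_right_mono)
  ultimately show ?thesis
    by (intro order_trans[OF norm_triangle_ineq] order_trans[OF add_right_mono[OF norm_triangle_ineq]]) simp
qed

lemma norm_comm: "norm (comm x v) \<le> 4 * B * norm v"
  unfolding comm_def by (intro norm_comm_aux V'_bound A'_bound A_bound)

lemma comm_lip: "norm (comm x v - comm y v) \<le> 4 * B * \<bar>x - y\<bar> * norm v"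
proof -
  have "comm x v - comm y v = (V' x - V' y) *\<^sub>R flip (scal_J v) + (A1' x - A1' y) *\<^sub>R flip (flip_J v)
     + (A1 x - A1 y) *\<^sub>R (flip_J (mass v) - mass (flip_J v))"
    by (simp add: comm_def algebra_simps)
  then show ?thesis
    using norm_comm_aux[OF V'_lip[of x y] A'_lip[of x y] A_lip[of x y], of v] by (simp add: mult.assoc)
qed

lemma pot_inner: "pot x v \<bullet> w = - (v \<bullet> pot x w)"
  by (simp add: pot_def inner_add_left inner_add_right spinor_inner)

lemma comm_diff: "comm x (v - w) = comm x v - comm x w"
  by (simp add: comm_def spinor_linear algebra_simps)

lemma pot_diff: "pot x (v - w) = pot x v - pot x w"
  by (simp add: pot_def spinor_linear algebra_simps)

lemma c1per_pot: "c1per u \<Longrightarrow> c1per (\<lambda>x. pot x (u x))"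
  unfolding pot_def
  by (intro c1per_add c1per_scaleR c1per_V c1per_A c1per_linear[OF bounded_linear_scal_J]
      c1per_linear[OF bounded_linear_flip_J])

lemma cper_comm:
  assumes "cper u"
  shows "cper (\<lambda>x. comm x (u x))"
proof -
  note lin = cper_linear[OF bounded_linear_scal_J] cper_linear[OF bounded_linear_flip_J]
    cper_linear[OF bounded_linear_mass] cper_linear[OF bounded_linear_flip]
  have "cper (\<lambda>x. flip (scal_J (u x)))" "cper (\<lambda>x. flip (flip_J (u x)))"
    "cper (\<lambda>x. flip_J (mass (u x)))" "cper (\<lambda>x. mass (flip_J (u x)))"
    using lin(4)[OF lin(1)[OF assms]] lin(4)[OF lin(2)[OF assms]] lin(2)[OF lin(3)[OF assms]]
      lin(3)[OF lin(2)[OF assms]] by auto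
  then show ?thesis
    unfolding comm_def
    by (intro cper_add cper_scaleR cper_diff cper_V' cper_A' c1per_cper[OF c1per_A])
qed

lemma c1per_trig:
  fixes f :: "real \<Rightarrow> real"
  assumes "c1per f"
  shows "c1per (\<lambda>x. cos (r * f x))" "c1per (\<lambda>x. sin (r * f x))"
proof -
  obtain f' where f': "cper f'" "\<And>x. (f has_vector_derivative f' x) (at x)"
    using assms c1perE by blast
  have d: "((\<lambda>x. cos (r * f x)) has_vector_derivative - (r * f' x * sin (r * f x))) (at x)"
    "((\<lambda>x. sin (r * f x)) has_vector_derivative r * f' x * cos (r * f x)) (at x)" for x
    using f'(2) unfolding has_real_derivative_iff_has_vector_derivative[symmetric]
    by (auto intro!: derivative_eq_intros)
  show "c1per (\<lambda>x. cos (r * f x))" "c1per (\<lambda>x. sin (r * f x))"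
    using c1per_cper[OF assms] f'(1)
    by (auto intro!: c1perI[OF _ d(1)] c1perI[OF _ d(2)] continuous_intros
        simp: cper_def periodic_fun_def)
qed

lemma c1per_evol:
  assumes "c1per u"
  shows "c1per (\<lambda>x. evol r x (u x))"
proof -
  have J: "c1per (\<lambda>x. scal_J (w x))" "c1per (\<lambda>x. flip_J (w x))" if "c1per w" for w
    using that by (auto intro: c1per_linear[OF bounded_linear_scal_J] c1per_linear[OF bounded_linear_flip_J])
  show ?thesis
    unfolding evol_def rotor_def Let_def
    by (intro c1per_add c1per_scaleR c1per_trig c1per_V c1per_A J assms)
qed

section \<open>The propagator of the potential\<close>

lemma evol_simps:
  "evol 0 x v = v" "evol r x (evol s x v) = evol (r + s) x v" "norm (evol r x v) = norm v"
  "evol r x v \<bullet> w = v \<bullet> evol (- r) x w" "evol r x (v - w) = evol r x v - evol r x w"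
  by (simp_all add: evol_def rotor_rotor rotor_inner rotor_diff algebra_simps)

lemma evol_deriv: "((\<lambda>r. evol r x v) has_vector_derivative pot x (evol r x v)) (at r)"
  unfolding evol_def pot_def by (rule rotor_has_vector_derivative)

lemma evol_minus_id: "norm (evol h x v - v) \<le> 2 * B * \<bar>h\<bar> * norm v"
proof -
  have "norm (evol h x v - evol 0 x v) \<le> (2 * B * norm v) * \<bar>h - 0\<bar>"
  proof (rule mvt_bound[where S = UNIV])
    show "((\<lambda>h. evol h x v) has_vector_derivative pot x (evol r x v)) (at r within UNIV)" for r
      by (rule evol_deriv)
    show "norm (pot x (evol r x v)) \<le> 2 * B * norm v" for r
      using norm_pot[of x "evol r x v"] by (simp add: evol_simps)
  qed auto
  then show ?thesis by (simp add: evol_simps mult_ac)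
qed

text \<open>The derivative differs from its initial value by \<open>pot\<close> applied to an
  increment of the propagator; each of the two uses of the potential costs a factor
  \<open>2 * B\<close>.\<close>

lemma evol_taylor: "norm (evol h x v - v - h *\<^sub>R pot x v) \<le> (2 * B)\<^sup>2 * h\<^sup>2 * norm v"
proof -
  have "norm (evol h x v - evol 0 x v - (h - 0) *\<^sub>R pot x (evol 0 x v))
     \<le> norm (h - 0) * ((2 * B)\<^sup>2 * \<bar>h\<bar> * norm v)"
  proof (rule vector_differentiable_bound_linearization[where f' = "\<lambda>r. pot x (evol r x v)"
        and S = "{- \<bar>h\<bar>..\<bar>h\<bar>}"])
    show "((\<lambda>r. evol r x v) has_vector_derivative pot x (evol r x v)) (at r within {- \<bar>h\<bar>..\<bar>h\<bar>})" for r
      using evol_deriv by (rule has_vector_derivative_at_within)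
    show "closed_segment 0 h \<subseteq> {- \<bar>h\<bar>..\<bar>h\<bar>}" by (auto simp: closed_segment_eq_real_ivl split: if_splits)
    fix r assume r: "r \<in> {- \<bar>h\<bar>..\<bar>h\<bar>}"
    have "norm (pot x (evol r x v) - pot x (evol 0 x v)) \<le> 2 * B * norm (evol r x v - v)"
      using norm_pot[of x "evol r x v - v"] by (simp add: pot_diff evol_simps)
    also have "\<dots> \<le> 2 * B * (2 * B * \<bar>r\<bar> * norm v)"
      using evol_minus_id B_nonneg by (intro mult_left_mono) auto
    also have "\<dots> \<le> 2 * B * (2 * B * \<bar>h\<bar> * norm v)"
      using r B_nonneg by (intro mult_left_mono mult_right_mono) auto
    finally show "norm (pot x (evol r x v) - pot x (evol 0 x v)) \<le> (2 * B)\<^sup>2 * \<bar>h\<bar> * norm v"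
      by (simp add: power2_eq_square mult_ac)
  qed auto
  then show ?thesis by (simp add: evol_simps power2_eq_square mult_ac)
qed

lemma nrm_pot: "cper u \<Longrightarrow> cper (\<lambda>x. pot x (u x)) \<Longrightarrow> nrm (\<lambda>x. pot x (u x)) \<le> 2 * B * nrm u"
  by (rule nrm_mono) (use norm_pot B_nonneg in auto)

lemma nrm_comm: "cper u \<Longrightarrow> nrm (\<lambda>x. comm x (u x)) \<le> 4 * B * nrm u"
  by (rule nrm_mono[OF cper_comm]) (use norm_comm B_nonneg in auto)

lemma nrm_evol [simp]: "nrm (\<lambda>x. evol r x (u x)) = nrm u"
  by (rule nrm_cong_norm) (simp add: evol_simps)

text \<open>The discrete product rule: an increment of \<open>q\<close> with the coefficients
  frozen, plus an increment of the coefficients. The second part is where the Lipschitz bounds on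
  \<open>V'\<close> and \<open>A1'\<close> enter quantitatively.\<close>

lemma tlip_comm:
  assumes q: "cper q" "tlip L q"
  shows "tlip (4 * B * (L + nrm q)) (\<lambda>x. comm x (q x))"
  unfolding tlip_def
proof safe
  fix h assume h: "0 \<le> h" "h \<le> b - a"
  have c: "cper (\<lambda>x. q (x + h) - q x)" by (intro cper_diff cper_shift q)
  have cs: "cper (\<lambda>x. comm (x + h) (q (x + h)))" using cper_shift[OF cper_comm[OF q(1)]] by simp
  \<comment> \<open>Seen as a translate by \<open>h\<close> of the commutator applied to
    \<open>q\<close> shifted by \<open>- h\<close>, which is continuous and periodic.\<close>
  have cq: "cper (\<lambda>x. comm (x + h) (q x))"
    using cper_shift[OF cper_comm[OF cper_shift[OF q(1), of "- h"]], of h] by simp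
  have c1: "cper (\<lambda>x. comm (x + h) (q (x + h) - q x))" and c2: "cper (\<lambda>x. comm (x + h) (q x) - comm x (q x))"
    unfolding comm_diff by (intro cper_diff cs cq cper_comm q)+
  have "nrm (\<lambda>x. comm (x + h) (q (x + h)) - comm x (q x))
     = nrm (\<lambda>x. comm (x + h) (q (x + h) - q x) + (comm (x + h) (q x) - comm x (q x)))"
    by (simp add: comm_diff)
  also have "\<dots> \<le> nrm (\<lambda>x. comm (x + h) (q (x + h) - q x)) + nrm (\<lambda>x. comm (x + h) (q x) - comm x (q x))"
    by (rule nrm_triangle[OF c1 c2])
  also have "\<dots> \<le> 4 * B * nrm (\<lambda>x. q (x + h) - q x) + (4 * B * h) * nrm q"
  proof (rule add_mono)
    show "nrm (\<lambda>x. comm (x + h) (q (x + h) - q x)) \<le> 4 * B * nrm (\<lambda>x. q (x + h) - q x)"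
      by (rule nrm_mono[OF c1 c]) (use norm_comm B_nonneg in auto)
    have "norm (comm (x + h) (q x) - comm x (q x)) \<le> 4 * B * h * norm (q x)" for x
      using comm_lip[of "x + h" "q x" x] h by simp
    then show "nrm (\<lambda>x. comm (x + h) (q x) - comm x (q x)) \<le> (4 * B * h) * nrm q"
      by (rule nrm_mono[OF c2 q(1)]) (use h B_nonneg in auto)
  qed
  also have "\<dots> \<le> 4 * B * (L * h) + (4 * B * h) * nrm q"
    using q(2) h B_nonneg by (intro add_mono mult_left_mono) (auto simp: tlip_def)
  finally show "nrm (\<lambda>x. comm (x + h) (q (x + h)) - comm x (q x)) \<le> 4 * B * (L + nrm q) * h"
    by (simp add: algebra_simps)
qed

text \<open>Since \<open>flip\<close> commutes with \<open>scal_J\<close> and \<open>flip_J\<close>,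
  all terms containing the space derivative cancel and the commutator remains as a source. Thus
  \<open>ip_dsol_deriv\<close> can differentiate pairings with the potential along the free
  flow.\<close>

lemma dsol_pot:
  assumes "dsol t0 t1 (\<lambda>s x. 0) \<Psi>"
  shows "dsol t0 t1 (\<lambda>s x. comm x (\<Psi> s x)) (\<lambda>s x. pot x (\<Psi> s x))"
proof -
  obtain \<Psi>t \<Psi>x where d:
    "\<And>s. s \<in> {t0..t1} \<Longrightarrow> periodic_fun a b (\<Psi> s)"
    "\<And>s x. s \<in> {t0..t1} \<Longrightarrow> ((\<lambda>r. \<Psi> r x) has_vector_derivative \<Psi>t s x) (at s within {t0..t1})"
    "\<And>s x. s \<in> {t0..t1} \<Longrightarrow> (\<Psi> s has_vector_derivative \<Psi>x s x) (at x)"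
    "continuous_on ({t0..t1} \<times> UNIV) (\<lambda>(s, x). \<Psi>t s x)"
    "continuous_on ({t0..t1} \<times> UNIV) (\<lambda>(s, x). \<Psi>x s x)"
    "continuous_on ({t0..t1} \<times> UNIV) (\<lambda>(s, x). \<Psi> s x)"
    "\<And>s x. s \<in> {t0..t1} \<Longrightarrow> \<Psi>t s x = - flip (\<Psi>x s x) + mass (\<Psi> s x) + 0"
    by (rule dsolE[OF assms]) blast
  define Px where "Px s x = (V x *\<^sub>R scal_J (\<Psi>x s x) + V' x *\<^sub>R scal_J (\<Psi> s x))
      + (A1 x *\<^sub>R flip_J (\<Psi>x s x) + A1' x *\<^sub>R flip_J (\<Psi> s x))" for s x
  have cont: "continuous_on ({t0..t1} \<times> UNIV) (\<lambda>p. f (snd p))" if "cper f" for f :: "real \<Rightarrow> real"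
    by (rule continuous_on_compose2[OF cper_continuous[OF that, of UNIV]]) (auto intro!: continuous_intros)
  show ?thesis
  proof (rule dsolI[of _ _ _ "\<lambda>s x. pot x (\<Psi>t s x)" Px])
    fix s x assume s: "s \<in> {t0..t1}"
    show "periodic_fun a b (\<lambda>x. pot x (\<Psi> s x))"
      using d(1)[OF s] V_per A_per by (simp add: periodic_fun_def pot_def)
    show "((\<lambda>r. pot x (\<Psi> r x)) has_vector_derivative pot x (\<Psi>t s x)) (at s within {t0..t1})"
      unfolding pot_def
      by (intro has_vector_derivative_add bounded_linear.has_vector_derivative[OF bounded_linear_scaleR_right]
          spinor_has_vector_derivative d(2)[OF s])
    show "((\<lambda>x. pot x (\<Psi> s x)) has_vector_derivative Px s x) (at x)"
      unfolding pot_def Px_def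
      by (intro has_vector_derivative_add has_vector_derivative_scaleR spinor_has_vector_derivative d(3)[OF s])
        (use V_deriv A_deriv in \<open>auto simp: has_real_derivative_iff_has_vector_derivative\<close>)
    show "pot x (\<Psi>t s x) = - flip (Px s x) + mass (pot x (\<Psi> s x)) + comm x (\<Psi> s x)"
      unfolding d(7)[OF s] pot_def Px_def comm_def
      by (simp add: spinor_linear spinor_mult algebra_simps)
  next
    show "continuous_on ({t0..t1} \<times> UNIV) (\<lambda>(s, x). pot x (\<Psi>t s x))"
      "continuous_on ({t0..t1} \<times> UNIV) (\<lambda>(s, x). Px s x)"
      using d(4-6) c1per_V c1per_A cper_V' cper_A'
      unfolding pot_def Px_def case_prod_beta
      by (auto intro!: continuous_intros cont c1per_cper)
  qed
qed

text \<open>The derivative of the pairing is the same pairing with the commutator. Its variation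
  consists of an increment of the flow of \<open>Z\<close>, bounded in norm, and one of the flow of
  \<open>p\<close>, bounded by duality against the commutator term. These give
  \<open>4 * B * (L + nrm Z)\<close> and \<open>4 * B * (L + nrm Z) + 4 * B * nrm Z\<close>, hence 8
  and 12. Both signs of \<open>t\<close> occur, on the two sides of the midpoint.\<close>

lemma pairing_second_order:
  assumes Z: "c1per Z" "tlip L Z" and p: "c1per p"
  shows "\<bar>ip (\<lambda>x. pot x (dirac_flow t Z x)) (dirac_flow t p) - ip (\<lambda>x. pot x (Z x)) p - t * ip (\<lambda>x. comm x (Z x)) p\<bar>
    \<le> (8 * B * L + 12 * B * nrm Z) * t\<^sup>2 * nrm p"
proof -
  define S where "S = {min 0 t..max 0 t}"
  define r where "r s = ip (\<lambda>x. pot x (dirac_flow s Z x)) (dirac_flow s p)" for s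
  define r' where "r' s = ip (\<lambda>x. comm x (dirac_flow s Z x)) (dirac_flow s p)" for s
  have cZ: "cper (dirac_flow s Z)" and cp: "cper (dirac_flow s p)" for s
    using Z p c1per_dirac_flow c1per_cper by blast+
  have zp: "cper Z" "cper p" using Z p c1per_cper by auto
  have "norm (r t - r 0 - (t - 0) *\<^sub>R r' 0) \<le> norm (t - 0) * ((8 * B * L + 12 * B * nrm Z) * \<bar>t\<bar> * nrm p)"
  proof (rule vector_differentiable_bound_linearization[where S = S and f' = r'])
    fix s assume s: "s \<in> S"
    have "dsol (min 0 t) (max 0 t) (\<lambda>s x. 0) (\<lambda>s. dirac_flow (s - 0) p)" by (intro dsol_dirac_flow p)
    then have sp: "dsol (min 0 t) (max 0 t) (\<lambda>s x. 0) (\<lambda>s. dirac_flow s p)" by simp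
    have "dsol (min 0 t) (max 0 t) (\<lambda>s x. 0) (\<lambda>s. dirac_flow (s - 0) Z)" by (intro dsol_dirac_flow Z)
    then have "dsol (min 0 t) (max 0 t) (\<lambda>s x. comm x (dirac_flow s Z x)) (\<lambda>s x. pot x (dirac_flow s Z x))"
      using dsol_pot by simp
    from ip_dsol_deriv[OF this sp, of s] s
    show "(r has_vector_derivative r' s) (at s within S)"
      by (simp add: r_def[abs_def] r'_def S_def cper_comm cZ cper_const) (simp add: ip_def)
    have "r' s - r' 0 = ip (\<lambda>x. comm x (dirac_flow s Z x - Z x)) (dirac_flow s p)
       + ip (\<lambda>x. comm x (Z x)) (\<lambda>x. dirac_flow s p x - p x)"
      unfolding r'_def comm_diff
      using ip_linear(2)[OF cper_comm[OF cZ] cper_comm[OF zp(1)] cp]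
        ip_linear(5)[OF cp zp(2) cper_comm[OF zp(1)]] by (simp add: dirac_flow_0)
    also have "\<bar>\<dots>\<bar> \<le> (4 * B * (\<bar>s\<bar> * (L + nrm Z))) * nrm p
       + \<bar>s\<bar> * (4 * B * (L + nrm Z) + 4 * B * nrm Z) * nrm p"
    proof (rule order_trans[OF abs_triangle_ineq], rule add_mono)
      have c: "cper (\<lambda>x. dirac_flow s Z x - Z x)" by (intro cper_diff cZ zp)
      have "\<bar>ip (\<lambda>x. comm x (dirac_flow s Z x - Z x)) (dirac_flow s p)\<bar>
          \<le> nrm (\<lambda>x. comm x (dirac_flow s Z x - Z x)) * nrm (dirac_flow s p)"
        by (intro ip_Cauchy_Schwarz cper_comm c cp)
      also have "\<dots> \<le> (4 * B * (\<bar>s\<bar> * (L + nrm Z))) * nrm p"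
        unfolding nrm_dirac_flow[OF p]
        using order_trans[OF nrm_comm[OF c] mult_left_mono[OF nrm_dirac_flow_minus_id[OF Z, of s]]] B_nonneg
        by (intro mult_right_mono) auto
      finally show "\<bar>ip (\<lambda>x. comm x (dirac_flow s Z x - Z x)) (dirac_flow s p)\<bar>
         \<le> (4 * B * (\<bar>s\<bar> * (L + nrm Z))) * nrm p" .
      have "\<bar>ip (\<lambda>x. comm x (Z x)) (\<lambda>x. dirac_flow s p x - p x)\<bar>
          \<le> \<bar>s\<bar> * (4 * B * (L + nrm Z) + nrm (\<lambda>x. comm x (Z x))) * nrm p"
        by (intro ip_dirac_flow_minus_id cper_comm zp tlip_comm Z p)
      also have "\<dots> \<le> \<bar>s\<bar> * (4 * B * (L + nrm Z) + 4 * B * nrm Z) * nrm p"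
        using nrm_comm[OF zp(1)] by (intro mult_right_mono mult_left_mono add_left_mono) auto
      finally show "\<bar>ip (\<lambda>x. comm x (Z x)) (\<lambda>x. dirac_flow s p x - p x)\<bar>
          \<le> \<bar>s\<bar> * (4 * B * (L + nrm Z) + 4 * B * nrm Z) * nrm p" .
    qed
    also have "\<dots> = (8 * B * L + 12 * B * nrm Z) * \<bar>s\<bar> * nrm p" by (simp add: algebra_simps)
    also have "\<dots> \<le> (8 * B * L + 12 * B * nrm Z) * \<bar>t\<bar> * nrm p"
      using s B_nonneg tlip_nonneg[OF Z(2)] by (intro mult_right_mono mult_left_mono) (auto simp: S_def)
    finally show "norm (r' s - r' 0) \<le> (8 * B * L + 12 * B * nrm Z) * \<bar>t\<bar> * nrm p" by simp
  qed (auto simp: S_def closed_segment_eq_real_ivl)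
  moreover have "norm (t - 0) * ((8 * B * L + 12 * B * nrm Z) * \<bar>t\<bar> * nrm p)
     = (8 * B * L + 12 * B * nrm Z) * t\<^sup>2 * nrm p"
    by (simp add: power2_eq_square abs_mult_self_eq mult_ac flip: abs_mult)
  ultimately have "norm (r t - r 0 - (t - 0) *\<^sub>R r' 0) \<le> (8 * B * L + 12 * B * nrm Z) * t\<^sup>2 * nrm p"
    by (simp only:)
  then show ?thesis by (simp add: r_def r'_def dirac_flow_0)
qed

end

section \<open>Error of the Strang splitting\<close>

context dirac_potential
begin

definition strang_step :: "real \<Rightarrow> real \<Rightarrow> (real \<Rightarrow> complex^2) \<Rightarrow> real \<Rightarrow> complex^2" where
  "strang_step \<epsilon> \<tau> u = dirac_flow (\<tau> / 2) (\<lambda>x. evol (\<epsilon> * \<tau>) x (dirac_flow (\<tau> / 2) u x))"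

text \<open>In the interaction picture \<open>Z(s) = e\<^bsup>(c-s)\<^bold>T\<^esup> \<Phi>(s)\<close> around the midpoint \<open>c\<close> of the step, a Strang step is
  the exponential midpoint rule \<open>e\<^bsup>\<epsilon>\<tau>\<^bold>V\<^esup>\<close>. Testing the defect \<open>d\<close> against its own transport \<open>p(s)\<close> under
  \<open>e\<^bsup>s\<epsilon>\<^bold>V\<^esup>\<close> reduces the estimate to the derivative of the scalar function \<open>\<langle>Z(s), p(s)\<rangle>\<close>; the term of
  that derivative linear in \<open>s - c\<close> is removed by the corrector \<open>\<epsilon> (s - c)\<^sup>2 / 2 \<cdot> \<langle>[\<^bold>V, \<^bold>T] Z(c), p(c)\<rangle>\<close>, which
  takes equal values at both endpoints.\<close>

lemma strang_local_error:
  assumes \<Phi>: "dsol t0 t1 (\<lambda>s x. \<epsilon> *\<^sub>R pot x (\<Phi> s x)) \<Phi>" and t: "t0 \<le> t1" and \<epsilon>: "0 \<le> \<epsilon>" "\<epsilon> \<le> 1"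
    and bound: "\<And>s. s \<in> {t0..t1} \<Longrightarrow> nrm (\<Phi> s) \<le> K" and lip: "\<And>s. s \<in> {t0..t1} \<Longrightarrow> tlip K (\<Phi> s)"
  shows "nrm (\<lambda>x. \<Phi> t1 x - strang_step \<epsilon> (t1 - t0) (\<Phi> t0) x) \<le> (20 * B + 16 * B\<^sup>2) * K * \<epsilon> * (t1 - t0) ^ 3"
proof -
  define \<tau> where "\<tau> = t1 - t0"
  define c where "c = (t0 + t1) / 2"
  have \<tau>: "0 \<le> \<tau>" "t1 - c = \<tau> / 2" "c - t0 = \<tau> / 2" using t by (simp_all add: \<tau>_def c_def field_simps)
  have c: "c \<in> {t0..t1}" using t by (simp add: c_def)
  have K: "0 \<le> K" using bound[OF c] nrm_ge_0[of "\<Phi> c"] by linarith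
  define Z where "Z s = dirac_flow (c - s) (\<Phi> s)" for s
  have \<Phi>c: "c1per (\<Phi> s)" if "s \<in> {t0..t1}" for s using dsol_c1per[OF \<Phi> that] .
  have Zc: "c1per (Z s)" if "s \<in> {t0..t1}" for s unfolding Z_def by (intro c1per_dirac_flow \<Phi>c that)
  have Zn: "nrm (Z s) \<le> K" if "s \<in> {t0..t1}" for s
    unfolding Z_def using bound[OF that] by (simp add: nrm_dirac_flow[OF \<Phi>c[OF that]])
  have Zl: "tlip K (Z s)" if "s \<in> {t0..t1}" for s
    unfolding Z_def by (intro tlip_dirac_flow \<Phi>c lip that)
  have ZF: "dirac_flow (s - c) (Z s) = \<Phi> s" if "s \<in> {t0..t1}" for s
    unfolding Z_def by (simp add: dirac_flow_add[OF \<Phi>c[OF that]] dirac_flow_0)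
  have pc: "cper (\<lambda>x. pot x (\<Phi> s x))" if "s \<in> {t0..t1}" for s
    by (intro c1per_cper c1per_pot \<Phi>c that)
  \<comment> \<open>A weak derivative: moving the flow onto the fixed \<open>g\<close> leaves a
    pairing of two sourced solutions, to which the energy identity applies.\<close>
  have Zd: "((\<lambda>s. ip (Z s) g) has_vector_derivative
      \<epsilon> * ip (\<lambda>x. pot x (\<Phi> s x)) (dirac_flow (s - c) g)) (at s within {t0..t1})"
    if g: "c1per g" and s: "s \<in> {t0..t1}" for g s
  proof -
    have "((\<lambda>s. ip (\<Phi> s) (dirac_flow (s - c) g)) has_vector_derivative
        ip (\<lambda>x. \<epsilon> *\<^sub>R pot x (\<Phi> s x)) (dirac_flow (s - c) g) + ip (\<Phi> s) (\<lambda>x. 0)) (at s within {t0..t1})"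
      by (intro ip_dsol_deriv \<Phi> dsol_dirac_flow g s cper_scale pc cper_const)
    then have "((\<lambda>s. ip (\<Phi> s) (dirac_flow (s - c) g)) has_vector_derivative
        \<epsilon> * ip (\<lambda>x. pot x (\<Phi> s x)) (dirac_flow (s - c) g)) (at s within {t0..t1})"
      by (simp add: ip_def)
    then show ?thesis
    proof (rule has_vector_derivative_transform[OF s, rotated])
      show "ip (Z r) g = ip (\<Phi> r) (dirac_flow (r - c) g)" if "r \<in> {t0..t1}" for r
        using ip_dirac_flow[OF Zc[OF that] g, of "r - c"] ZF[OF that] by simp
    qed
  qed
  have Zd_bound: "\<bar>\<epsilon> * ip (\<lambda>x. pot x (\<Phi> s x)) (dirac_flow (s - c) g)\<bar> \<le> \<epsilon> * (2 * B * K) * nrm g"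
    if g: "c1per g" and s: "s \<in> {t0..t1}" for g s
  proof -
    have "\<bar>ip (\<lambda>x. pot x (\<Phi> s x)) (dirac_flow (s - c) g)\<bar> \<le> nrm (\<lambda>x. pot x (\<Phi> s x)) * nrm (dirac_flow (s - c) g)"
      by (intro ip_Cauchy_Schwarz pc s c1per_cper c1per_dirac_flow g)
    also have "\<dots> \<le> (2 * B * K) * nrm g"
      unfolding nrm_dirac_flow[OF g]
      using order_trans[OF nrm_pot[OF c1per_cper[OF \<Phi>c[OF s]] pc[OF s]] mult_left_mono[OF bound[OF s]]] B_nonneg
      by (intro mult_right_mono) auto
    finally show ?thesis using \<epsilon>(1) by (simp add: abs_mult mult.assoc mult_left_mono)
  qed
  have Z_lip: "nrm (\<lambda>x. Z s x - Z r x) \<le> \<epsilon> * (2 * B * K) * \<bar>s - r\<bar>" if s: "s \<in> {t0..t1}" and r: "r \<in> {t0..t1}" for s r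
  proof -
    define g where "g = (\<lambda>x. Z s x - Z r x)"
    have g: "c1per g" unfolding g_def by (intro c1per_diff Zc s r)
    have "norm (ip (Z s) g - ip (Z r) g) \<le> (\<epsilon> * (2 * B * K) * nrm g) * \<bar>s - r\<bar>"
      by (rule mvt_bound[where S = "{t0..t1}", OF Zd[OF g]]) (use Zd_bound[OF g] s r in auto)
    moreover have "ip (Z s) g - ip (Z r) g = (nrm g)\<^sup>2"
      unfolding nrm_square using ip_linear(2)[OF Zc[OF s, THEN c1per_cper] Zc[OF r, THEN c1per_cper] c1per_cper[OF g]]
      by (simp add: g_def)
    ultimately have "nrm g * nrm g \<le> nrm g * (\<epsilon> * (2 * B * K) * \<bar>s - r\<bar>)"
      by (simp add: power2_eq_square mult_ac)
    then have "nrm g \<le> \<epsilon> * (2 * B * K) * \<bar>s - r\<bar>"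
      using nrm_ge_0[of g] \<epsilon> K B_nonneg by (cases "nrm g = 0") (auto simp: mult_le_cancel_left)
    then show ?thesis by (simp add: g_def)
  qed
  \<comment> \<open>The error of the step pulled back by half a step of free flow, which does not
    change its norm.\<close>
  define d where "d = (\<lambda>x. Z t1 x - evol (\<epsilon> * \<tau>) x (Z t0 x))"
  \<comment> \<open>Normalized so that \<open>p t1 = d\<close> and \<open>p t0\<close> is the
    inverse potential step applied to \<open>d\<close>; the increment of the pairing over the step
    is then exactly the square of \<open>nrm d\<close>.\<close>
  define p where "p s = (\<lambda>x. evol (\<epsilon> * (s - t1)) x (d x))" for s
  have t01: "t0 \<in> {t0..t1}" "t1 \<in> {t0..t1}" using t by auto
  have d: "c1per d" unfolding d_def by (intro c1per_diff c1per_evol Zc t01)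
  have p: "c1per (p s)" for s unfolding p_def by (intro c1per_evol d)
  have pn: "nrm (p s) = nrm d" for s unfolding p_def by simp
  have p_shift: "p s x = evol (\<epsilon> * (s - r)) x (p r x)" for s r x
    by (simp add: p_def evol_simps algebra_simps)
  have p_lip: "nrm (\<lambda>x. p s x - p r x) \<le> 2 * B * (\<epsilon> * \<bar>s - r\<bar>) * nrm d" for s r
  proof -
    have "norm (p s x - p r x) \<le> 2 * B * (\<epsilon> * \<bar>s - r\<bar>) * norm (p r x)" for x
      using evol_minus_id[of "\<epsilon> * (s - r)" x "p r x"] \<epsilon> by (simp add: p_shift[of s x r] abs_mult)
    then have "nrm (\<lambda>x. p s x - p r x) \<le> 2 * B * (\<epsilon> * \<bar>s - r\<bar>) * nrm (p r)"
      by (rule nrm_mono[OF cper_diff[OF p[THEN c1per_cper] p[THEN c1per_cper]] p[THEN c1per_cper]])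
         (use B_nonneg \<epsilon> in auto)
    then show ?thesis by (simp add: pn)
  qed
  define J where "J s = ip (Z s) (p s)" for s
  \<comment> \<open>The first term is due to the motion of \<open>Z\<close>, the second to that of
    \<open>p\<close>, with its sign reversed by skewness of the potential.\<close>
  define J' where "J' s = \<epsilon> * (ip (\<lambda>x. pot x (\<Phi> s x)) (dirac_flow (s - c) (p s)) - ip (\<lambda>x. pot x (Z s x)) (p s))" for s
  have J_deriv: "(J has_real_derivative J' s) (at s within {t0..t1})" if s: "s \<in> {t0..t1}" for s
  proof -
    \<comment> \<open>Both factors of the pairing move. Expanding \<open>p\<close> to first order at
      \<open>s\<close> leaves pairings of \<open>Z\<close> with the fixed functions
      \<open>p s\<close> and \<open>q\<close>, plus a remainder quadratic in
      \<open>r - s\<close>.\<close>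
    define q where "q = (\<lambda>x. pot x (p s x))"
    define rem where "rem r = (\<lambda>x. p r x - p s x - (\<epsilon> * (r - s)) *\<^sub>R q x)" for r
    have q: "c1per q" unfolding q_def by (intro c1per_pot p)
    note cp = p[THEN c1per_cper] and cq = c1per_cper[OF q]
    have rc: "cper (rem r)" for r unfolding rem_def by (intro cper_diff cper_scale cp cq)
    have rn: "nrm (rem r) \<le> (2 * B)\<^sup>2 * (\<epsilon> * (r - s))\<^sup>2 * nrm d" for r
    proof -
      have "norm (rem r x) \<le> (2 * B)\<^sup>2 * (\<epsilon> * (r - s))\<^sup>2 * norm (p s x)" for x
        using evol_taylor[of "\<epsilon> * (r - s)" x "p s x"] by (simp add: rem_def q_def p_shift[of r x s])
      then have "nrm (rem r) \<le> (2 * B)\<^sup>2 * (\<epsilon> * (r - s))\<^sup>2 * nrm (p s)"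
        by (rule nrm_mono[OF rc cp]) simp
      then show ?thesis by (simp add: pn)
    qed
    have split: "J r = ip (Z r) (p s) + (\<epsilon> * (r - s)) * ip (Z r) q + ip (Z r) (rem r)" if r: "r \<in> {t0..t1}" for r
    proof -
      note cz = c1per_cper[OF Zc[OF r]]
      have "p r = (\<lambda>x. (p s x + (\<epsilon> * (r - s)) *\<^sub>R q x) + rem r x)" by (simp add: rem_def)
      then show ?thesis
        unfolding J_def using ip_linear(4)[OF cper_add[OF cp cper_scale[OF cq]] rc cz, of s "\<epsilon> * (r - s)" r]
          ip_linear(4)[OF cp cper_scale[OF cq] cz, of s "\<epsilon> * (r - s)"] ip_linear(6)[OF cq cq cz] by simp
    qed
    have "((\<lambda>r. ip (Z r) (rem r)) has_real_derivative 0) (at s within {t0..t1})"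
    proof (rule quadratic_has_derivative_0[OF _ s])
      fix r assume r: "r \<in> {t0..t1}"
      have "\<bar>ip (Z r) (rem r)\<bar> \<le> nrm (Z r) * nrm (rem r)"
        by (intro ip_Cauchy_Schwarz rc c1per_cper Zc r)
      also have "\<dots> \<le> K * ((2 * B)\<^sup>2 * (\<epsilon> * (r - s))\<^sup>2 * nrm d)"
        using Zn[OF r] rn K by (intro mult_mono) auto
      finally show "\<bar>ip (Z r) (rem r)\<bar> \<le> (K * (2 * B)\<^sup>2 * \<epsilon>\<^sup>2 * nrm d) * (r - s)\<^sup>2"
        by (simp add: power_mult_distrib mult_ac)
    qed
    moreover have "((\<lambda>r. ip (Z r) (p s)) has_real_derivative
       \<epsilon> * ip (\<lambda>x. pot x (\<Phi> s x)) (dirac_flow (s - c) (p s))) (at s within {t0..t1})"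
      using Zd[OF p s] by (simp add: has_real_derivative_iff_has_vector_derivative)
    moreover have "((\<lambda>r. (\<epsilon> * (r - s)) * ip (Z r) q) has_real_derivative \<epsilon> * ip (Z s) q) (at s within {t0..t1})"
      using Zd[OF q s] unfolding has_real_derivative_iff_has_vector_derivative[symmetric]
      by (auto intro!: derivative_eq_intros)
    ultimately have "((\<lambda>r. ip (Z r) (p s) + (\<epsilon> * (r - s)) * ip (Z r) q + ip (Z r) (rem r)) has_real_derivative
        \<epsilon> * ip (\<lambda>x. pot x (\<Phi> s x)) (dirac_flow (s - c) (p s)) + \<epsilon> * ip (Z s) q + 0) (at s within {t0..t1})"
      by (intro DERIV_add)
    moreover have "ip (Z s) q = - ip (\<lambda>x. pot x (Z s x)) (p s)"
      by (simp add: ip_def q_def pot_inner)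
    ultimately have "((\<lambda>r. ip (Z r) (p s) + (\<epsilon> * (r - s)) * ip (Z r) q + ip (Z r) (rem r)) has_real_derivative J' s)
       (at s within {t0..t1})"
      by (simp add: J'_def algebra_simps)
    then show ?thesis
      by (rule has_field_derivative_transform_within[OF _ zero_less_one s]) (simp add: split)
  qed
  define k where "k s = ip (\<lambda>x. comm x (Z s x)) (p s)" for s
  \<comment> \<open>The coefficient 20 is 8 + 12, with both the translation constant and the norm of
    \<open>Z s\<close> bounded by \<open>K\<close>.\<close>
  have J'_est: "\<bar>J' s - \<epsilon> * (s - c) * k s\<bar> \<le> \<epsilon> * (20 * B * K * \<tau>\<^sup>2 * nrm d)" if s: "s \<in> {t0..t1}" for s
  proof -
    have sc: "(s - c)\<^sup>2 \<le> \<tau>\<^sup>2" using s \<tau> by (intro power2_le_iff_abs_le[THEN iffD2]) auto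
    have eq: "J' s - \<epsilon> * (s - c) * k s = \<epsilon> * (ip (\<lambda>x. pot x (dirac_flow (s - c) (Z s) x)) (dirac_flow (s - c) (p s))
        - ip (\<lambda>x. pot x (Z s x)) (p s) - (s - c) * k s)"
      by (simp add: J'_def ZF[OF s] algebra_simps)
    have "\<bar>J' s - \<epsilon> * (s - c) * k s\<bar> \<le> \<epsilon> * ((8 * B * K + 12 * B * nrm (Z s)) * (s - c)\<^sup>2 * nrm (p s))"
      unfolding eq unfolding abs_mult k_def abs_of_nonneg[OF \<epsilon>(1)]
      by (rule mult_left_mono[OF pairing_second_order[OF Zc[OF s] Zl[OF s] p] \<epsilon>(1)])
    also have "\<dots> \<le> \<epsilon> * (20 * B * K * \<tau>\<^sup>2 * nrm d)"
    proof -
      have "8 * B * K + 12 * B * nrm (Z s) \<le> 20 * B * K"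
        using mult_left_mono[OF Zn[OF s], of "12 * B"] B_nonneg by simp
      then have "(8 * B * K + 12 * B * nrm (Z s)) * (s - c)\<^sup>2 \<le> 20 * B * K * \<tau>\<^sup>2"
        by (rule mult_mono[OF _ sc]) (use B_nonneg K in auto)
      then show ?thesis unfolding pn using \<epsilon> by (intro mult_left_mono mult_right_mono) auto
    qed
    finally show ?thesis .
  qed
  \<comment> \<open>\<open>Z\<close> and \<open>p\<close> both move at speed proportional to
    \<epsilon>; each contributes 8 to the 16.\<close>
  have k_lip: "\<bar>k s - k c\<bar> \<le> 16 * B\<^sup>2 * K * \<epsilon> * \<bar>s - c\<bar> * nrm d" if s: "s \<in> {t0..t1}" for s
  proof -
    note cz = Zc[THEN c1per_cper] and cp = p[THEN c1per_cper]
    have cd: "cper (\<lambda>x. Z s x - Z c x)" "cper (\<lambda>x. p s x - p c x)" by (intro cper_diff cz cp s c)+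
    have eq: "k s - k c = ip (\<lambda>x. comm x (Z s x - Z c x)) (p s) + ip (\<lambda>x. comm x (Z c x)) (\<lambda>x. p s x - p c x)"
      unfolding k_def comm_diff
      using ip_linear(2)[OF cper_comm[OF cz[OF s]] cper_comm[OF cz[OF c]] cp]
        ip_linear(5)[OF cp cp cper_comm[OF cz[OF c]]] by simp
    have "\<bar>k s - k c\<bar> \<le> nrm (\<lambda>x. comm x (Z s x - Z c x)) * nrm (p s) + nrm (\<lambda>x. comm x (Z c x)) * nrm (\<lambda>x. p s x - p c x)"
      unfolding eq using ip_Cauchy_Schwarz[OF cper_comm[OF cd(1)] cp] ip_Cauchy_Schwarz[OF cper_comm[OF cz[OF c]] cd(2)]
      by (intro order_trans[OF abs_triangle_ineq] add_mono) auto
    also have "\<dots> \<le> (4 * B * (\<epsilon> * (2 * B * K) * \<bar>s - c\<bar>)) * nrm d + (4 * B * K) * (2 * B * (\<epsilon> * \<bar>s - c\<bar>) * nrm d)"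
    proof -
      have n1: "nrm (\<lambda>x. comm x (Z s x - Z c x)) \<le> 4 * B * (\<epsilon> * (2 * B * K) * \<bar>s - c\<bar>)"
        using order_trans[OF nrm_comm[OF cd(1)] mult_left_mono[OF Z_lip[OF s c]]] B_nonneg by simp
      have n2: "nrm (\<lambda>x. comm x (Z c x)) \<le> 4 * B * K"
        using order_trans[OF nrm_comm[OF cz[OF c]] mult_left_mono[OF Zn[OF c]]] B_nonneg by simp
      show ?thesis
        unfolding pn by (rule add_mono[OF mult_right_mono[OF n1 nrm_ge_0] mult_mono[OF n2 p_lip _ nrm_ge_0]])
          (use B_nonneg K in auto)
    qed
    also have "\<dots> = 16 * B\<^sup>2 * K * \<epsilon> * \<bar>s - c\<bar> * nrm d" by (simp add: power2_eq_square algebra_simps)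
    finally show ?thesis .
  qed
  define H where "H s = J s - \<epsilon> * k c * ((s - c)\<^sup>2 / 2)" for s
  define M where "M = (20 * B + 16 * B\<^sup>2) * K * \<epsilon> * \<tau>\<^sup>2"
  have "norm (H t1 - H t0) \<le> (M * nrm d) * \<bar>t1 - t0\<bar>"
  proof (rule mvt_bound[where S = "{t0..t1}"])
    fix s assume s: "s \<in> {t0..t1}"
    have "(H has_real_derivative J' s - \<epsilon> * k c * (s - c)) (at s within {t0..t1})"
      unfolding H_def[abs_def] using J_deriv[OF s] by (auto intro!: derivative_eq_intros)
    then show "(H has_vector_derivative J' s - \<epsilon> * k c * (s - c)) (at s within {t0..t1})"
      by (simp add: has_real_derivative_iff_has_vector_derivative)
    have sc: "\<bar>s - c\<bar> \<le> \<tau>" using s \<tau> by auto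
    \<comment> \<open>This term is quadratic in \<epsilon>; one factor is estimated by 1, so that
      the final bound is linear in \<epsilon>.\<close>
    have "\<epsilon> * \<bar>s - c\<bar> * \<bar>k s - k c\<bar> \<le> \<epsilon> * \<tau> * (16 * B\<^sup>2 * K * 1 * \<tau> * nrm d)"
    proof (rule mult_mono[OF mult_left_mono[OF sc \<epsilon>(1)]])
      have "\<epsilon> * \<bar>s - c\<bar> \<le> 1 * \<tau>" using \<epsilon> sc by (intro mult_mono) auto
      then have "(16 * B\<^sup>2 * K * nrm d) * (\<epsilon> * \<bar>s - c\<bar>) \<le> (16 * B\<^sup>2 * K * nrm d) * (1 * \<tau>)"
        using K by (intro mult_left_mono) auto
      with k_lip[OF s] show "\<bar>k s - k c\<bar> \<le> 16 * B\<^sup>2 * K * 1 * \<tau> * nrm d" by (simp add: mult_ac)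
    qed (use \<epsilon> \<tau> in auto)
    moreover have "J' s - \<epsilon> * k c * (s - c) = (J' s - \<epsilon> * (s - c) * k s) + \<epsilon> * (s - c) * (k s - k c)"
      by (simp add: algebra_simps)
    moreover have "\<bar>\<epsilon> * (s - c) * (k s - k c)\<bar> = \<epsilon> * \<bar>s - c\<bar> * \<bar>k s - k c\<bar>" using \<epsilon> by (simp add: abs_mult)
    ultimately have "\<bar>J' s - \<epsilon> * k c * (s - c)\<bar>
        \<le> \<epsilon> * (20 * B * K * \<tau>\<^sup>2 * nrm d) + \<epsilon> * \<tau> * (16 * B\<^sup>2 * K * 1 * \<tau> * nrm d)"
      using J'_est[OF s] by linarith
    also have "\<dots> = M * nrm d" by (simp add: M_def power2_eq_square algebra_simps)
    finally show "norm (J' s - \<epsilon> * k c * (s - c)) \<le> M * nrm d" by simp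
  qed (use t in auto)
  moreover have "H t1 - H t0 = (nrm d)\<^sup>2"
  proof -
    have "(t1 - c)\<^sup>2 = (t0 - c)\<^sup>2" by (simp add: c_def power2_eq_square field_simps)
    then have "H t1 - H t0 = J t1 - J t0" by (simp add: H_def)
    also have "J t1 = ip (Z t1) d" by (simp add: J_def p_def evol_simps)
    also have "J t0 = ip (\<lambda>x. evol (\<epsilon> * \<tau>) x (Z t0 x)) d"
    proof -
      have "\<epsilon> * (t0 - t1) = - (\<epsilon> * \<tau>)" by (simp add: \<tau>_def algebra_simps)
      then show ?thesis by (simp add: J_def p_def ip_def evol_simps)
    qed
    also have "ip (Z t1) d - \<dots> = ip d d"
      using ip_linear(2)[OF Zc[OF t01(2), THEN c1per_cper] c1per_evol[OF Zc[OF t01(1)], THEN c1per_cper]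
          c1per_cper[OF d]] by (simp add: d_def)
    finally show ?thesis by (simp add: nrm_square)
  qed
  ultimately have "nrm d * nrm d \<le> nrm d * (M * \<tau>)"
    using \<tau> by (simp add: power2_eq_square mult_ac \<tau>_def[symmetric])
  moreover have "0 \<le> M * \<tau>" using B_nonneg K \<epsilon> \<tau> by (simp add: M_def)
  ultimately have "nrm d \<le> M * \<tau>"
    using nrm_ge_0[of d] by (cases "nrm d = 0") (auto simp: mult_le_cancel_left)
  moreover have "nrm (\<lambda>x. \<Phi> t1 x - strang_step \<epsilon> \<tau> (\<Phi> t0) x) = nrm d"
  proof -
    have "Z t0 = dirac_flow (\<tau> / 2) (\<Phi> t0)" by (simp only: Z_def \<tau>(3))
    moreover have "\<Phi> t1 = dirac_flow (\<tau> / 2) (Z t1)" 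
      by (rule ZF[OF t01(2), unfolded \<tau>(2), symmetric])
    ultimately show ?thesis
      unfolding strang_step_def d_def
      using nrm_dirac_flow_diff[OF Zc[OF t01(2)] c1per_evol[OF Zc[OF t01(1)]], of "\<tau> / 2"] by simp
  qed
  ultimately show ?thesis by (simp add: M_def \<tau>_def power2_eq_square power3_eq_cube mult_ac)
qed

section \<open>Stability and accumulation of local errors\<close>

lemma c1per_strang_step: "c1per u \<Longrightarrow> c1per (strang_step \<epsilon> \<tau> u)"
  unfolding strang_step_def by (intro c1per_dirac_flow c1per_evol)

text \<open>Stability with constant exactly 1: both half steps and the pointwise rotation preserve
  norms of differences.\<close>

lemma nrm_strang_step_diff:
  assumes "c1per u" "c1per v"
  shows "nrm (\<lambda>x. strang_step \<epsilon> \<tau> u x - strang_step \<epsilon> \<tau> v x) = nrm (\<lambda>x. u x - v x)"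
proof -
  have "nrm (\<lambda>x. strang_step \<epsilon> \<tau> u x - strang_step \<epsilon> \<tau> v x)
      = nrm (\<lambda>x. evol (\<epsilon> * \<tau>) x (dirac_flow (\<tau> / 2) u x) - evol (\<epsilon> * \<tau>) x (dirac_flow (\<tau> / 2) v x))"
    unfolding strang_step_def by (intro nrm_dirac_flow_diff c1per_evol c1per_dirac_flow assms)
  also have "\<dots> = nrm (\<lambda>x. dirac_flow (\<tau> / 2) u x - dirac_flow (\<tau> / 2) v x)"
    by (simp flip: evol_simps(5))
  also have "\<dots> = nrm (\<lambda>x. u x - v x)" by (intro nrm_dirac_flow_diff assms)
  finally show ?thesis .
qed

text \<open>\<open>expT\<close> is identified only on periodic C^1 functions, so this regularity has
  to be carried along the iteration.\<close>

lemma strang_eq_step: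
  assumes "c1per u" "0 \<le> \<tau>"
  shows "c1per (strang a b \<epsilon> \<tau> V A1 u n)"
    and "strang a b \<epsilon> \<tau> V A1 u (Suc n) = strang_step \<epsilon> \<tau> (strang a b \<epsilon> \<tau> V A1 u n)"
proof -
  have step: "strang a b \<epsilon> \<tau> V A1 u (Suc n) = strang_step \<epsilon> \<tau> (strang a b \<epsilon> \<tau> V A1 u n)"
    if "c1per (strang a b \<epsilon> \<tau> V A1 u n)" for n
    using that assms(2)
    by (simp add: strang_step_def expT_eq_dirac_flow mexp_Vmat c1per_dirac_flow
        c1per_evol flip: evol_def)
  show c: "c1per (strang a b \<epsilon> \<tau> V A1 u n)" for n
  proof (induction n)
    case (Suc n)
    then show ?case unfolding step[OF Suc] by (rule c1per_strang_step)
  qed (simp add: assms)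
  show "strang a b \<epsilon> \<tau> V A1 u (Suc n) = strang_step \<epsilon> \<tau> (strang a b \<epsilon> \<tau> V A1 u n)"
    by (rule step[OF c])
qed

text \<open>Each step adds the local error made from the exact solution and transports the previous
  error isometrically. No growth factor arises, so the long time horizon costs only the number of
  steps.\<close>

lemma strang_global_error:
  assumes \<Phi>: "dsol 0 Tend (\<lambda>s x. \<epsilon> *\<^sub>R pot x (\<Phi> s x)) \<Phi>" and \<epsilon>: "0 \<le> \<epsilon>" "\<epsilon> \<le> 1"
    and bound: "\<And>s. s \<in> {0..Tend} \<Longrightarrow> nrm (\<Phi> s) \<le> K" and lip: "\<And>s. s \<in> {0..Tend} \<Longrightarrow> tlip K (\<Phi> s)"
    and \<tau>: "0 \<le> \<tau>" and n: "real n * \<tau> \<le> Tend"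
  shows "nrm (\<lambda>x. \<Phi> (real n * \<tau>) x - strang a b \<epsilon> \<tau> V A1 (\<Phi> 0) n x)
    \<le> real n * ((20 * B + 16 * B\<^sup>2) * K * \<epsilon> * \<tau> ^ 3)"
  using n
proof (induction n)
  case 0
  show ?case by (simp add: nrm_def ip_def)
next
  case (Suc n)
  define t0 t1 where "t0 = real n * \<tau>" and "t1 = real (Suc n) * \<tau>"
  define u where "u = strang a b \<epsilon> \<tau> V A1 (\<Phi> 0) n"
  have t: "t1 - t0 = \<tau>" "0 \<le> t0" "t0 \<le> t1" "t1 \<le> Tend"
    using Suc.prems \<tau> by (simp_all add: t0_def t1_def algebra_simps)
  have c: "c1per (\<Phi> s)" if "s \<in> {0..Tend}" for s using dsol_c1per[OF \<Phi> that] .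
  have u: "c1per u" unfolding u_def by (intro strang_eq_step(1) c \<tau>) (use t in auto)
  have c01: "c1per (\<Phi> t0)" "c1per (\<Phi> t1)" using c t by auto
  have "nrm (\<lambda>x. \<Phi> t1 x - strang_step \<epsilon> \<tau> u x) = nrm (\<lambda>x. (\<Phi> t1 x - strang_step \<epsilon> \<tau> (\<Phi> t0) x)
      + (strang_step \<epsilon> \<tau> (\<Phi> t0) x - strang_step \<epsilon> \<tau> u x))" by simp
  also have "\<dots> \<le> nrm (\<lambda>x. \<Phi> t1 x - strang_step \<epsilon> \<tau> (\<Phi> t0) x)
      + nrm (\<lambda>x. strang_step \<epsilon> \<tau> (\<Phi> t0) x - strang_step \<epsilon> \<tau> u x)"
    by (intro nrm_triangle cper_diff c1per_cper c1per_strang_step c01 u)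
  also have "\<dots> \<le> (20 * B + 16 * B\<^sup>2) * K * \<epsilon> * \<tau> ^ 3 + real n * ((20 * B + 16 * B\<^sup>2) * K * \<epsilon> * \<tau> ^ 3)"
  proof (rule add_mono)
    have "dsol t0 t1 (\<lambda>s x. \<epsilon> *\<^sub>R pot x (\<Phi> s x)) \<Phi>" using dsol_subinterval[OF \<Phi>] t by auto
    from strang_local_error[OF this t(3) \<epsilon> bound lip] t
    show "nrm (\<lambda>x. \<Phi> t1 x - strang_step \<epsilon> \<tau> (\<Phi> t0) x) \<le> (20 * B + 16 * B\<^sup>2) * K * \<epsilon> * \<tau> ^ 3" by auto
    show "nrm (\<lambda>x. strang_step \<epsilon> \<tau> (\<Phi> t0) x - strang_step \<epsilon> \<tau> u x)
        \<le> real n * ((20 * B + 16 * B\<^sup>2) * K * \<epsilon> * \<tau> ^ 3)"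
      using Suc.IH t unfolding nrm_strang_step_diff[OF c01(1) u] by (simp add: u_def t0_def)
  qed
  also have "\<dots> = real (Suc n) * ((20 * B + 16 * B\<^sup>2) * K * \<epsilon> * \<tau> ^ 3)" by (simp add: algebra_simps)
  also have "strang_step \<epsilon> \<tau> u = strang a b \<epsilon> \<tau> V A1 (\<Phi> 0) (Suc n)"
    unfolding u_def by (rule strang_eq_step(2)[symmetric, OF _ \<tau>]) (use c t in auto)
  finally show ?case by (simp add: t1_def)
qed

end

section \<open>The Sobolev hypotheses\<close>

lemma integral_increments_continuous:
  fixes f g :: "real \<Rightarrow> 'a::euclidean_space"
  assumes "\<And>x y. x \<le> y \<Longrightarrow> (g has_integral f y - f x) {x..y}"
  shows "continuous_on UNIV f"
proof (rule continuous_at_imp_continuous_on, rule ballI)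
  fix x :: real
  have "continuous_on {x - 1..x + 1} (\<lambda>y. f (x - 1) + integral {x - 1..y} g)"
    using assms[of "x - 1" "x + 1"]
    by (intro continuous_intros indefinite_integral_continuous_1) auto
  moreover have "f (x - 1) + integral {x - 1..y} g = f y" if "y \<in> {x - 1..x + 1}" for y
    using integral_unique[OF assms[of "x - 1" y]] that by simp
  ultimately have "continuous_on {x - 1..x + 1} f" by (rule continuous_on_eq)
  then show "isCont f x" by (rule continuous_on_interior) simp
qed

lemma integral_increments_deriv:
  fixes f g :: "real \<Rightarrow> 'a::euclidean_space"
  assumes "\<And>x y. x \<le> y \<Longrightarrow> (g has_integral f y - f x) {x..y}" and g: "continuous_on UNIV g"
  shows "(f has_vector_derivative g x) (at x)"
proof -
  have "((\<lambda>y. integral {x - 1..y} g) has_vector_derivative g x) (at x within {x - 1..x + 1})"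
    by (rule integral_has_vector_derivative) (auto intro: continuous_on_subset[OF g])
  then have "((\<lambda>y. f y - f (x - 1)) has_vector_derivative g x) (at x within {x - 1..x + 1})"
    by (rule has_vector_derivative_transform[rotated 2])
      (auto simp: integral_unique[OF assms(1)])
  then have "((\<lambda>y. f y - f (x - 1)) has_vector_derivative g x) (at x)"
    by (simp add: at_within_Icc_at)
  from has_vector_derivative_add[OF this has_vector_derivative_const[of "f (x - 1)"]] show ?thesis by simp
qed

context period_cell
begin

text \<open>With at least two links, \<open>D 1\<close> is itself an indefinite integral and hence
  continuous, which upgrades the weak derivative of \<open>u\<close> to a classical one.\<close>

lemma deriv_chain_C1:
  fixes u :: "real \<Rightarrow> 'a::euclidean_space"
  assumes "deriv_chain a b m u D" "m \<ge> 2"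
  shows "cper u" "cper (D 1)" "\<And>x. (u has_vector_derivative D 1 x) (at x)"
proof -
  have D: "\<And>k x y. k < m \<Longrightarrow> x \<le> y \<Longrightarrow> (D (Suc k) has_integral D k y - D k x) {x..y}"
    and u: "D 0 = u" "periodic_fun a b u" using assms(1) by (auto simp: deriv_chain_def)
  have c1: "continuous_on UNIV (D 1)"
    using D[of 1] assms(2) by (intro integral_increments_continuous[of "D 2"]) (auto simp: numeral_2_eq_2)
  have inc: "\<And>x y. x \<le> y \<Longrightarrow> (D 1 has_integral u y - u x) {x..y}"
    using D[of 0] u assms(2) by auto
  show d: "\<And>x. (u has_vector_derivative D 1 x) (at x)"
    by (rule integral_increments_deriv[OF inc c1])
  show "cper u" "cper (D 1)"
    using c1 u(2) vector_derivative_periodic[OF u(2) d] integral_increments_continuous[OF inc]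
    by (auto simp: cper_def)
qed

text \<open>The Lipschitz constant of \<open>D 1\<close> is a bound on \<open>D 2\<close>. For
  \<open>m = 2\<close> this is the essential bound; for larger \<open>m\<close> the function
  \<open>D 2\<close> is continuous and periodic, hence bounded by compactness.\<close>

lemma W_per_C11:
  assumes "W_per a b m f" "m \<ge> 2"
  obtains f' B where "periodic_fun a b f" "\<And>x. (f has_vector_derivative f' x) (at x)"
    "\<And>x. \<bar>f x\<bar> \<le> B" "\<And>x. \<bar>f' x\<bar> \<le> B" "\<And>x y. \<bar>f' x - f' y\<bar> \<le> B * \<bar>x - y\<bar>"
proof -
  obtain D M where D: "deriv_chain a b m f D" and M: "AE x in lborel. \<bar>D m x\<bar> \<le> M"
    using assms(1) by (auto simp: W_per_def)
  note C1 = deriv_chain_C1[OF D assms(2)]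
  have inc: "(D (Suc k) has_integral D k y - D k x) {x..y}" if "k < m" "x \<le> y" for k x y
    using D that by (auto simp: deriv_chain_def)
  have inc2: "(D 2 has_integral D 1 y - D 1 x) {x..y}" if "x \<le> y" for x y
    using inc[of 1 x y] that assms(2) by (simp add: numeral_2_eq_2)
  obtain L where L: "0 \<le> L" "\<And>x y. x \<le> y \<Longrightarrow> \<bar>D 1 y - D 1 x\<bar> \<le> L * (y - x)"
  proof (cases "m = 2")
    case True
    define N where "N = {x. \<not> \<bar>D 2 x\<bar> \<le> M}"
    have meas: "D 2 \<in> borel_measurable lborel" using D True by (simp add: deriv_chain_def)
    then have "N \<in> sets lborel" unfolding N_def by measurable
    moreover have "AE x in lborel. x \<notin> N" using M True by (auto simp: N_def)
    ultimately have "N \<in> null_sets lborel" using AE_iff_null_sets by blast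
    then have N: "negligible N" by (simp add: negligible_iff_null_sets null_sets_completionI)
    have "\<bar>D 1 y - D 1 x\<bar> \<le> \<bar>M\<bar> * (y - x)" if "x \<le> y" for x y
    proof -
      \<comment> \<open>Setting the integrand to 0 on the null set makes the bound hold everywhere
        without changing the integral; \<open>\<bar>M\<bar>\<close> supplies the non-negative
        constant.\<close>
      have "((\<lambda>x. if x \<in> N then 0 else D 2 x) has_integral D 1 y - D 1 x) (cbox x y)"
        using inc2[OF that] by (intro has_integral_spike[OF N _ inc2[OF that, folded cbox_interval]]) auto
      from has_integral_bound[OF _ this, of "\<bar>M\<bar>"] that show ?thesis
        by (auto simp: N_def)
    qed
    then show ?thesis using that[of "\<bar>M\<bar>"] by auto
  next
    case False
    then have "m > 2" using assms(2) by simp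
    then have c2: "continuous_on UNIV (D 2)"
      using inc[of 2] by (intro integral_increments_continuous[of "D 3"]) (auto simp: eval_nat_numeral)
    have d2: "(D 1 has_vector_derivative D 2 x) (at x)" for x
      by (rule integral_increments_deriv[OF inc2 c2])
    then have "cper (D 2)"
      using c2 C1(2) vector_derivative_periodic[of "D 1" "D 2"] by (simp add: cper_def)
    then obtain L where L: "0 \<le> L" "\<And>x. norm (D 2 x) \<le> L" using cper_bounded by blast
    have "\<bar>D 1 y - D 1 x\<bar> \<le> L * (y - x)" if "x \<le> y" for x y
      using mvt_bound[of UNIV "D 1" "D 2" L x y] d2 L that by simp
    with L(1) show ?thesis by (rule that)
  qed
  have L': "\<bar>D 1 x - D 1 y\<bar> \<le> L * \<bar>x - y\<bar>" for x y
    using L(2)[of x y] L(2)[of y x] by (cases "x \<le> y") (auto simp: abs_minus_commute)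
  obtain B0 B1 where B: "\<And>x. norm (f x) \<le> B0" "\<And>x. norm (D 1 x) \<le> B1"
    using C1 cper_bounded by metis
  show ?thesis
  proof (rule that[of "D 1" "max L (max B0 B1)"])
    show "\<bar>D 1 x - D 1 y\<bar> \<le> max L (max B0 B1) * \<bar>x - y\<bar>" for x y
      using L'[of x y] mult_right_mono[of L "max L (max B0 B1)" "\<bar>x - y\<bar>"] by linarith
    show "\<bar>f x\<bar> \<le> max L (max B0 B1)" "\<bar>D 1 x\<bar> \<le> max L (max B0 B1)" for x
      using B[of x] by (simp_all add: le_max_iff_disj)
  qed (use C1 in \<open>auto simp: cper_def\<close>)
qed

text \<open>Every summand of the Sobolev norm is non-negative, so each L^2 norm is at most
  \<open>K\<close>: \<open>k = 0\<close> controls the size and \<open>k = 1\<close> the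
  translations.\<close>

lemma Hm_bounded_H1:
  assumes "Hm_bounded a b m K u" "m \<ge> 2"
  shows "nrm u \<le> K" "tlip K u"
proof -
  obtain D where D: "deriv_chain a b m u D"
    and K: "sqrt (\<Sum>k\<le>m. LINT x:{a..b}|lborel. (norm (D k x))\<^sup>2) \<le> K"
    using assms(1) by (auto simp: Hm_bounded_def)
  note C1 = deriv_chain_C1[OF D assms(2)]
  have le: "L2norm a b (D k) \<le> K" if "k \<le> m" for k
  proof -
    have "(LINT x:{a..b}|lborel. (norm (D k x))\<^sup>2) \<le> (\<Sum>k\<le>m. LINT x:{a..b}|lborel. (norm (D k x))\<^sup>2)"
      using that by (intro member_le_sum) (auto simp: set_lebesgue_integral_def intro!: integral_nonneg_AE)
    then show ?thesis unfolding L2norm_def using K real_sqrt_le_mono order_trans by blast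
  qed
  have "D 0 = u" using D by (simp add: deriv_chain_def)
  then show "nrm u \<le> K" using le[of 0] L2norm_eq_nrm[OF C1(1)] by simp
  have "nrm (D 1) \<le> K" using le[of 1] L2norm_eq_nrm[OF C1(2)] assms(2) by simp
  then show "tlip K u"
    using C1 by (intro tlip_from_deriv[OF c1perI C1(3,2)]) (auto simp: cper_def)
qed

end

theorem theorem3p1:
  fixes a b T K :: real and m :: nat and V A1 :: "real \<Rightarrow> real"
  assumes "a < b" and "T > 0" and "m \<ge> 2"
    and "W_per a b m V" and "W_per a b m A1"
  shows "\<exists>C1>0. \<forall>\<epsilon> \<Phi> \<tau> n.
           0 < \<epsilon> \<and> \<epsilon> \<le> 1 \<and> dirac_solution a b \<epsilon> V A1 (T / \<epsilon>) \<Phi> \<and>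
           (\<forall>t\<in>{0..T / \<epsilon>}. Hm_bounded a b m K (\<Phi> t)) \<and>
           \<tau> > 0 \<and> real n \<le> (T / \<epsilon>) / \<tau>
           \<longrightarrow> L2norm a b (\<lambda>x. \<Phi> (real n * \<tau>) x - strang a b \<epsilon> \<tau> V A1 (\<Phi> 0) n x)
                 \<le> C1 * \<epsilon> * (real n * \<tau>) * \<tau>\<^sup>2
             \<and> C1 * \<epsilon> * (real n * \<tau>) * \<tau>\<^sup>2 \<le> C1 * T * \<tau>\<^sup>2"
proof -
  interpret period_cell a b by unfold_locales fact
  obtain V' B1 where V: "periodic_fun a b V" "\<And>x. (V has_vector_derivative V' x) (at x)"
    "\<And>x. \<bar>V x\<bar> \<le> B1" "\<And>x. \<bar>V' x\<bar> \<le> B1" "\<And>x y. \<bar>V' x - V' y\<bar> \<le> B1 * \<bar>x - y\<bar>"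
    using W_per_C11[OF assms(4,3)] by blast
  obtain A1' B2 where A: "periodic_fun a b A1" "\<And>x. (A1 has_vector_derivative A1' x) (at x)"
    "\<And>x. \<bar>A1 x\<bar> \<le> B2" "\<And>x. \<bar>A1' x\<bar> \<le> B2" "\<And>x y. \<bar>A1' x - A1' y\<bar> \<le> B2 * \<bar>x - y\<bar>"
    using W_per_C11[OF assms(5,3)] by blast
  define B where "B = max B1 B2"
  interpret dirac_potential a b V A1 V' A1' B
  proof
    show "\<bar>V' x - V' y\<bar> \<le> B * \<bar>x - y\<bar>" "\<bar>A1' x - A1' y\<bar> \<le> B * \<bar>x - y\<bar>" for x y
      using V(5)[of x y] A(5)[of x y] mult_right_mono[of B1 B "\<bar>x - y\<bar>"] mult_right_mono[of B2 B "\<bar>x - y\<bar>"]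
      by (auto simp: B_def)
    show "\<bar>V x\<bar> \<le> B" "\<bar>A1 x\<bar> \<le> B" "\<bar>V' x\<bar> \<le> B" "\<bar>A1' x\<bar> \<le> B" for x
      using V(3,4)[of x] A(3,4)[of x] by (simp_all add: B_def le_max_iff_disj)
  qed (fact V A)+
  \<comment> \<open>The statement asks for a positive constant for every \<open>K\<close>: the
    absolute value handles negative \<open>K\<close>, and the added 1 the case where the product
    vanishes.\<close>
  define C where "C = (20 * B + 16 * B\<^sup>2) * \<bar>K\<bar> + 1"
  have C: "C > 0" unfolding C_def using B_nonneg by (intro add_nonneg_pos mult_nonneg_nonneg) auto
  show ?thesis
  proof (rule exI[of _ C], rule conjI[OF C], intro allI impI, elim conjE)
    fix \<epsilon> \<Phi> \<tau> n
    assume \<epsilon>: "0 < \<epsilon>" "\<epsilon> \<le> 1" and sol: "dirac_solution a b \<epsilon> V A1 (T / \<epsilon>) \<Phi>"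
      and Hm: "\<forall>t\<in>{0..T / \<epsilon>}. Hm_bounded a b m K (\<Phi> t)"
      and \<tau>: "\<tau> > 0" and n: "real n \<le> (T / \<epsilon>) / \<tau>"
    have n': "real n * \<tau> \<le> T / \<epsilon>" using n \<tau> by (simp only: pos_le_divide_eq)
    have "(\<epsilon> *\<^sub>R Vmat V A1 x) *v v = \<epsilon> *\<^sub>R pot x v" for x v
      unfolding pot_def Vmat_mult[symmetric]
      by (simp add: vec_eq_iff matrix_vector_mult_def scaleR_sum_right)
    then have \<Phi>: "dsol 0 (T / \<epsilon>) (\<lambda>s x. \<epsilon> *\<^sub>R pot x (\<Phi> s x)) \<Phi>"
      using sol by (simp add: dirac_solution_def classical_sol_iff_dsol)
    have K: "nrm (\<Phi> s) \<le> K" "tlip K (\<Phi> s)" if "s \<in> {0..T / \<epsilon>}" for s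
      using Hm_bounded_H1[OF _ assms(3)] Hm that by auto
    have t: "0 \<in> {0..T / \<epsilon>}" "real n * \<tau> \<in> {0..T / \<epsilon>}" using n' \<tau> \<epsilon> assms(2) by auto
    have "c1per (strang a b \<epsilon> \<tau> V A1 (\<Phi> 0) n)" "c1per (\<Phi> (real n * \<tau>))"
      using dsol_c1per[OF \<Phi>] t \<tau> by (auto intro!: strang_eq_step)
    then have "L2norm a b (\<lambda>x. \<Phi> (real n * \<tau>) x - strang a b \<epsilon> \<tau> V A1 (\<Phi> 0) n x)
       = nrm (\<lambda>x. \<Phi> (real n * \<tau>) x - strang a b \<epsilon> \<tau> V A1 (\<Phi> 0) n x)"
      by (intro L2norm_eq_nrm cper_diff c1per_cper)
    also have "\<dots> \<le> real n * ((20 * B + 16 * B\<^sup>2) * K * \<epsilon> * \<tau> ^ 3)"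
      using \<epsilon> \<tau> by (intro strang_global_error[OF \<Phi> _ _ K _ n']) auto
    also have "\<dots> = ((20 * B + 16 * B\<^sup>2) * K) * (\<epsilon> * (real n * \<tau>) * \<tau>\<^sup>2)"
      by (simp add: power2_eq_square power3_eq_cube)
    also have "\<dots> \<le> C * (\<epsilon> * (real n * \<tau>) * \<tau>\<^sup>2)"
    proof (rule mult_right_mono)
      have "(20 * B + 16 * B\<^sup>2) * K \<le> (20 * B + 16 * B\<^sup>2) * \<bar>K\<bar>"
        using B_nonneg by (intro mult_left_mono) auto
      then show "(20 * B + 16 * B\<^sup>2) * K \<le> C" by (simp add: C_def)
    qed (use \<epsilon> \<tau> in auto)
    finally have err: "L2norm a b (\<lambda>x. \<Phi> (real n * \<tau>) x - strang a b \<epsilon> \<tau> V A1 (\<Phi> 0) n x)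
        \<le> C * \<epsilon> * (real n * \<tau>) * \<tau>\<^sup>2" by (simp add: mult.assoc)
    have "\<epsilon> * (real n * \<tau>) \<le> T" using n' \<epsilon> by (simp add: pos_le_divide_eq mult.commute)
    then have "C * (\<epsilon> * (real n * \<tau>)) * \<tau>\<^sup>2 \<le> C * T * \<tau>\<^sup>2"
      using C by (intro mult_right_mono mult_left_mono) auto
    with err show "L2norm a b (\<lambda>x. \<Phi> (real n * \<tau>) x - strang a b \<epsilon> \<tau> V A1 (\<Phi> 0) n x)
           \<le> C * \<epsilon> * (real n * \<tau>) * \<tau>\<^sup>2 \<and> C * \<epsilon> * (real n * \<tau>) * \<tau>\<^sup>2 \<le> C * T * \<tau>\<^sup>2"
      by (simp add: mult.assoc)
  qed
qed

end
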